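(* There is an isomorphism and an equivalence of 2-categories $$\mathbf{Lex}\;\cong\;\mathbf{CompCat}^{\mathrm{str2}}_{\mathrm{rtd},\mathrm{triv}}\;\simeq\;\mathbf{CompCat}_{\mathrm{rtd},\mathrm{triv}},$$ where $\mathbf{Lex}$ is the 2-category of categories with finite limits, and the last two are the 2-categories of rooted trivial comprehension categories, with strict and pseudo maps respectively.
   Context: **Comprehension categories.** A comprehension category $(\mathcal C,\mathcal T,p,\chi)$ is a category $\mathcal C$, a fibration $p:\mathcal T\to\mathcal C$, and a functor $\chi:\mathcal T\to\mathcal C^{\to}$ to the arrow category with $\mathrm{cod}\circ\chi=p$ strictly, sending $p$-cartesian maps to pullback squares. For $A\in\mathcal T_\Gamma=p^{-1}(\Gamma)$ the domain of $\chi(A)$ is written $\Gamma.A$. A *pseudo map* $(F,\bar F,\varphi)$ is a functor $F:\mathcal C\to\mathcal C'$, a functor $\bar F:\mathcal T\to\mathcal T'$ strictly over $F$ preserving cartesian maps, and a natural isomorphism $\varphi:\chi'\bar F\cong F^{\to}\chi$ lying strictly over the identity of $F$; it is *strict* if $\chi'\bar F=F^{\to}\chi$ and $\varphi$ is the identity. A *transformation* $(F,\bar F,\varphi)\Rightarrow(G,\bar G,\gamma)$ is a natural transformation $\alpha:F\Rightarrow G$ and another $\bar\alpha:\bar F\Rightarrow\bar G$ strictly over $\alpha$, with $\gamma_A\circ\chi'(\bar\alpha_A)=\alpha_{\Gamma.A}\circ\varphi_A$ for all $A\in\mathcal T_\Gamma$. A comprehension category is *trivial* if $\chi$ is an identity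 (so $\mathcal T=\mathcal C^{\to}$ and $p=\mathrm{cod}$). It is *rooted* if equipped with a distinguished terminal object $1$ such that every object is isomorphic to an iterated context extension $1.A_0\ldots A_{n-1}$, $n\ge0$, with each $A_k\in\mathcal T_{1.A_0\ldots A_{k-1}}$. Maps of rooted comprehension categories preserve $1$ up to specified isomorphism (also in the strict version, where comprehension is preserved strictly but the root not necessarily so), and transformations commute at $1$ with these isomorphisms. **Finite-limit categories.** $\mathbf{Lex}$ is the 2-category of categories with finite limits, functors preserving finite limits, and natural transformations. For the isomorphism of 2-categories, a terminal object is regarded as chosen (but need only be preserved up to isomorphism). **Conventions.** 2-categories and 2-functors are strict; $\cong$ is isomorphism of 2-categories; an equivalence $\simeq$ is a 2-functor inducing equivalences on hom-categories and surjective on objects up to internal equivalence. *)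

theory Defs
  imports "HOL-Library.FuncSet"
begin

text \<open>
  Categories, functors and transformations are built on explicit carrier sets. All structure maps
  are extensional (\<open>undefined\<close> off their domain), so that HOL equality of categories, functors and
  transformations is equality of the mathematical objects. This matters because the 2-categorical
  notions below are strict.
\<close>

section \<open>Categories\<close>

record ('o, 'a) cat =
  Ob :: "'o set"
  Ar :: "'a set"
  Dom :: "'a \<Rightarrow> 'o"
  Cod :: "'a \<Rightarrow> 'o"
  Idn :: "'o \<Rightarrow> 'a"
  Cmp :: "'a \<Rightarrow> 'a \<Rightarrow> 'a"  \<comment> \<open>\<open>Cmp C g f\<close> is \<open>g\<close> after \<open>f\<close>\<close>

definition homset :: "('o, 'a) cat \<Rightarrow> 'o \<Rightarrow> 'o \<Rightarrow> 'a set" where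
  "homset C x y = {f \<in> Ar C. Dom C f = x \<and> Cod C f = y}"

definition composable :: "('o, 'a) cat \<Rightarrow> 'a \<Rightarrow> 'a \<Rightarrow> bool" where
  "composable C g f \<longleftrightarrow> g \<in> Ar C \<and> f \<in> Ar C \<and> Dom C g = Cod C f"

locale category =
  fixes C :: "('o, 'a) cat"
  assumes Dom_ext: "Dom C \<in> Ar C \<rightarrow>\<^sub>E Ob C"
    and Cod_ext: "Cod C \<in> Ar C \<rightarrow>\<^sub>E Ob C"
    and Idn_ext: "Idn C \<in> extensional (Ob C)"
    and Idn_hom: "x \<in> Ob C \<Longrightarrow> Idn C x \<in> homset C x x"
    and Cmp_ext: "\<not> composable C g f \<Longrightarrow> Cmp C g f = undefined"
    and Cmp_hom: "f \<in> homset C x y \<Longrightarrow> g \<in> homset C y z \<Longrightarrow> Cmp C g f \<in> homset C x z"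
    and Cmp_assoc: "composable C h g \<Longrightarrow> composable C g f \<Longrightarrow>
      Cmp C h (Cmp C g f) = Cmp C (Cmp C h g) f"
    and Cmp_Idn_right: "f \<in> Ar C \<Longrightarrow> Cmp C f (Idn C (Dom C f)) = f"
    and Cmp_Idn_left: "f \<in> Ar C \<Longrightarrow> Cmp C (Idn C (Cod C f)) f = f"

definition mk_cat ::
  "'o set \<Rightarrow> 'a set \<Rightarrow> ('a \<Rightarrow> 'o) \<Rightarrow> ('a \<Rightarrow> 'o) \<Rightarrow> ('o \<Rightarrow> 'a) \<Rightarrow> ('a \<Rightarrow> 'a \<Rightarrow> 'a) \<Rightarrow> ('o, 'a) cat" where
  "mk_cat X A d c i m =
    \<lparr>Ob = X, Ar = A, Dom = restrict d A, Cod = restrict c A, Idn = restrict i X,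
     Cmp = (\<lambda>g f. if g \<in> A \<and> f \<in> A \<and> d g = c f then m g f else undefined)\<rparr>"

definition full_subcat :: "('o, 'a) cat \<Rightarrow> 'o set \<Rightarrow> ('o, 'a) cat" where
  "full_subcat C S =
    mk_cat (Ob C \<inter> S) {f \<in> Ar C. Dom C f \<in> S \<and> Cod C f \<in> S} (Dom C) (Cod C) (Idn C) (Cmp C)"

definition prod_cat :: "('o, 'a) cat \<Rightarrow> ('p, 'b) cat \<Rightarrow> ('o \<times> 'p, 'a \<times> 'b) cat" where
  "prod_cat C D =
    mk_cat (Ob C \<times> Ob D) (Ar C \<times> Ar D) (map_prod (Dom C) (Dom D)) (map_prod (Cod C) (Cod D))
      (map_prod (Idn C) (Idn D)) (\<lambda>(g, g') (f, f'). (Cmp C g f, Cmp D g' f'))"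

definition iso_arr :: "('o, 'a) cat \<Rightarrow> 'a \<Rightarrow> bool" where
  "iso_arr C f \<longleftrightarrow> f \<in> Ar C \<and> (\<exists>g \<in> homset C (Cod C f) (Dom C f).
     Cmp C g f = Idn C (Dom C f) \<and> Cmp C f g = Idn C (Cod C f))"

definition isomorphic :: "('o, 'a) cat \<Rightarrow> 'o \<Rightarrow> 'o \<Rightarrow> bool" where
  "isomorphic C x y \<longleftrightarrow> (\<exists>f \<in> homset C x y. iso_arr C f)"

definition terminal :: "('o, 'a) cat \<Rightarrow> 'o \<Rightarrow> bool" where
  "terminal C t \<longleftrightarrow> t \<in> Ob C \<and> (\<forall>x \<in> Ob C. \<exists>!f. f \<in> homset C x t)"


section \<open>Functors and natural transformations\<close>

record ('o, 'a, 'p, 'b) functr =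
  fob :: "'o \<Rightarrow> 'p"
  far :: "'a \<Rightarrow> 'b"

locale is_functor = C: category C + D: category D
  for C :: "('o, 'a) cat" and D :: "('p, 'b) cat" +
  fixes F :: "('o, 'a, 'p, 'b) functr"
  assumes fob_ext: "fob F \<in> Ob C \<rightarrow>\<^sub>E Ob D"
    and far_ext: "far F \<in> extensional (Ar C)"
    and far_hom: "f \<in> homset C x y \<Longrightarrow> far F f \<in> homset D (fob F x) (fob F y)"
    and far_Idn: "x \<in> Ob C \<Longrightarrow> far F (Idn C x) = Idn D (fob F x)"
    and far_Cmp: "composable C g f \<Longrightarrow> far F (Cmp C g f) = Cmp D (far F g) (far F f)"

definition mk_functor ::
  "('o, 'a) cat \<Rightarrow> ('o \<Rightarrow> 'p) \<Rightarrow> ('a \<Rightarrow> 'b) \<Rightarrow> ('o, 'a, 'p, 'b) functr" where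
  "mk_functor C u v = \<lparr>fob = restrict u (Ob C), far = restrict v (Ar C)\<rparr>"

definition id_functor :: "('o, 'a) cat \<Rightarrow> ('o, 'a, 'o, 'a) functr" where
  "id_functor C = mk_functor C (\<lambda>x. x) (\<lambda>f. f)"

text \<open>In \<open>comp_functor C G F\<close>, the argument \<open>C\<close> is the domain of \<open>F\<close>.\<close>

definition comp_functor :: "('o, 'a) cat \<Rightarrow> ('p, 'b, 'q, 'c) functr \<Rightarrow> ('o, 'a, 'p, 'b) functr \<Rightarrow>
    ('o, 'a, 'q, 'c) functr" where
  "comp_functor C G F = mk_functor C (\<lambda>x. fob G (fob F x)) (\<lambda>f. far G (far F f))"

locale nat_trans = F: is_functor C D F + G: is_functor C D G
  for C :: "('o, 'a) cat" and D :: "('p, 'b) cat" and F G +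
  fixes \<alpha> :: "'o \<Rightarrow> 'b"
  assumes comp_ext: "\<alpha> \<in> extensional (Ob C)"
    and comp_hom: "x \<in> Ob C \<Longrightarrow> \<alpha> x \<in> homset D (fob F x) (fob G x)"
    and natural: "f \<in> homset C x y \<Longrightarrow> Cmp D (\<alpha> y) (far F f) = Cmp D (far G f) (\<alpha> x)"

definition nat_iso :: "('o, 'a) cat \<Rightarrow> ('p, 'b) cat \<Rightarrow> ('o, 'a, 'p, 'b) functr \<Rightarrow>
    ('o, 'a, 'p, 'b) functr \<Rightarrow> ('o \<Rightarrow> 'b) \<Rightarrow> bool" where
  "nat_iso C D F G \<alpha> \<longleftrightarrow> nat_trans C D F G \<alpha> \<and> (\<forall>x \<in> Ob C. iso_arr D (\<alpha> x))"

definition nt_id :: "('o, 'a) cat \<Rightarrow> ('p, 'b) cat \<Rightarrow> ('o, 'a, 'p, 'b) functr \<Rightarrow> 'o \<Rightarrow> 'b" where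
  "nt_id C D F = (\<lambda>x \<in> Ob C. Idn D (fob F x))"

definition nt_vcomp ::
  "('o, 'a) cat \<Rightarrow> ('p, 'b) cat \<Rightarrow> ('o \<Rightarrow> 'b) \<Rightarrow> ('o \<Rightarrow> 'b) \<Rightarrow> 'o \<Rightarrow> 'b" where
  "nt_vcomp C D \<beta> \<alpha> = (\<lambda>x \<in> Ob C. Cmp D (\<beta> x) (\<alpha> x))"

text \<open>Horizontal composite of \<open>\<alpha> : F \<Rightarrow> F'\<close> (from \<open>C\<close>) and \<open>\<beta> : G \<Rightarrow> G'\<close> (into \<open>E\<close>).\<close>

definition nt_hcomp :: "('o, 'a) cat \<Rightarrow> ('q, 'c) cat \<Rightarrow> ('p, 'b, 'q, 'c) functr \<Rightarrow>
    ('o, 'a, 'p, 'b) functr \<Rightarrow> ('p \<Rightarrow> 'c) \<Rightarrow> ('o \<Rightarrow> 'b) \<Rightarrow> 'o \<Rightarrow> 'c" where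
  "nt_hcomp C E G F' \<beta> \<alpha> = (\<lambda>x \<in> Ob C. Cmp E (\<beta> (fob F' x)) (far G (\<alpha> x)))"

definition equivalence :: "('o, 'a) cat \<Rightarrow> ('p, 'b) cat \<Rightarrow> ('o, 'a, 'p, 'b) functr \<Rightarrow> bool" where
  "equivalence C D F \<longleftrightarrow> is_functor C D F \<and>
     (\<exists>G \<eta> \<epsilon>. is_functor D C G \<and> nat_iso C C (id_functor C) (comp_functor C G F) \<eta> \<and>
        nat_iso D D (comp_functor D F G) (id_functor D) \<epsilon>)"

text \<open>
  The components of a transformation do not determine its source and target, so 2-cells record
  these as well.
\<close>

datatype ('m, 't) cell = Cell (src: 'm) (tgt: 'm) (comps: 't)

definition functor_cat :: "('o, 'a) cat \<Rightarrow> ('p, 'b) cat \<Rightarrow>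
    (('o, 'a, 'p, 'b) functr, (('o, 'a, 'p, 'b) functr, 'o \<Rightarrow> 'b) cell) cat" where
  "functor_cat C D =
    mk_cat {F. is_functor C D F} {Cell F G \<alpha> |F G \<alpha>. nat_trans C D F G \<alpha>} src tgt
      (\<lambda>F. Cell F F (nt_id C D F))
      (\<lambda>t s. Cell (src s) (tgt t) (nt_vcomp C D (comps t) (comps s)))"


section \<open>Finite limits\<close>

definition cone :: "('j, 'k) cat \<Rightarrow> ('o, 'a) cat \<Rightarrow> ('j, 'k, 'o, 'a) functr \<Rightarrow> 'o \<Rightarrow>
    ('j \<Rightarrow> 'a) \<Rightarrow> bool" where
  "cone J C D x l \<longleftrightarrow> x \<in> Ob C \<and> (\<forall>j \<in> Ob J. l j \<in> homset C x (fob D j)) \<and>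
     (\<forall>u \<in> Ar J. Cmp C (far D u) (l (Dom J u)) = l (Cod J u))"

definition limit_cone :: "('j, 'k) cat \<Rightarrow> ('o, 'a) cat \<Rightarrow> ('j, 'k, 'o, 'a) functr \<Rightarrow> 'o \<Rightarrow>
    ('j \<Rightarrow> 'a) \<Rightarrow> bool" where
  "limit_cone J C D x l \<longleftrightarrow> cone J C D x l \<and>
     (\<forall>y m. cone J C D y m \<longrightarrow>
        (\<exists>!h. h \<in> homset C y x \<and> (\<forall>j \<in> Ob J. Cmp C (l j) h = m j)))"

text \<open>
  Every finite category is isomorphic to one whose objects and arrows are natural numbers, so
  it suffices to let finite diagram shapes range over the latter.
\<close>

definition finite_diagram ::
  "(nat, nat) cat \<Rightarrow> ('o, 'a) cat \<Rightarrow> (nat, nat, 'o, 'a) functr \<Rightarrow> bool" where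
  "finite_diagram J C D \<longleftrightarrow> finite (Ob J) \<and> finite (Ar J) \<and> is_functor J C D"

definition has_finite_limits :: "('o, 'a) cat \<Rightarrow> bool" where
  "has_finite_limits C \<longleftrightarrow> (\<forall>J D. finite_diagram J C D \<longrightarrow> (\<exists>x l. limit_cone J C D x l))"

definition preserves_finite_limits ::
  "('o, 'a) cat \<Rightarrow> ('p, 'b) cat \<Rightarrow> ('o, 'a, 'p, 'b) functr \<Rightarrow> bool" where
  "preserves_finite_limits C C' F \<longleftrightarrow>
     (\<forall>J D x l. finite_diagram J C D \<and> limit_cone J C D x l \<longrightarrow>
        limit_cone J C' (comp_functor J F D) (fob F x) (\<lambda>j. far F (l j)))"


section \<open>Arrow categories\<close>

text \<open>
  \<open>Square f u v g\<close> is the arrow from \<open>f\<close> to \<open>g\<close> in the arrow category given by the commutative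
  square \<open>g \<circ> u = v \<circ> f\<close>.
\<close>

datatype 'a square = Square (sq_dom: 'a) (sq_top: 'a) (sq_bot: 'a) (sq_cod: 'a)

definition arrow_cat :: "('o, 'a) cat \<Rightarrow> ('a, 'a square) cat" where
  "arrow_cat C =
    mk_cat (Ar C)
      {Square f u v g |f u v g. f \<in> Ar C \<and> g \<in> Ar C \<and> u \<in> homset C (Dom C f) (Dom C g) \<and>
         v \<in> homset C (Cod C f) (Cod C g) \<and> Cmp C g u = Cmp C v f}
      sq_dom sq_cod
      (\<lambda>f. Square f (Idn C (Dom C f)) (Idn C (Cod C f)) f)
      (\<lambda>t s. Square (sq_dom s) (Cmp C (sq_top t) (sq_top s)) (Cmp C (sq_bot t) (sq_bot s))
               (sq_cod t))"

definition cod_functor :: "('o, 'a) cat \<Rightarrow> ('a, 'a square, 'o, 'a) functr" where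
  "cod_functor C = mk_functor (arrow_cat C) (Cod C) sq_bot"

text \<open>The functor \<open>F\<^sup>\<rightarrow>\<close> induced by a functor \<open>F\<close> with domain \<open>C\<close>.\<close>

definition arrow_functor :: "('o, 'a) cat \<Rightarrow> ('o, 'a, 'p, 'b) functr \<Rightarrow>
    ('a, 'a square, 'b, 'b square) functr" where
  "arrow_functor C F = mk_functor (arrow_cat C) (far F) (map_square (far F))"

definition pullback_square :: "('o, 'a) cat \<Rightarrow> 'a square \<Rightarrow> bool" where
  "pullback_square C s \<longleftrightarrow> s \<in> Ar (arrow_cat C) \<and>
     (\<forall>x a b. a \<in> homset C x (Dom C (sq_cod s)) \<and> b \<in> homset C x (Cod C (sq_dom s)) \<and>
        Cmp C (sq_cod s) a = Cmp C (sq_bot s) b \<longrightarrow>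
        (\<exists>!h. h \<in> homset C x (Dom C (sq_dom s)) \<and>
              Cmp C (sq_top s) h = a \<and> Cmp C (sq_dom s) h = b))"


section \<open>Fibrations\<close>

definition cartesian ::
  "('e, 'b) cat \<Rightarrow> ('o, 'a) cat \<Rightarrow> ('e, 'b, 'o, 'a) functr \<Rightarrow> 'b \<Rightarrow> bool" where
  "cartesian T C p f \<longleftrightarrow> f \<in> Ar T \<and>
     (\<forall>g w. g \<in> Ar T \<and> Cod T g = Cod T f \<and>
        w \<in> homset C (fob p (Dom T g)) (fob p (Dom T f)) \<and> Cmp C (far p f) w = far p g \<longrightarrow>
        (\<exists>!h. h \<in> homset T (Dom T g) (Dom T f) \<and> far p h = w \<and> Cmp T f h = g))"

definition fibration ::
  "('e, 'b) cat \<Rightarrow> ('o, 'a) cat \<Rightarrow> ('e, 'b, 'o, 'a) functr \<Rightarrow> bool" where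
  "fibration T C p \<longleftrightarrow> is_functor T C p \<and>
     (\<forall>A \<in> Ob T. \<forall>u \<in> Ar C. Cod C u = fob p A \<longrightarrow>
        (\<exists>f. cartesian T C p f \<and> Cod T f = A \<and> far p f = u))"


section \<open>2-categories\<close>

text \<open>
  A strict 2-category is presented as a category enriched in categories. \<open>THom K X Y\<close> is the
  hom-category, its composition being vertical composition of 2-cells, and \<open>TComp K X Y Z\<close> is the
  composition functor, acting on objects by composition of 1-cells and on arrows by horizontal
  composition of 2-cells. Fields at arguments that are not objects of \<open>K\<close> are irrelevant.
\<close>

record ('x, 'h, 'c) two_cat =
  TOb :: "'x set"
  THom :: "'x \<Rightarrow> 'x \<Rightarrow> ('h, 'c) cat"
  TId :: "'x \<Rightarrow> 'h"
  TComp :: "'x \<Rightarrow> 'x \<Rightarrow> 'x \<Rightarrow> ('h \<times> 'h, 'c \<times> 'c, 'h, 'c) functr"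

abbreviation TComp1 :: "('x, 'h, 'c) two_cat \<Rightarrow> 'x \<Rightarrow> 'x \<Rightarrow> 'x \<Rightarrow> 'h \<Rightarrow> 'h \<Rightarrow> 'h" where
  "TComp1 K X Y Z g f \<equiv> fob (TComp K X Y Z) (g, f)"

abbreviation TComp2 :: "('x, 'h, 'c) two_cat \<Rightarrow> 'x \<Rightarrow> 'x \<Rightarrow> 'x \<Rightarrow> 'c \<Rightarrow> 'c \<Rightarrow> 'c" where
  "TComp2 K X Y Z t s \<equiv> far (TComp K X Y Z) (t, s)"

abbreviation TId2 :: "('x, 'h, 'c) two_cat \<Rightarrow> 'x \<Rightarrow> 'c" where
  "TId2 K X \<equiv> Idn (THom K X X) (TId K X)"

locale two_category =
  fixes K :: "('x, 'h, 'c) two_cat"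
  assumes hom_category: "X \<in> TOb K \<Longrightarrow> Y \<in> TOb K \<Longrightarrow> category (THom K X Y)"
    and TId_ob: "X \<in> TOb K \<Longrightarrow> TId K X \<in> Ob (THom K X X)"
    and TComp_functor: "X \<in> TOb K \<Longrightarrow> Y \<in> TOb K \<Longrightarrow> Z \<in> TOb K \<Longrightarrow>
      is_functor (prod_cat (THom K Y Z) (THom K X Y)) (THom K X Z) (TComp K X Y Z)"
    and assoc1: "W \<in> TOb K \<Longrightarrow> X \<in> TOb K \<Longrightarrow> Y \<in> TOb K \<Longrightarrow> Z \<in> TOb K \<Longrightarrow>
      f \<in> Ob (THom K W X) \<Longrightarrow> g \<in> Ob (THom K X Y) \<Longrightarrow> h \<in> Ob (THom K Y Z) \<Longrightarrow>
      TComp1 K W Y Z h (TComp1 K W X Y g f) = TComp1 K W X Z (TComp1 K X Y Z h g) f"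
    and assoc2: "W \<in> TOb K \<Longrightarrow> X \<in> TOb K \<Longrightarrow> Y \<in> TOb K \<Longrightarrow> Z \<in> TOb K \<Longrightarrow>
      r \<in> Ar (THom K W X) \<Longrightarrow> s \<in> Ar (THom K X Y) \<Longrightarrow> t \<in> Ar (THom K Y Z) \<Longrightarrow>
      TComp2 K W Y Z t (TComp2 K W X Y s r) = TComp2 K W X Z (TComp2 K X Y Z t s) r"
    and unit1: "X \<in> TOb K \<Longrightarrow> Y \<in> TOb K \<Longrightarrow> f \<in> Ob (THom K X Y) \<Longrightarrow>
      TComp1 K X X Y f (TId K X) = f \<and> TComp1 K X Y Y (TId K Y) f = f"
    and unit2: "X \<in> TOb K \<Longrightarrow> Y \<in> TOb K \<Longrightarrow> s \<in> Ar (THom K X Y) \<Longrightarrow>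
      TComp2 K X X Y s (TId2 K X) = s \<and> TComp2 K X Y Y (TId2 K Y) s = s"

record ('x, 'h, 'c, 'y, 'i, 'd) two_functr =
  Fob :: "'x \<Rightarrow> 'y"
  Fhom :: "'x \<Rightarrow> 'x \<Rightarrow> ('h, 'c, 'i, 'd) functr"

locale two_functor = K: two_category K + L: two_category L
  for K :: "('x, 'h, 'c) two_cat" and L :: "('y, 'i, 'd) two_cat" +
  fixes \<Phi> :: "('x, 'h, 'c, 'y, 'i, 'd) two_functr"
  assumes Fob_ob: "X \<in> TOb K \<Longrightarrow> Fob \<Phi> X \<in> TOb L"
    and Fhom_functor: "X \<in> TOb K \<Longrightarrow> Y \<in> TOb K \<Longrightarrow>
      is_functor (THom K X Y) (THom L (Fob \<Phi> X) (Fob \<Phi> Y)) (Fhom \<Phi> X Y)"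
    and preserves_TId: "X \<in> TOb K \<Longrightarrow> fob (Fhom \<Phi> X X) (TId K X) = TId L (Fob \<Phi> X)"
    and preserves_TComp1: "X \<in> TOb K \<Longrightarrow> Y \<in> TOb K \<Longrightarrow> Z \<in> TOb K \<Longrightarrow>
      f \<in> Ob (THom K X Y) \<Longrightarrow> g \<in> Ob (THom K Y Z) \<Longrightarrow>
      fob (Fhom \<Phi> X Z) (TComp1 K X Y Z g f) =
      TComp1 L (Fob \<Phi> X) (Fob \<Phi> Y) (Fob \<Phi> Z) (fob (Fhom \<Phi> Y Z) g) (fob (Fhom \<Phi> X Y) f)"
    and preserves_TComp2: "X \<in> TOb K \<Longrightarrow> Y \<in> TOb K \<Longrightarrow> Z \<in> TOb K \<Longrightarrow>
      s \<in> Ar (THom K X Y) \<Longrightarrow> t \<in> Ar (THom K Y Z) \<Longrightarrow>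
      far (Fhom \<Phi> X Z) (TComp2 K X Y Z t s) =
      TComp2 L (Fob \<Phi> X) (Fob \<Phi> Y) (Fob \<Phi> Z) (far (Fhom \<Phi> Y Z) t) (far (Fhom \<Phi> X Y) s)"

text \<open>The composite \<open>\<Psi> \<circ> \<Phi>\<close> is the identity 2-functor of \<open>K\<close>.\<close>

definition two_functor_left_inverse :: "('x, 'h, 'c) two_cat \<Rightarrow>
    ('x, 'h, 'c, 'y, 'i, 'd) two_functr \<Rightarrow> ('y, 'i, 'd, 'x, 'h, 'c) two_functr \<Rightarrow> bool" where
  "two_functor_left_inverse K \<Phi> \<Psi> \<longleftrightarrow>
     (\<forall>X \<in> TOb K. Fob \<Psi> (Fob \<Phi> X) = X) \<and>
     (\<forall>X \<in> TOb K. \<forall>Y \<in> TOb K.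
        comp_functor (THom K X Y) (Fhom \<Psi> (Fob \<Phi> X) (Fob \<Phi> Y)) (Fhom \<Phi> X Y) = id_functor (THom K X Y))"

definition isomorphic_two_cats :: "('x, 'h, 'c) two_cat \<Rightarrow> ('y, 'i, 'd) two_cat \<Rightarrow> bool" where
  "isomorphic_two_cats K L \<longleftrightarrow>
     (\<exists>\<Phi> \<Psi>. two_functor K L \<Phi> \<and> two_functor L K \<Psi> \<and>
        two_functor_left_inverse K \<Phi> \<Psi> \<and> two_functor_left_inverse L \<Psi> \<Phi>)"

definition internally_equivalent :: "('x, 'h, 'c) two_cat \<Rightarrow> 'x \<Rightarrow> 'x \<Rightarrow> bool" where
  "internally_equivalent K X Y \<longleftrightarrow>
     (\<exists>f \<in> Ob (THom K X Y). \<exists>g \<in> Ob (THom K Y X).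
        isomorphic (THom K X X) (TComp1 K X Y X g f) (TId K X) \<and>
        isomorphic (THom K Y Y) (TComp1 K Y X Y f g) (TId K Y))"

definition two_equivalence :: "('x, 'h, 'c) two_cat \<Rightarrow> ('y, 'i, 'd) two_cat \<Rightarrow>
    ('x, 'h, 'c, 'y, 'i, 'd) two_functr \<Rightarrow> bool" where
  "two_equivalence K L \<Phi> \<longleftrightarrow> two_functor K L \<Phi> \<and>
     (\<forall>X \<in> TOb K. \<forall>Y \<in> TOb K.
        equivalence (THom K X Y) (THom L (Fob \<Phi> X) (Fob \<Phi> Y)) (Fhom \<Phi> X Y)) \<and>
     (\<forall>Y \<in> TOb L. \<exists>X \<in> TOb K. internally_equivalent L (Fob \<Phi> X) Y)"

definition equivalent_two_cats :: "('x, 'h, 'c) two_cat \<Rightarrow> ('y, 'i, 'd) two_cat \<Rightarrow> bool" where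
  "equivalent_two_cats K L \<longleftrightarrow> (\<exists>\<Phi>. two_equivalence K L \<Phi>)"

definition full_sub_two_cat :: "('x, 'h, 'c) two_cat \<Rightarrow> 'x set \<Rightarrow> ('x, 'h, 'c) two_cat" where
  "full_sub_two_cat K P = K\<lparr>TOb := TOb K \<inter> P\<rparr>"

text \<open>All objects, the 1-cells selected by \<open>S\<close>, and all 2-cells between those.\<close>

definition locally_full_sub_two_cat ::
  "('x, 'h, 'c) two_cat \<Rightarrow> ('x \<Rightarrow> 'x \<Rightarrow> 'h set) \<Rightarrow> ('x, 'h, 'c) two_cat" where
  "locally_full_sub_two_cat K S = K\<lparr>
     THom := (\<lambda>X Y. full_subcat (THom K X Y) (S X Y)),
     TComp := (\<lambda>X Y Z. mk_functor
       (prod_cat (full_subcat (THom K Y Z) (S Y Z)) (full_subcat (THom K X Y) (S X Y)))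
       (fob (TComp K X Y Z)) (far (TComp K X Y Z)))\<rparr>"


section \<open>The 2-category of categories with finite limits\<close>

type_synonym ('o, 'a) lex_two_cat =
  "(('o, 'a) cat \<times> 'o, ('o, 'a, 'o, 'a) functr, (('o, 'a, 'o, 'a) functr, 'o \<Rightarrow> 'a) cell) two_cat"

text \<open>
  The 2-category of all categories with objects in \<open>'o\<close> and arrows in \<open>'a\<close>, each equipped with a
  chosen object, which 1-cells and 2-cells ignore.
\<close>

definition Cat_pt :: "('o, 'a) lex_two_cat" where
  "Cat_pt =
    \<lparr>TOb = {(C, t). category C \<and> t \<in> Ob C},
     THom = (\<lambda>(C, _) (D, _). functor_cat C D),
     TId = (\<lambda>(C, _). id_functor C),
     TComp = (\<lambda>(C, _) (D, _) (E, _). mk_functor (prod_cat (functor_cat D E) (functor_cat C D))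
       (\<lambda>(G, F). comp_functor C G F)
       (\<lambda>(t, s). Cell (comp_functor C (src t) (src s)) (comp_functor C (tgt t) (tgt s))
                   (nt_hcomp C E (src t) (tgt s) (comps t) (comps s))))\<rparr>"

definition Lex :: "('o, 'a) lex_two_cat" where
  "Lex = locally_full_sub_two_cat
     (full_sub_two_cat Cat_pt {(C, t). has_finite_limits C \<and> terminal C t})
     (\<lambda>(C, _) (D, _). {F. preserves_finite_limits C D F})"


section \<open>Comprehension categories\<close>

record ('o, 'a, 'e, 'b) compcat =
  Base :: "('o, 'a) cat"
  Tot :: "('e, 'b) cat"
  Proj :: "('e, 'b, 'o, 'a) functr"
  Chi :: "('e, 'b, 'a, 'a square) functr"

locale comp_cat =
  fixes X :: "('o, 'a, 'e, 'b, 'z) compcat_scheme"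
  assumes Proj_fibration: "fibration (Tot X) (Base X) (Proj X)"
    and Chi_functor: "is_functor (Tot X) (arrow_cat (Base X)) (Chi X)"
    and cod_Chi: "comp_functor (Tot X) (cod_functor (Base X)) (Chi X) = Proj X"
    and Chi_cartesian: "cartesian (Tot X) (Base X) (Proj X) f \<Longrightarrow>
      pullback_square (Base X) (far (Chi X) f)"

text \<open>The context extension \<open>\<Gamma>.A\<close>, for \<open>A\<close> over \<open>\<Gamma>\<close>.\<close>

definition ctx_ext :: "('o, 'a, 'e, 'b, 'z) compcat_scheme \<Rightarrow> 'e \<Rightarrow> 'o" where
  "ctx_ext X A = Dom (Base X) (fob (Chi X) A)"

text \<open>If \<open>\<chi>\<close> is an identity then \<open>p = cod\<close> follows from \<open>cod \<circ> \<chi> = p\<close>.\<close>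

definition trivial :: "('o, 'a, 'a, 'a square, 'z) compcat_scheme \<Rightarrow> bool" where
  "trivial X \<longleftrightarrow> Tot X = arrow_cat (Base X) \<and> Chi X = id_functor (arrow_cat (Base X))"

record ('o, 'a, 'e, 'b) rooted_compcat = "('o, 'a, 'e, 'b) compcat" +
  Root :: 'o

inductive_set iterated_ext :: "('o, 'a, 'e, 'b) rooted_compcat \<Rightarrow> 'o set"
  for X :: "('o, 'a, 'e, 'b) rooted_compcat" where
  root: "Root X \<in> iterated_ext X"
| extend: "\<Gamma> \<in> iterated_ext X \<Longrightarrow> A \<in> Ob (Tot X) \<Longrightarrow> fob (Proj X) A = \<Gamma> \<Longrightarrow>
    ctx_ext X A \<in> iterated_ext X"

locale rooted_comp_cat = comp_cat X for X :: "('o, 'a, 'e, 'b) rooted_compcat" +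
  assumes Root_terminal: "terminal (Base X) (Root X)"
    and rooted: "\<Delta> \<in> Ob (Base X) \<Longrightarrow> \<exists>\<Gamma> \<in> iterated_ext X. isomorphic (Base X) \<Delta> \<Gamma>"


subsection \<open>Maps\<close>

text \<open>The field \<open>mcomp\<close> holds the components of the natural transformation \<open>\<phi>\<close>.\<close>

record ('o, 'a, 'e, 'b) compmap =
  mbase :: "('o, 'a, 'o, 'a) functr"
  mtotal :: "('e, 'b, 'e, 'b) functr"
  mcomp :: "'e \<Rightarrow> 'a square"

locale pseudo_map =
  fixes X :: "('o, 'a, 'e, 'b, 'z) compcat_scheme"
    and Y :: "('o, 'a, 'e, 'b, 'z) compcat_scheme"
    and M :: "('o, 'a, 'e, 'b, 'y) compmap_scheme"
  assumes mbase_functor: "is_functor (Base X) (Base Y) (mbase M)"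
    and mtotal_functor: "is_functor (Tot X) (Tot Y) (mtotal M)"
    and mtotal_over:
      "comp_functor (Tot X) (Proj Y) (mtotal M) = comp_functor (Tot X) (mbase M) (Proj X)"
    and mtotal_cartesian: "cartesian (Tot X) (Base X) (Proj X) f \<Longrightarrow>
      cartesian (Tot Y) (Base Y) (Proj Y) (far (mtotal M) f)"
    and mcomp_iso: "nat_iso (Tot X) (arrow_cat (Base Y))
      (comp_functor (Tot X) (Chi Y) (mtotal M))
      (comp_functor (Tot X) (arrow_functor (Base X) (mbase M)) (Chi X)) (mcomp M)"
    and mcomp_over: "A \<in> Ob (Tot X) \<Longrightarrow>
      sq_bot (mcomp M A) = Idn (Base Y) (fob (mbase M) (fob (Proj X) A))"

record ('o, 'a, 'e, 'b) rooted_compmap = "('o, 'a, 'e, 'b) compmap" +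
  mroot :: 'a

locale rooted_pseudo_map = pseudo_map X Y M
  for X Y :: "('o, 'a, 'e, 'b) rooted_compcat" and M :: "('o, 'a, 'e, 'b) rooted_compmap" +
  assumes mroot_hom: "mroot M \<in> homset (Base Y) (Root Y) (fob (mbase M) (Root X))"
    and mroot_iso: "iso_arr (Base Y) (mroot M)"

definition strict :: "('o, 'a, 'e, 'b, 'z) compcat_scheme \<Rightarrow>
    ('o, 'a, 'e, 'b, 'z) compcat_scheme \<Rightarrow> ('o, 'a, 'e, 'b, 'y) compmap_scheme \<Rightarrow> bool" where
  "strict X Y M \<longleftrightarrow>
     comp_functor (Tot X) (Chi Y) (mtotal M) =
       comp_functor (Tot X) (arrow_functor (Base X) (mbase M)) (Chi X) \<and>
     mcomp M = nt_id (Tot X) (arrow_cat (Base Y)) (comp_functor (Tot X) (Chi Y) (mtotal M))"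

definition id_map :: "('o, 'a, 'e, 'b) rooted_compcat \<Rightarrow> ('o, 'a, 'e, 'b) rooted_compmap" where
  "id_map X =
    \<lparr>mbase = id_functor (Base X), mtotal = id_functor (Tot X),
     mcomp = nt_id (Tot X) (arrow_cat (Base X)) (Chi X), mroot = Idn (Base X) (Root X)\<rparr>"

text \<open>
  The composite of \<open>M = (F, F', \<phi>) : X \<rightarrow> Y\<close> and \<open>N = (G, G', \<gamma>) : Y \<rightarrow> Z\<close>, where \<open>F'\<close> and \<open>G'\<close> act
  on total categories. The comparison isomorphism is
  \<open>\<chi>'' G' F' \<Rightarrow> G\<^sup>\<rightarrow> \<chi>' F' \<Rightarrow> G\<^sup>\<rightarrow> F\<^sup>\<rightarrow> \<chi>\<close>, and the root isomorphism is \<open>1'' \<rightarrow> G 1' \<rightarrow> G F 1\<close>.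
\<close>

definition map_comp :: "('o, 'a, 'e, 'b) rooted_compcat \<Rightarrow> ('o, 'a, 'e, 'b) rooted_compcat \<Rightarrow>
    ('o, 'a, 'e, 'b) rooted_compcat \<Rightarrow> ('o, 'a, 'e, 'b) rooted_compmap \<Rightarrow>
    ('o, 'a, 'e, 'b) rooted_compmap \<Rightarrow> ('o, 'a, 'e, 'b) rooted_compmap" where
  "map_comp X Y Z N M =
    \<lparr>mbase = comp_functor (Base X) (mbase N) (mbase M),
     mtotal = comp_functor (Tot X) (mtotal N) (mtotal M),
     mcomp = (\<lambda>A \<in> Ob (Tot X). Cmp (arrow_cat (Base Z))
       (far (arrow_functor (Base Y) (mbase N)) (mcomp M A))
       (mcomp N (fob (mtotal M) A))),
     mroot = Cmp (Base Z) (far (mbase N) (mroot M)) (mroot N)\<rparr>"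


subsection \<open>Transformations\<close>

locale comp_trans =
  fixes X :: "('o, 'a, 'e, 'b, 'z) compcat_scheme"
    and Y :: "('o, 'a, 'e, 'b, 'z) compcat_scheme"
    and M :: "('o, 'a, 'e, 'b, 'y) compmap_scheme"
    and N :: "('o, 'a, 'e, 'b, 'y) compmap_scheme"
    and \<alpha> :: "'o \<Rightarrow> 'a"
    and \<alpha>' :: "'e \<Rightarrow> 'b"
  assumes base_trans: "nat_trans (Base X) (Base Y) (mbase M) (mbase N) \<alpha>"
    and total_trans: "nat_trans (Tot X) (Tot Y) (mtotal M) (mtotal N) \<alpha>'"
    and total_over: "A \<in> Ob (Tot X) \<Longrightarrow> far (Proj Y) (\<alpha>' A) = \<alpha> (fob (Proj X) A)"
    and comp_compat: "A \<in> Ob (Tot X) \<Longrightarrow>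
      Cmp (Base Y) (sq_top (mcomp N A)) (sq_top (far (Chi Y) (\<alpha>' A))) =
      Cmp (Base Y) (\<alpha> (ctx_ext X A)) (sq_top (mcomp M A))"

locale rooted_comp_trans = comp_trans X Y M N \<alpha> \<alpha>'
  for X Y :: "('o, 'a, 'e, 'b) rooted_compcat" and M N :: "('o, 'a, 'e, 'b) rooted_compmap"
    and \<alpha> \<alpha>' +
  assumes root_compat: "Cmp (Base Y) (\<alpha> (Root X)) (mroot M) = mroot N"


subsection \<open>The 2-categories of rooted comprehension categories\<close>

type_synonym ('o, 'a, 'e, 'b) comp_cell =
  "(('o, 'a, 'e, 'b) rooted_compmap, ('o \<Rightarrow> 'a) \<times> ('e \<Rightarrow> 'b)) cell"

type_synonym ('o, 'a, 'e, 'b) comp_two_cat =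
  "(('o, 'a, 'e, 'b) rooted_compcat, ('o, 'a, 'e, 'b) rooted_compmap,
    ('o, 'a, 'e, 'b) comp_cell) two_cat"

definition comp_hom :: "('o, 'a, 'e, 'b) rooted_compcat \<Rightarrow> ('o, 'a, 'e, 'b) rooted_compcat \<Rightarrow>
    (('o, 'a, 'e, 'b) rooted_compmap, ('o, 'a, 'e, 'b) comp_cell) cat" where
  "comp_hom X Y =
    mk_cat {M. rooted_pseudo_map X Y M}
      {Cell M N (\<alpha>, \<alpha>') |M N \<alpha> \<alpha>'. rooted_pseudo_map X Y M \<and> rooted_pseudo_map X Y N \<and>
         rooted_comp_trans X Y M N \<alpha> \<alpha>'}
      src tgt
      (\<lambda>M. Cell M M (nt_id (Base X) (Base Y) (mbase M), nt_id (Tot X) (Tot Y) (mtotal M)))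
      (\<lambda>t s. Cell (src s) (tgt t)
         (nt_vcomp (Base X) (Base Y) (fst (comps t)) (fst (comps s)),
          nt_vcomp (Tot X) (Tot Y) (snd (comps t)) (snd (comps s))))"

definition CompCat_rtd :: "('o, 'a, 'e, 'b) comp_two_cat" where
  "CompCat_rtd =
    \<lparr>TOb = {X. rooted_comp_cat X},
     THom = comp_hom,
     TId = id_map,
     TComp = (\<lambda>X Y Z. mk_functor (prod_cat (comp_hom Y Z) (comp_hom X Y))
       (\<lambda>(N, M). map_comp X Y Z N M)
       (\<lambda>(t, s). Cell (map_comp X Y Z (src t) (src s)) (map_comp X Y Z (tgt t) (tgt s))
          (nt_hcomp (Base X) (Base Z) (mbase (src t)) (mbase (tgt s))
             (fst (comps t)) (fst (comps s)),
           nt_hcomp (Tot X) (Tot Z) (mtotal (src t)) (mtotal (tgt s))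
             (snd (comps t)) (snd (comps s)))))\<rparr>"

type_synonym ('o, 'a) triv_two_cat = "('o, 'a, 'a, 'a square) comp_two_cat"

definition CompCat_rtd_triv :: "('o, 'a) triv_two_cat" where
  "CompCat_rtd_triv = full_sub_two_cat CompCat_rtd {X. trivial X}"

definition CompCat_str2_rtd_triv :: "('o, 'a) triv_two_cat" where
  "CompCat_str2_rtd_triv = locally_full_sub_two_cat CompCat_rtd_triv (\<lambda>X Y. {M. strict X Y M})"

end

(*
Pullbacks and a terminal object give all finite limits: a finite diagram is built up one object and
one arrow at a time, adding an object by a product and an arrow by an equalizer, both of which are
pullbacks. The construction is preserved by every functor preserving pullbacks and the terminal
object, so such functors preserve all finite limits.

A trivial comprehension category is a category whose codomain functor is a fibration, that is, one
with pullbacks. It is automatically rooted once it has a terminal object 1, since x is the extension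
of 1 by x -> 1. Strictness forces a map to be (F, F^->, id), the root isomorphism is unique, and a
transformation is determined by its base part, so forgetting everything but the base is a bijection
on 0-, 1- and 2-cells. A pseudo map (F, F', phi) is isomorphic to the strict map (F, F^->, id) via
the 2-cell (id, phi), which gives the equivalence.
*)

theory Submission
  imports Defs
begin

section \<open>Categories and functors\<close>

text \<open>Two features of the definitions shape the proof. First,
  \<open>preserves_finite_limits\<close> speaks of every limit cone of every finite diagram, and a
  limit constructed separately in the target would not obviously be the image of one in the source.
  So the limit in \<open>C\<close> and its image in \<open>C'\<close> are carried through one and
  the same induction; an arbitrary limit cone is then compared with the constructed one, and
  existence of limits is the instance where the functor is the identity. Second, a pseudo map is
  only required to preserve cartesian arrows through \<open>mtotal\<close>, which need not be the
  functor induced on arrow categories by the base. That the base preserves pullbacks is obtained by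
  transporting cartesianness along the comparison isomorphism. Since the comparison lies over
  identities, both it and its inverse are total parts of 2-cells with identity base. The root of a
  comprehension category is data, so the objects of \<open>Lex\<close> have to carry a chosen
  terminal object: otherwise forgetting would not be injective on 0-cells.\<close>

lemma mem_homset [simp]: "f \<in> homset C x y \<longleftrightarrow> f \<in> Ar C \<and> Dom C f = x \<and> Cod C f = y"
  by (auto simp: homset_def)

context category
begin

lemma Dom_Ob [simp]: "f \<in> Ar C \<Longrightarrow> Dom C f \<in> Ob C"
  using Dom_ext by auto

lemma Cod_Ob [simp]: "f \<in> Ar C \<Longrightarrow> Cod C f \<in> Ob C"
  using Cod_ext by auto

lemma Idn_simps [simp]:
  "x \<in> Ob C \<Longrightarrow> Idn C x \<in> Ar C"
  "x \<in> Ob C \<Longrightarrow> Dom C (Idn C x) = x"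
  "x \<in> Ob C \<Longrightarrow> Cod C (Idn C x) = x"
  using Idn_hom by auto

lemma Cmp_simps [simp]:
  "g \<in> Ar C \<Longrightarrow> f \<in> Ar C \<Longrightarrow> Dom C g = Cod C f \<Longrightarrow> Cmp C g f \<in> Ar C"
  "g \<in> Ar C \<Longrightarrow> f \<in> Ar C \<Longrightarrow> Dom C g = Cod C f \<Longrightarrow> Dom C (Cmp C g f) = Dom C f"
  "g \<in> Ar C \<Longrightarrow> f \<in> Ar C \<Longrightarrow> Dom C g = Cod C f \<Longrightarrow> Cod C (Cmp C g f) = Cod C g"
  using Cmp_hom by auto

text \<open>Oriented against the axiom, so that simplification nests composites to the right. An
  equation about a two-fold composite then no longer fires at the head of a longer one, which is why
  several facts below have a second version with an extra arrow \<open>h\<close> on the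
  right.\<close>

lemma Cmp_assoc' [simp]:
  "h \<in> Ar C \<Longrightarrow> g \<in> Ar C \<Longrightarrow> f \<in> Ar C \<Longrightarrow> Dom C h = Cod C g \<Longrightarrow> Dom C g = Cod C f \<Longrightarrow>
    Cmp C (Cmp C h g) f = Cmp C h (Cmp C g f)"
  using Cmp_assoc by (auto simp: composable_def)

lemma Cmp_Idn [simp]:
  "f \<in> Ar C \<Longrightarrow> Dom C f = x \<Longrightarrow> Cmp C f (Idn C x) = f"
  "f \<in> Ar C \<Longrightarrow> Cod C f = x \<Longrightarrow> Cmp C (Idn C x) f = f"
  using Cmp_Idn_right Cmp_Idn_left by auto

lemma iso_arr_Ar: "iso_arr C f \<Longrightarrow> f \<in> Ar C"
  by (simp add: iso_arr_def)

lemma iso_arrI: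
  assumes "f \<in> Ar C" "g \<in> Ar C" "Dom C g = Cod C f" "Cod C g = Dom C f"
    "Cmp C g f = Idn C (Dom C f)" "Cmp C f g = Idn C (Cod C f)"
  shows "iso_arr C f"
  using assms by (auto simp: iso_arr_def)

text \<open>The last two facts are cancellation rules: in right-nested composites the equation for
  \<open>Cmp C g f\<close> does not apply to \<open>Cmp C g (Cmp C f h)\<close>.\<close>

lemma iso_arrE:
  assumes "iso_arr C f"
  obtains g where "f \<in> Ar C" "g \<in> Ar C" "Dom C g = Cod C f" "Cod C g = Dom C f"
    "Cmp C g f = Idn C (Dom C f)" "Cmp C f g = Idn C (Cod C f)"
    "\<And>h. h \<in> Ar C \<Longrightarrow> Cod C h = Dom C f \<Longrightarrow> Cmp C g (Cmp C f h) = h"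
    "\<And>h. h \<in> Ar C \<Longrightarrow> Cod C h = Cod C f \<Longrightarrow> Cmp C f (Cmp C g h) = h"
proof -
  from assms obtain g where g: "f \<in> Ar C" "g \<in> Ar C" "Dom C g = Cod C f" "Cod C g = Dom C f"
    "Cmp C g f = Idn C (Dom C f)" "Cmp C f g = Idn C (Cod C f)"
    by (auto simp: iso_arr_def)
  have "Cmp C g (Cmp C f h) = h" if "h \<in> Ar C" "Cod C h = Dom C f" for h
    using that g Cmp_assoc'[of g f h] by simp
  moreover have "Cmp C f (Cmp C g h) = h" if "h \<in> Ar C" "Cod C h = Cod C f" for h
    using that g Cmp_assoc'[of f g h] by simp
  ultimately show thesis using that g by blast
qed

lemma iso_arr_Idn [simp]: "x \<in> Ob C \<Longrightarrow> iso_arr C (Idn C x)"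
  by (rule iso_arrI[where g = "Idn C x"]) auto

lemma iso_arr_Cmp:
  assumes "iso_arr C g" "iso_arr C f" "Dom C g = Cod C f"
  shows "iso_arr C (Cmp C g f)"
proof -
  obtain g' where g': "g \<in> Ar C" "g' \<in> Ar C" "Dom C g' = Cod C g" "Cod C g' = Dom C g"
    "Cmp C g' g = Idn C (Dom C g)" "Cmp C g g' = Idn C (Cod C g)"
    "\<And>h. h \<in> Ar C \<Longrightarrow> Cod C h = Dom C g \<Longrightarrow> Cmp C g' (Cmp C g h) = h"
    "\<And>h. h \<in> Ar C \<Longrightarrow> Cod C h = Cod C g \<Longrightarrow> Cmp C g (Cmp C g' h) = h"
    using iso_arrE[OF assms(1)] by blast
  obtain f' where f': "f \<in> Ar C" "f' \<in> Ar C" "Dom C f' = Cod C f" "Cod C f' = Dom C f"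
    "Cmp C f' f = Idn C (Dom C f)" "Cmp C f f' = Idn C (Cod C f)"
    "\<And>h. h \<in> Ar C \<Longrightarrow> Cod C h = Dom C f \<Longrightarrow> Cmp C f' (Cmp C f h) = h"
    "\<And>h. h \<in> Ar C \<Longrightarrow> Cod C h = Cod C f \<Longrightarrow> Cmp C f (Cmp C f' h) = h"
    using iso_arrE[OF assms(2)] by blast
  show ?thesis
    by (rule iso_arrI[where g = "Cmp C f' g'"]) (use f' g' assms(3) in auto)
qed

end

lemma mk_cat_simps [simp]:
  "Ob (mk_cat X A d c i m) = X"
  "Ar (mk_cat X A d c i m) = A"
  "f \<in> A \<Longrightarrow> Dom (mk_cat X A d c i m) f = d f"
  "f \<in> A \<Longrightarrow> Cod (mk_cat X A d c i m) f = c f"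
  "x \<in> X \<Longrightarrow> Idn (mk_cat X A d c i m) x = i x"
  "g \<in> A \<Longrightarrow> f \<in> A \<Longrightarrow> d g = c f \<Longrightarrow> Cmp (mk_cat X A d c i m) g f = m g f"
  by (auto simp: mk_cat_def)

text \<open>\<open>mk_cat\<close> restricts every structure map to its carrier, so extensionality
  comes for free and only the algebraic laws on the carriers remain as premises.\<close>

lemma category_mk_cat:
  assumes "\<And>f. f \<in> A \<Longrightarrow> d f \<in> X" "\<And>f. f \<in> A \<Longrightarrow> c f \<in> X"
    and "\<And>x. x \<in> X \<Longrightarrow> i x \<in> A" "\<And>x. x \<in> X \<Longrightarrow> d (i x) = x" "\<And>x. x \<in> X \<Longrightarrow> c (i x) = x"
    and "\<And>g f. g \<in> A \<Longrightarrow> f \<in> A \<Longrightarrow> d g = c f \<Longrightarrow> m g f \<in> A"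
    and "\<And>g f. g \<in> A \<Longrightarrow> f \<in> A \<Longrightarrow> d g = c f \<Longrightarrow> d (m g f) = d f"
    and "\<And>g f. g \<in> A \<Longrightarrow> f \<in> A \<Longrightarrow> d g = c f \<Longrightarrow> c (m g f) = c g"
    and "\<And>h g f. h \<in> A \<Longrightarrow> g \<in> A \<Longrightarrow> f \<in> A \<Longrightarrow> d h = c g \<Longrightarrow> d g = c f \<Longrightarrow>
      m h (m g f) = m (m h g) f"
    and "\<And>f. f \<in> A \<Longrightarrow> m f (i (d f)) = f" "\<And>f. f \<in> A \<Longrightarrow> m (i (c f)) f = f"
  shows "category (mk_cat X A d c i m)"
proof
  show "Idn (mk_cat X A d c i m) \<in> extensional (Ob (mk_cat X A d c i m))"
    by (auto simp: mk_cat_def)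
  show "Cmp (mk_cat X A d c i m) g f = undefined" if "\<not> composable (mk_cat X A d c i m) g f" for g f
    using that by (auto simp: mk_cat_def composable_def)
  show "Dom (mk_cat X A d c i m) \<in> Ar (mk_cat X A d c i m) \<rightarrow>\<^sub>E Ob (mk_cat X A d c i m)"
    using assms by (auto simp: mk_cat_def)
  show "Cod (mk_cat X A d c i m) \<in> Ar (mk_cat X A d c i m) \<rightarrow>\<^sub>E Ob (mk_cat X A d c i m)"
    using assms by (auto simp: mk_cat_def)
qed (use assms in \<open>auto simp: composable_def\<close>)

lemma category_full_subcat:
  assumes "category C" shows "category (full_subcat C S)"
proof -
  interpret category C by fact
  show ?thesis unfolding full_subcat_def by (rule category_mk_cat) auto
qed

lemma full_subcat_simps [simp]:
  "Ob (full_subcat C S) = Ob C \<inter> S"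
  "Ar (full_subcat C S) = {f \<in> Ar C. Dom C f \<in> S \<and> Cod C f \<in> S}"
  "f \<in> Ar C \<Longrightarrow> Dom C f \<in> S \<Longrightarrow> Cod C f \<in> S \<Longrightarrow> Dom (full_subcat C S) f = Dom C f"
  "f \<in> Ar C \<Longrightarrow> Dom C f \<in> S \<Longrightarrow> Cod C f \<in> S \<Longrightarrow> Cod (full_subcat C S) f = Cod C f"
  "x \<in> Ob C \<Longrightarrow> x \<in> S \<Longrightarrow> Idn (full_subcat C S) x = Idn C x"
  "g \<in> Ar C \<Longrightarrow> Dom C g \<in> S \<Longrightarrow> Cod C g \<in> S \<Longrightarrow> f \<in> Ar C \<Longrightarrow> Dom C f \<in> S \<Longrightarrow> Cod C f = Dom C g \<Longrightarrow>
    Cmp (full_subcat C S) g f = Cmp C g f"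
  by (auto simp: full_subcat_def)

lemma category_prod_cat:
  assumes "category C" "category D" shows "category (prod_cat C D)"
proof -
  interpret C: category C by fact
  interpret D: category D by fact
  show ?thesis unfolding prod_cat_def by (rule category_mk_cat) auto
qed

lemma prod_cat_simps [simp]:
  "Ob (prod_cat C D) = Ob C \<times> Ob D"
  "Ar (prod_cat C D) = Ar C \<times> Ar D"
  "f \<in> Ar C \<Longrightarrow> f' \<in> Ar D \<Longrightarrow> Dom (prod_cat C D) (f, f') = (Dom C f, Dom D f')"
  "f \<in> Ar C \<Longrightarrow> f' \<in> Ar D \<Longrightarrow> Cod (prod_cat C D) (f, f') = (Cod C f, Cod D f')"
  "x \<in> Ob C \<Longrightarrow> x' \<in> Ob D \<Longrightarrow> Idn (prod_cat C D) (x, x') = (Idn C x, Idn D x')"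
  "g \<in> Ar C \<Longrightarrow> g' \<in> Ar D \<Longrightarrow> f \<in> Ar C \<Longrightarrow> f' \<in> Ar D \<Longrightarrow> Dom C g = Cod C f \<Longrightarrow> Dom D g' = Cod D f' \<Longrightarrow>
    Cmp (prod_cat C D) (g, g') (f, f') = (Cmp C g f, Cmp D g' f')"
  by (auto simp: prod_cat_def)

section \<open>Functors: images of arrows, extensional equality, composition\<close>

context is_functor
begin

lemma fob_Ob [simp]: "x \<in> Ob C \<Longrightarrow> fob F x \<in> Ob D"
  using fob_ext by auto

lemma far_simps [simp]:
  "f \<in> Ar C \<Longrightarrow> far F f \<in> Ar D"
  "f \<in> Ar C \<Longrightarrow> Dom D (far F f) = fob F (Dom C f)"
  "f \<in> Ar C \<Longrightarrow> Cod D (far F f) = fob F (Cod C f)"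
  using far_hom by auto

lemma far_Idn' [simp]: "x \<in> Ob C \<Longrightarrow> far F (Idn C x) = Idn D (fob F x)"
  by (rule far_Idn)

lemma far_Cmp' [simp]:
  "g \<in> Ar C \<Longrightarrow> f \<in> Ar C \<Longrightarrow> Dom C g = Cod C f \<Longrightarrow> far F (Cmp C g f) = Cmp D (far F g) (far F f)"
  using far_Cmp by (auto simp: composable_def)

lemma far_iso: "iso_arr C f \<Longrightarrow> iso_arr D (far F f)"
proof -
  assume "iso_arr C f"
  then obtain g where g: "f \<in> Ar C" "g \<in> Ar C" "Dom C g = Cod C f" "Cod C g = Dom C f"
    "Cmp C g f = Idn C (Dom C f)" "Cmp C f g = Idn C (Cod C f)"
    by (blast elim: C.iso_arrE)
  then have "Cmp D (far F g) (far F f) = Idn D (fob F (Dom C f))"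
    "Cmp D (far F f) (far F g) = Idn D (fob F (Cod C f))"
    using far_Cmp'[of g f] far_Cmp'[of f g] by auto
  with g show ?thesis
    by (intro D.iso_arrI[where g = "far F g"]) auto
qed

end

lemma mk_functor_simps [simp]:
  "x \<in> Ob C \<Longrightarrow> fob (mk_functor C u v) x = u x"
  "f \<in> Ar C \<Longrightarrow> far (mk_functor C u v) f = v f"
  by (auto simp: mk_functor_def)

lemma functr_eqI:
  fixes F G :: "('o, 'a, 'p, 'b) functr"
  assumes "fob F \<in> extensional (Ob C)" "far F \<in> extensional (Ar C)"
    and "fob G \<in> extensional (Ob C)" "far G \<in> extensional (Ar C)"
    and "\<And>x. x \<in> Ob C \<Longrightarrow> fob F x = fob G x"
    and "\<And>f. f \<in> Ar C \<Longrightarrow> far F f = far G f"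
  shows "F = G"
proof -
  have "fob F = fob G" "far F = far G"
    using assms extensionalityI by blast+
  then show ?thesis by simp
qed

lemma is_functor_eqI:
  assumes "is_functor C D F" "is_functor C D' G"
    and "\<And>x. x \<in> Ob C \<Longrightarrow> fob F x = fob G x"
    and "\<And>f. f \<in> Ar C \<Longrightarrow> far F f = far G f"
  shows "F = G"
  apply (rule functr_eqI[where C = C])
  using assms by (auto dest: is_functor.fob_ext is_functor.far_ext PiE_restrict simp: PiE_def)

lemma mk_functor_eqI:
  assumes "\<And>x. x \<in> Ob C \<Longrightarrow> u x = u' x"
    and "\<And>f. f \<in> Ar C \<Longrightarrow> v f = v' f"
  shows "mk_functor C u v = mk_functor C u' v'"
  using assms by (auto simp: mk_functor_def intro!: restrict_ext)

lemma mk_functor_eqD: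
  assumes "mk_functor C u v = mk_functor C u' v'"
  shows "x \<in> Ob C \<Longrightarrow> u x = u' x" "f \<in> Ar C \<Longrightarrow> v f = v' f"
  using mk_functor_simps[of _ C u v] mk_functor_simps[of _ C u' v'] assms by metis+

lemma mk_functor_eq:
  assumes "is_functor C D F"
    and "\<And>x. x \<in> Ob C \<Longrightarrow> u x = fob F x"
    and "\<And>f. f \<in> Ar C \<Longrightarrow> v f = far F f"
  shows "mk_functor C u v = F"
  apply (rule functr_eqI[where C = C])
  using assms by (auto dest: is_functor.fob_ext is_functor.far_ext simp: PiE_def)
    (auto simp: mk_functor_def)

lemma is_functor_mk_functor:
  assumes "category C" "category D"
    and "\<And>x. x \<in> Ob C \<Longrightarrow> u x \<in> Ob D"
    and "\<And>f. f \<in> Ar C \<Longrightarrow> v f \<in> Ar D"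
    and "\<And>f. f \<in> Ar C \<Longrightarrow> Dom D (v f) = u (Dom C f)"
    and "\<And>f. f \<in> Ar C \<Longrightarrow> Cod D (v f) = u (Cod C f)"
    and "\<And>x. x \<in> Ob C \<Longrightarrow> v (Idn C x) = Idn D (u x)"
    and "\<And>g f. g \<in> Ar C \<Longrightarrow> f \<in> Ar C \<Longrightarrow> Dom C g = Cod C f \<Longrightarrow> v (Cmp C g f) = Cmp D (v g) (v f)"
  shows "is_functor C D (mk_functor C u v)"
proof -
  interpret C: category C by fact
  interpret D: category D by fact
  show ?thesis
  proof
    show "fob (mk_functor C u v) \<in> Ob C \<rightarrow>\<^sub>E Ob D" using assms by (auto simp: mk_functor_def)
    show "far (mk_functor C u v) \<in> extensional (Ar C)" by (auto simp: mk_functor_def)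
  qed (use assms in \<open>auto simp: composable_def\<close>)
qed

lemma is_functor_id_functor: "category C \<Longrightarrow> is_functor C C (id_functor C)"
  unfolding id_functor_def by (rule is_functor_mk_functor) auto

lemma id_functor_simps [simp]:
  "x \<in> Ob C \<Longrightarrow> fob (id_functor C) x = x"
  "f \<in> Ar C \<Longrightarrow> far (id_functor C) f = f"
  by (auto simp: id_functor_def)

lemma is_functor_comp_functor:
  assumes "is_functor C D F" "is_functor D E G"
  shows "is_functor C E (comp_functor C G F)"
proof -
  interpret F: is_functor C D F by fact
  interpret G: is_functor D E G by fact
  show ?thesis unfolding comp_functor_def
    by (rule is_functor_mk_functor) (auto intro: F.C.category_axioms G.D.category_axioms)
qed

lemma comp_functor_simps [simp]:
  "x \<in> Ob C \<Longrightarrow> fob (comp_functor C G F) x = fob G (fob F x)"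
  "f \<in> Ar C \<Longrightarrow> far (comp_functor C G F) f = far G (far F f)"
  by (auto simp: comp_functor_def)

lemma comp_functor_id_right: "is_functor C D F \<Longrightarrow> comp_functor C F (id_functor C) = F"
  unfolding comp_functor_def by (rule mk_functor_eq) auto

lemma comp_functor_id_left:
  assumes "is_functor C D F" shows "comp_functor C (id_functor D) F = F"
proof -
  interpret is_functor C D F by fact
  show ?thesis unfolding comp_functor_def by (rule mk_functor_eq[OF assms]) auto
qed

lemma comp_functor_assoc:
  assumes "is_functor C D F"
  shows "comp_functor C H (comp_functor C G F) = comp_functor C (comp_functor D H G) F"
proof -
  interpret is_functor C D F by fact
  show ?thesis by (auto simp: comp_functor_def intro!: mk_functor_eqI)
qed

lemma comp_functor_eqD:
  assumes "comp_functor C G F = comp_functor C G' F'"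
  shows "x \<in> Ob C \<Longrightarrow> fob G (fob F x) = fob G' (fob F' x)"
    and "f \<in> Ar C \<Longrightarrow> far G (far F f) = far G' (far F' f)"
  using mk_functor_eqD[OF assms[unfolded comp_functor_def]] by blast+

section \<open>Natural transformations\<close>

context nat_trans
begin

lemma comp_simps [simp]:
  "x \<in> Ob C \<Longrightarrow> \<alpha> x \<in> Ar D"
  "x \<in> Ob C \<Longrightarrow> Dom D (\<alpha> x) = fob F x"
  "x \<in> Ob C \<Longrightarrow> Cod D (\<alpha> x) = fob G x"
  using comp_hom by auto

lemma natural':
  "f \<in> Ar C \<Longrightarrow> Dom C f = x \<Longrightarrow> Cod C f = y \<Longrightarrow> Cmp D (\<alpha> y) (far F f) = Cmp D (far G f) (\<alpha> x)"
  using natural by auto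

text \<open>Naturality in the shape in which it meets right-nested composites.\<close>

lemma natural_Cmp:
  assumes "f \<in> Ar C" "Dom C f = x" "Cod C f = y" "h \<in> Ar D" "Cod D h = fob F x"
  shows "Cmp D (\<alpha> y) (Cmp D (far F f) h) = Cmp D (far G f) (Cmp D (\<alpha> x) h)"
proof -
  have xy: "x \<in> Ob C" "y \<in> Ob C" using assms by auto
  have "Cmp D (\<alpha> y) (Cmp D (far F f) h) = Cmp D (Cmp D (\<alpha> y) (far F f)) h"
    using assms xy by simp
  also have "\<dots> = Cmp D (far G f) (Cmp D (\<alpha> x) h)"
    using assms xy by (simp add: natural')
  finally show ?thesis .
qed

end

lemma nat_transI:
  assumes "is_functor C D F" "is_functor C D G"
    and "\<alpha> \<in> extensional (Ob C)"
    and "\<And>x. x \<in> Ob C \<Longrightarrow> \<alpha> x \<in> Ar D"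
    and "\<And>x. x \<in> Ob C \<Longrightarrow> Dom D (\<alpha> x) = fob F x"
    and "\<And>x. x \<in> Ob C \<Longrightarrow> Cod D (\<alpha> x) = fob G x"
    and "\<And>f. f \<in> Ar C \<Longrightarrow> Cmp D (\<alpha> (Cod C f)) (far F f) = Cmp D (far G f) (\<alpha> (Dom C f))"
  shows "nat_trans C D F G \<alpha>"
proof -
  interpret F: is_functor C D F by fact
  interpret G: is_functor C D G by fact
  show ?thesis by unfold_locales (use assms in auto)
qed

lemma nt_id_simps [simp]: "x \<in> Ob C \<Longrightarrow> nt_id C D F x = Idn D (fob F x)"
  by (simp add: nt_id_def)

lemma nt_vcomp_simps [simp]: "x \<in> Ob C \<Longrightarrow> nt_vcomp C D \<beta> \<alpha> x = Cmp D (\<beta> x) (\<alpha> x)"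
  by (simp add: nt_vcomp_def)

lemma nt_hcomp_simps [simp]:
  "x \<in> Ob C \<Longrightarrow> nt_hcomp C E G F' \<beta> \<alpha> x = Cmp E (\<beta> (fob F' x)) (far G (\<alpha> x))"
  by (simp add: nt_hcomp_def)

lemma nt_id_extensional [simp]: "nt_id C D F \<in> extensional (Ob C)"
  by (simp add: nt_id_def)

lemma nt_vcomp_extensional [simp]: "nt_vcomp C D \<beta> \<alpha> \<in> extensional (Ob C)"
  by (simp add: nt_vcomp_def)

lemma nt_hcomp_extensional [simp]: "nt_hcomp C E G F' \<beta> \<alpha> \<in> extensional (Ob C)"
  by (simp add: nt_hcomp_def)

lemma nat_trans_nt_id:
  assumes "is_functor C D F" shows "nat_trans C D F F (nt_id C D F)"
proof -
  interpret is_functor C D F by fact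
  show ?thesis by (rule nat_transI[OF assms assms]) auto
qed

lemma nat_trans_nt_vcomp:
  assumes "nat_trans C D F G \<alpha>" "nat_trans C D G H \<beta>"
  shows "nat_trans C D F H (nt_vcomp C D \<beta> \<alpha>)"
proof -
  interpret \<alpha>: nat_trans C D F G \<alpha> by fact
  interpret \<beta>: nat_trans C D G H \<beta> by fact
  show ?thesis
    by (rule nat_transI[OF \<alpha>.F.is_functor_axioms \<beta>.G.is_functor_axioms])
      (auto simp: \<alpha>.natural' \<beta>.natural_Cmp)
qed

lemma nat_trans_nt_hcomp:
  assumes "nat_trans C D F F' \<alpha>" "nat_trans D E G G' \<beta>"
  shows "nat_trans C E (comp_functor C G F) (comp_functor C G' F') (nt_hcomp C E G F' \<beta> \<alpha>)"
proof -
  interpret \<alpha>: nat_trans C D F F' \<alpha> by fact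
  interpret \<beta>: nat_trans D E G G' \<beta> by fact
  have "Cmp E (far G (\<alpha> (Cod C f))) (far G (far F f)) = Cmp E (far G (far F' f)) (far G (\<alpha> (Dom C f)))"
    if "f \<in> Ar C" for f
    using that by (simp add: \<alpha>.natural' flip: \<beta>.F.far_Cmp')
  then show ?thesis
    by (intro nat_transI)
      (auto simp: \<beta>.natural_Cmp
        intro: is_functor_comp_functor \<alpha>.F.is_functor_axioms \<alpha>.G.is_functor_axioms
          \<beta>.F.is_functor_axioms \<beta>.G.is_functor_axioms)
qed

lemma nt_eqI:
  assumes "\<alpha> \<in> extensional (Ob C)" "\<beta> \<in> extensional (Ob C)" "\<And>x. x \<in> Ob C \<Longrightarrow> \<alpha> x = \<beta> x"
  shows "\<alpha> = \<beta>"
  using assms extensionalityI by blast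

lemma nt_vcomp_assoc:
  assumes "nat_trans C D F G \<alpha>" "nat_trans C D G H \<beta>" "nat_trans C D H K \<gamma>"
  shows "nt_vcomp C D \<gamma> (nt_vcomp C D \<beta> \<alpha>) = nt_vcomp C D (nt_vcomp C D \<gamma> \<beta>) \<alpha>"
proof -
  interpret \<alpha>: nat_trans C D F G \<alpha> by fact
  interpret \<beta>: nat_trans C D G H \<beta> by fact
  interpret \<gamma>: nat_trans C D H K \<gamma> by fact
  show ?thesis by (rule nt_eqI[where C = C]) auto
qed

lemma nt_vcomp_id:
  assumes "nat_trans C D F G \<alpha>"
  shows "nt_vcomp C D \<alpha> (nt_id C D F) = \<alpha>" "nt_vcomp C D (nt_id C D G) \<alpha> = \<alpha>"
proof -
  interpret \<alpha>: nat_trans C D F G \<alpha> by fact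
  show "nt_vcomp C D \<alpha> (nt_id C D F) = \<alpha>" "nt_vcomp C D (nt_id C D G) \<alpha> = \<alpha>"
    by (rule nt_eqI[where C = C], use \<alpha>.comp_ext in auto)+
qed

lemma nt_hcomp_nt_id:
  assumes "is_functor C D F" "is_functor D E G"
  shows "nt_hcomp C E G F (nt_id D E G) (nt_id C D F) = nt_id C E (comp_functor C G F)"
proof -
  interpret F: is_functor C D F by fact
  interpret G: is_functor D E G by fact
  show ?thesis by (rule nt_eqI[where C = C]) auto
qed

text \<open>The interchange law. After expanding, the two sides differ by the naturality of \<beta>
  at the components of \<open>\<alpha>'\<close>.\<close>

lemma nt_hcomp_nt_vcomp:
  assumes "nat_trans C D F F' \<alpha>" "nat_trans C D F' F'' \<alpha>'"
    and "nat_trans D E G G' \<beta>" "nat_trans D E G' G'' \<beta>'"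
  shows "nt_hcomp C E G F'' (nt_vcomp D E \<beta>' \<beta>) (nt_vcomp C D \<alpha>' \<alpha>) =
    nt_vcomp C E (nt_hcomp C E G' F'' \<beta>' \<alpha>') (nt_hcomp C E G F' \<beta> \<alpha>)"
proof -
  interpret \<alpha>: nat_trans C D F F' \<alpha> by fact
  interpret \<beta>: nat_trans D E G G' \<beta> by fact
  interpret \<alpha>': nat_trans C D F' F'' \<alpha>' by fact
  interpret \<beta>': nat_trans D E G' G'' \<beta>' by fact
  show ?thesis by (rule nt_eqI[where C = C]) (auto simp: \<beta>.natural_Cmp)
qed

lemma nt_hcomp_assoc:
  assumes "nat_trans B C H H' \<gamma>" "nat_trans C D F F' \<alpha>" "nat_trans D E G G' \<beta>"
  shows "nt_hcomp B E G (comp_functor B F' H') \<beta> (nt_hcomp B D F H' \<alpha> \<gamma>) =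
    nt_hcomp B E (comp_functor C G F) H' (nt_hcomp C E G F' \<beta> \<alpha>) \<gamma>"
proof -
  interpret \<alpha>: nat_trans C D F F' \<alpha> by fact
  interpret \<beta>: nat_trans D E G G' \<beta> by fact
  interpret \<gamma>: nat_trans B C H H' \<gamma> by fact
  show ?thesis by (rule nt_eqI[where C = B]) auto
qed

lemma nt_hcomp_unit:
  assumes "nat_trans C D F F' \<alpha>"
  shows "nt_hcomp C D F (id_functor C) \<alpha> (nt_id C C (id_functor C)) = \<alpha>"
    and "nt_hcomp C D (id_functor D) F' (nt_id D D (id_functor D)) \<alpha> = \<alpha>"
proof -
  interpret \<alpha>: nat_trans C D F F' \<alpha> by fact
  show "nt_hcomp C D F (id_functor C) \<alpha> (nt_id C C (id_functor C)) = \<alpha>"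
    "nt_hcomp C D (id_functor D) F' (nt_id D D (id_functor D)) \<alpha> = \<alpha>"
    by (rule nt_eqI[where C = C], use \<alpha>.comp_ext in auto)+
qed

lemma nat_trans_functors: "nat_trans C D F G \<alpha> \<Longrightarrow> is_functor C D F \<and> is_functor C D G"
  by (simp add: nat_trans_def)

lemma category_functor_cat: "category (functor_cat C D)"
  unfolding functor_cat_def
  by (rule category_mk_cat)
    (auto simp: nt_vcomp_assoc nt_vcomp_id nat_trans_nt_id nat_trans_nt_vcomp dest: nat_trans_functors)

lemma functor_cat_simps [simp]:
  "Ob (functor_cat C D) = {F. is_functor C D F}"
  "Ar (functor_cat C D) = {Cell F G \<alpha> |F G \<alpha>. nat_trans C D F G \<alpha>}"
  "nat_trans C D F G \<alpha> \<Longrightarrow> Dom (functor_cat C D) (Cell F G \<alpha>) = F"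
  "nat_trans C D F G \<alpha> \<Longrightarrow> Cod (functor_cat C D) (Cell F G \<alpha>) = G"
  "is_functor C D F \<Longrightarrow> Idn (functor_cat C D) F = Cell F F (nt_id C D F)"
  "nat_trans C D F G \<alpha> \<Longrightarrow> nat_trans C D G H \<beta> \<Longrightarrow>
    Cmp (functor_cat C D) (Cell G H \<beta>) (Cell F G \<alpha>) = Cell F H (nt_vcomp C D \<beta> \<alpha>)"
  by (auto simp: functor_cat_def)

section \<open>2-categories\<close>

context two_category
begin

lemma TComp1_Ob [simp]:
  assumes "X \<in> TOb K" "Y \<in> TOb K" "Z \<in> TOb K" "f \<in> Ob (THom K X Y)" "g \<in> Ob (THom K Y Z)"
  shows "TComp1 K X Y Z g f \<in> Ob (THom K X Z)"
proof -
  interpret is_functor "prod_cat (THom K Y Z) (THom K X Y)" "THom K X Z" "TComp K X Y Z"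
    by (rule TComp_functor) fact+
  show ?thesis using assms by simp
qed

lemma TComp2_simps [simp]:
  assumes "X \<in> TOb K" "Y \<in> TOb K" "Z \<in> TOb K" "s \<in> Ar (THom K X Y)" "t \<in> Ar (THom K Y Z)"
  shows "TComp2 K X Y Z t s \<in> Ar (THom K X Z)"
    "Dom (THom K X Z) (TComp2 K X Y Z t s) =
      TComp1 K X Y Z (Dom (THom K Y Z) t) (Dom (THom K X Y) s)"
    "Cod (THom K X Z) (TComp2 K X Y Z t s) =
      TComp1 K X Y Z (Cod (THom K Y Z) t) (Cod (THom K X Y) s)"
proof -
  interpret is_functor "prod_cat (THom K Y Z) (THom K X Y)" "THom K X Z" "TComp K X Y Z"
    by (rule TComp_functor) fact+
  show "TComp2 K X Y Z t s \<in> Ar (THom K X Z)"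
    "Dom (THom K X Z) (TComp2 K X Y Z t s) =
      TComp1 K X Y Z (Dom (THom K Y Z) t) (Dom (THom K X Y) s)"
    "Cod (THom K X Z) (TComp2 K X Y Z t s) =
      TComp1 K X Y Z (Cod (THom K Y Z) t) (Cod (THom K X Y) s)"
    using assms by simp_all
qed

lemma TComp2_Idn:
  assumes "X \<in> TOb K" "Y \<in> TOb K" "Z \<in> TOb K" "f \<in> Ob (THom K X Y)" "g \<in> Ob (THom K Y Z)"
  shows "TComp2 K X Y Z (Idn (THom K Y Z) g) (Idn (THom K X Y) f) =
    Idn (THom K X Z) (TComp1 K X Y Z g f)"
proof -
  interpret is_functor "prod_cat (THom K Y Z) (THom K X Y)" "THom K X Z" "TComp K X Y Z"
    by (rule TComp_functor) fact+
  show ?thesis using assms far_Idn[of "(g, f)"] by (simp del: far_Idn')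
qed

lemma TComp2_Cmp:
  assumes "X \<in> TOb K" "Y \<in> TOb K" "Z \<in> TOb K"
    and "s \<in> Ar (THom K X Y)" "t \<in> Ar (THom K Y Z)" "s' \<in> Ar (THom K X Y)" "t' \<in> Ar (THom K Y Z)"
    and "Dom (THom K X Y) s' = Cod (THom K X Y) s" "Dom (THom K Y Z) t' = Cod (THom K Y Z) t"
  shows "TComp2 K X Y Z (Cmp (THom K Y Z) t' t) (Cmp (THom K X Y) s' s) =
    Cmp (THom K X Z) (TComp2 K X Y Z t' s') (TComp2 K X Y Z t s)"
proof -
  interpret is_functor "prod_cat (THom K Y Z) (THom K X Y)" "THom K X Z" "TComp K X Y Z"
    by (rule TComp_functor) fact+
  show ?thesis using assms far_Cmp'[of "(t', s')" "(t, s)"] by (simp del: far_Cmp')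
qed

end

text \<open>Composition functors are given here as \<open>mk_functor\<close> of two explicit
  functions \<open>u\<close> and \<open>v\<close>. Stating the laws for \<open>u\<close> and
  \<open>v\<close> keeps the restriction to the carriers out of every verification.\<close>

lemma two_categoryI:
  assumes "\<And>X Y. X \<in> TOb K \<Longrightarrow> Y \<in> TOb K \<Longrightarrow> category (THom K X Y)"
    and "\<And>X. X \<in> TOb K \<Longrightarrow> TId K X \<in> Ob (THom K X X)"
    and "\<And>X Y Z. X \<in> TOb K \<Longrightarrow> Y \<in> TOb K \<Longrightarrow> Z \<in> TOb K \<Longrightarrow>
      TComp K X Y Z = mk_functor (prod_cat (THom K Y Z) (THom K X Y)) (u X Y Z) (v X Y Z)"
    and "\<And>X Y Z f g. X \<in> TOb K \<Longrightarrow> Y \<in> TOb K \<Longrightarrow> Z \<in> TOb K \<Longrightarrow> f \<in> Ob (THom K X Y) \<Longrightarrow>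
      g \<in> Ob (THom K Y Z) \<Longrightarrow> u X Y Z (g, f) \<in> Ob (THom K X Z)"
    and "\<And>X Y Z s t. X \<in> TOb K \<Longrightarrow> Y \<in> TOb K \<Longrightarrow> Z \<in> TOb K \<Longrightarrow> s \<in> Ar (THom K X Y) \<Longrightarrow>
      t \<in> Ar (THom K Y Z) \<Longrightarrow> v X Y Z (t, s) \<in>
        homset (THom K X Z) (u X Y Z (Dom (THom K Y Z) t, Dom (THom K X Y) s))
          (u X Y Z (Cod (THom K Y Z) t, Cod (THom K X Y) s))"
    and "\<And>X Y Z f g. X \<in> TOb K \<Longrightarrow> Y \<in> TOb K \<Longrightarrow> Z \<in> TOb K \<Longrightarrow> f \<in> Ob (THom K X Y) \<Longrightarrow>
      g \<in> Ob (THom K Y Z) \<Longrightarrow> v X Y Z (Idn (THom K Y Z) g, Idn (THom K X Y) f) =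
        Idn (THom K X Z) (u X Y Z (g, f))"
    and "\<And>X Y Z s t s' t'. X \<in> TOb K \<Longrightarrow> Y \<in> TOb K \<Longrightarrow> Z \<in> TOb K \<Longrightarrow> s \<in> Ar (THom K X Y) \<Longrightarrow>
      t \<in> Ar (THom K Y Z) \<Longrightarrow> s' \<in> Ar (THom K X Y) \<Longrightarrow> t' \<in> Ar (THom K Y Z) \<Longrightarrow>
      Dom (THom K X Y) s' = Cod (THom K X Y) s \<Longrightarrow> Dom (THom K Y Z) t' = Cod (THom K Y Z) t \<Longrightarrow>
      v X Y Z (Cmp (THom K Y Z) t' t, Cmp (THom K X Y) s' s) =
        Cmp (THom K X Z) (v X Y Z (t', s')) (v X Y Z (t, s))"
    and "\<And>W X Y Z f g h. W \<in> TOb K \<Longrightarrow> X \<in> TOb K \<Longrightarrow> Y \<in> TOb K \<Longrightarrow> Z \<in> TOb K \<Longrightarrow>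
      f \<in> Ob (THom K W X) \<Longrightarrow> g \<in> Ob (THom K X Y) \<Longrightarrow> h \<in> Ob (THom K Y Z) \<Longrightarrow>
      u W Y Z (h, u W X Y (g, f)) = u W X Z (u X Y Z (h, g), f)"
    and "\<And>W X Y Z r s t. W \<in> TOb K \<Longrightarrow> X \<in> TOb K \<Longrightarrow> Y \<in> TOb K \<Longrightarrow> Z \<in> TOb K \<Longrightarrow>
      r \<in> Ar (THom K W X) \<Longrightarrow> s \<in> Ar (THom K X Y) \<Longrightarrow> t \<in> Ar (THom K Y Z) \<Longrightarrow>
      v W Y Z (t, v W X Y (s, r)) = v W X Z (v X Y Z (t, s), r)"
    and "\<And>X Y f. X \<in> TOb K \<Longrightarrow> Y \<in> TOb K \<Longrightarrow> f \<in> Ob (THom K X Y) \<Longrightarrow>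
      u X X Y (f, TId K X) = f \<and> u X Y Y (TId K Y, f) = f"
    and "\<And>X Y s. X \<in> TOb K \<Longrightarrow> Y \<in> TOb K \<Longrightarrow> s \<in> Ar (THom K X Y) \<Longrightarrow>
      v X X Y (s, TId2 K X) = s \<and> v X Y Y (TId2 K Y, s) = s"
  shows "two_category K"
proof (rule two_category.intro)
  fix X Y Z assume XYZ: "X \<in> TOb K" "Y \<in> TOb K" "Z \<in> TOb K"
  interpret XY: category "THom K X Y" using XYZ assms(1) by blast
  interpret YZ: category "THom K Y Z" using XYZ assms(1) by blast
  show "is_functor (prod_cat (THom K Y Z) (THom K X Y)) (THom K X Z) (TComp K X Y Z)"
    unfolding assms(3)[OF XYZ]
    apply (rule is_functor_mk_functor)
    using XYZ assms(1) assms(4,6,7)[OF XYZ] assms(5)[OF XYZ, unfolded mem_homset]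
    by (auto intro: category_prod_cat)
next
  fix X Y s assume XY: "X \<in> TOb K" "Y \<in> TOb K" "s \<in> Ar (THom K X Y)"
  interpret XX: category "THom K X X" using XY assms(1) by blast
  interpret YY: category "THom K Y Y" using XY assms(1) by blast
  show "TComp2 K X X Y s (TId2 K X) = s \<and> TComp2 K X Y Y (TId2 K Y) s = s"
    using XY assms(2,3,11) by simp
qed (use assms(1,2,3,4,8,9,10) assms(5)[unfolded mem_homset] in \<open>simp_all\<close>)

lemma two_category_full_sub:
  assumes "two_category K" shows "two_category (full_sub_two_cat K P)"
proof -
  interpret two_category K by fact
  show ?thesis
    by (rule two_category.intro)
      (simp_all add: full_sub_two_cat_def hom_category TId_ob TComp_functor assoc1 assoc2 unit1 unit2)
qed

lemma locally_full_sub_simps [simp]: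
  "TOb (locally_full_sub_two_cat K S) = TOb K"
  "THom (locally_full_sub_two_cat K S) X Y = full_subcat (THom K X Y) (S X Y)"
  "TId (locally_full_sub_two_cat K S) X = TId K X"
  by (simp_all add: locally_full_sub_two_cat_def)

lemma locally_full_sub_TComp [simp]:
  "f \<in> Ob (THom K X Y) \<Longrightarrow> f \<in> S X Y \<Longrightarrow> g \<in> Ob (THom K Y Z) \<Longrightarrow> g \<in> S Y Z \<Longrightarrow>
    TComp1 (locally_full_sub_two_cat K S) X Y Z g f = TComp1 K X Y Z g f"
  "s \<in> Ar (THom K X Y) \<Longrightarrow> Dom (THom K X Y) s \<in> S X Y \<Longrightarrow> Cod (THom K X Y) s \<in> S X Y \<Longrightarrow>
    t \<in> Ar (THom K Y Z) \<Longrightarrow> Dom (THom K Y Z) t \<in> S Y Z \<Longrightarrow> Cod (THom K Y Z) t \<in> S Y Z \<Longrightarrow>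
    TComp2 (locally_full_sub_two_cat K S) X Y Z t s = TComp2 K X Y Z t s"
  by (simp_all add: locally_full_sub_two_cat_def)

text \<open>All 2-cells between selected 1-cells are kept, so closure of \<open>S\<close> under
  identities and composition of 1-cells is the only thing to check; every law is inherited.\<close>

lemma two_category_locally_full_sub:
  assumes "two_category K"
    and TId_S: "\<And>X. X \<in> TOb K \<Longrightarrow> TId K X \<in> S X X"
    and TComp_S: "\<And>X Y Z f g. X \<in> TOb K \<Longrightarrow> Y \<in> TOb K \<Longrightarrow> Z \<in> TOb K \<Longrightarrow>
      f \<in> Ob (THom K X Y) \<Longrightarrow> f \<in> S X Y \<Longrightarrow> g \<in> Ob (THom K Y Z) \<Longrightarrow> g \<in> S Y Z \<Longrightarrow>
      TComp1 K X Y Z g f \<in> S X Z"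
  shows "two_category (locally_full_sub_two_cat K S)"
proof -
  interpret two_category K by fact
  note hom_simps = category.Dom_Ob[OF hom_category] category.Cod_Ob[OF hom_category]
    category.Idn_simps[OF hom_category] category.Cmp_simps[OF hom_category]
  show ?thesis
    apply (rule two_categoryI[where u = "\<lambda>X Y Z. fob (TComp K X Y Z)" and v = "\<lambda>X Y Z. far (TComp K X Y Z)"])
              apply (simp_all add: hom_category category_full_subcat TId_ob TId_S TComp_S hom_simps TComp2_Idn TComp2_Cmp assoc1 assoc2 unit1 unit2)
    apply (simp add: locally_full_sub_two_cat_def)
    done
qed

section \<open>The 2-category of finite-limit categories\<close>

lemma Cat_pt_simps [simp]:
  "X \<in> TOb Cat_pt \<longleftrightarrow> category (fst X) \<and> snd X \<in> Ob (fst X)"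
  "THom Cat_pt X Y = functor_cat (fst X) (fst Y)"
  "TId Cat_pt X = id_functor (fst X)"
  by (auto simp: Cat_pt_def split: prod.splits)

lemma Cat_pt_TComp [simp]:
  "is_functor (fst X) (fst Y) F \<Longrightarrow> is_functor (fst Y) (fst Z) G \<Longrightarrow>
    TComp1 Cat_pt X Y Z G F = comp_functor (fst X) G F"
  "nat_trans (fst X) (fst Y) F F' \<alpha> \<Longrightarrow> nat_trans (fst Y) (fst Z) G G' \<beta> \<Longrightarrow>
    TComp2 Cat_pt X Y Z (Cell G G' \<beta>) (Cell F F' \<alpha>) =
      Cell (comp_functor (fst X) G F) (comp_functor (fst X) G' F')
        (nt_hcomp (fst X) (fst Z) G F' \<beta> \<alpha>)"
  by (auto simp: Cat_pt_def split: prod.splits)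

lemma two_category_Cat_pt: "two_category Cat_pt"
  apply (rule two_categoryI[where u = "\<lambda>X Y Z. \<lambda>(G, F). comp_functor (fst X) G F"
      and v = "\<lambda>X Y Z. \<lambda>(t, s). Cell (comp_functor (fst X) (src t) (src s))
        (comp_functor (fst X) (tgt t) (tgt s))
        (nt_hcomp (fst X) (fst Z) (src t) (tgt s) (comps t) (comps s))"])
  apply (auto simp: category_functor_cat is_functor_id_functor nat_trans_nt_id
      is_functor_comp_functor nat_trans_nt_hcomp nat_trans_nt_vcomp nt_hcomp_nt_id
      nt_hcomp_nt_vcomp comp_functor_id_left comp_functor_id_right nt_hcomp_unit
      dest: nat_trans_functors)
  apply (auto simp: Cat_pt_def split: prod.splits) [1]
  subgoal by (rule comp_functor_assoc)
  subgoal by (rule comp_functor_assoc, drule nat_trans_functors, blast)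
  subgoal by (rule comp_functor_assoc, drule nat_trans_functors, blast)
  subgoal by (rule nt_hcomp_assoc)
  done

section \<open>Arrow categories\<close>

lemma arrow_cat_Ar:
  "s \<in> Ar (arrow_cat C) \<longleftrightarrow> sq_dom s \<in> Ar C \<and> sq_cod s \<in> Ar C \<and>
     sq_top s \<in> homset C (Dom C (sq_dom s)) (Dom C (sq_cod s)) \<and>
     sq_bot s \<in> homset C (Cod C (sq_dom s)) (Cod C (sq_cod s)) \<and>
     Cmp C (sq_cod s) (sq_top s) = Cmp C (sq_bot s) (sq_dom s)"
  by (cases s) (auto simp: arrow_cat_def)

lemma arrow_cat_ArD:
  assumes "s \<in> Ar (arrow_cat C)"
  shows "sq_dom s \<in> Ar C" "sq_cod s \<in> Ar C" "sq_top s \<in> Ar C" "sq_bot s \<in> Ar C"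
    "Dom C (sq_top s) = Dom C (sq_dom s)" "Cod C (sq_top s) = Dom C (sq_cod s)"
    "Dom C (sq_bot s) = Cod C (sq_dom s)" "Cod C (sq_bot s) = Cod C (sq_cod s)"
    "Cmp C (sq_cod s) (sq_top s) = Cmp C (sq_bot s) (sq_dom s)"
  using assms by (auto simp: arrow_cat_Ar)

lemma Ob_arrow_cat [simp]: "Ob (arrow_cat C) = Ar C"
  by (simp add: arrow_cat_def)

lemma arrow_cat_simps [simp]:
  "s \<in> Ar (arrow_cat C) \<Longrightarrow> Dom (arrow_cat C) s = sq_dom s"
  "s \<in> Ar (arrow_cat C) \<Longrightarrow> Cod (arrow_cat C) s = sq_cod s"
  "f \<in> Ar C \<Longrightarrow> Idn (arrow_cat C) f = Square f (Idn C (Dom C f)) (Idn C (Cod C f)) f"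
  "t \<in> Ar (arrow_cat C) \<Longrightarrow> s \<in> Ar (arrow_cat C) \<Longrightarrow> sq_dom t = sq_cod s \<Longrightarrow>
    Cmp (arrow_cat C) t s =
      Square (sq_dom s) (Cmp C (sq_top t) (sq_top s)) (Cmp C (sq_bot t) (sq_bot s)) (sq_cod t)"
  by (auto simp: arrow_cat_def)

lemma square_eqI:
  "sq_dom s = sq_dom t \<Longrightarrow> sq_top s = sq_top t \<Longrightarrow> sq_bot s = sq_bot t \<Longrightarrow> sq_cod s = sq_cod t \<Longrightarrow> s = t"
  by (cases s; cases t) auto

text \<open>Pasting of commutative squares, with both sides nested to the right as the simplifier
  leaves them.\<close>

lemma (in category) square_Cmp:
  assumes "s \<in> Ar (arrow_cat C)" "t \<in> Ar (arrow_cat C)" "sq_dom t = sq_cod s"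
  shows "Cmp C (sq_cod t) (Cmp C (sq_top t) (sq_top s)) =
    Cmp C (sq_bot t) (Cmp C (sq_bot s) (sq_dom s))"
proof -
  note s = arrow_cat_ArD[OF assms(1)] and t = arrow_cat_ArD[OF assms(2)]
  have "Cmp C (sq_cod t) (Cmp C (sq_top t) (sq_top s)) =
      Cmp C (Cmp C (sq_cod t) (sq_top t)) (sq_top s)"
    using s t(1-8) assms(3) by (subst Cmp_assoc') auto
  also have "\<dots> = Cmp C (Cmp C (sq_bot t) (sq_cod s)) (sq_top s)"
    using t(9) assms(3) by simp
  also have "\<dots> = Cmp C (sq_bot t) (Cmp C (sq_bot s) (sq_dom s))"
    using s t(1-8) assms(3) by simp
  finally show ?thesis .
qed

lemma (in category) Square_Idn_Ar [simp]:
  "f \<in> Ar C \<Longrightarrow> Dom C f = x \<Longrightarrow> Cod C f = y \<Longrightarrow> Square f (Idn C x) (Idn C y) f \<in> Ar (arrow_cat C)"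
  by (auto simp: arrow_cat_Ar)

lemma category_arrow_cat:
  assumes "category C" shows "category (arrow_cat C)"
proof -
  interpret category C by fact
  let ?A = "{Square f u v g |f u v g. f \<in> Ar C \<and> g \<in> Ar C \<and> u \<in> homset C (Dom C f) (Dom C g) \<and>
         v \<in> homset C (Cod C f) (Cod C g) \<and> Cmp C g u = Cmp C v f}"
  \<comment> \<open>Turns the raw set comprehension back into membership in
    \<open>Ar (arrow_cat C)\<close>, so that its description by selectors in
    \<open>arrow_cat_Ar\<close> applies.\<close>
  have *: "s \<in> ?A \<longleftrightarrow> s \<in> Ar (arrow_cat C)" for s
    by (simp add: arrow_cat_def)
  show ?thesis unfolding arrow_cat_def
    by (rule category_mk_cat, unfold *)
      (auto simp: arrow_cat_Ar square_Cmp intro!: square_eqI)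
qed

lemma is_functor_cod_functor:
  assumes "category C" shows "is_functor (arrow_cat C) C (cod_functor C)"
proof -
  interpret category C by fact
  show ?thesis unfolding cod_functor_def
    by (rule is_functor_mk_functor)
      (auto simp: category_arrow_cat assms arrow_cat_ArD)
qed

lemma cod_functor_simps [simp]:
  "f \<in> Ar C \<Longrightarrow> fob (cod_functor C) f = Cod C f"
  "s \<in> Ar (arrow_cat C) \<Longrightarrow> far (cod_functor C) s = sq_bot s"
  by (auto simp: cod_functor_def)

lemma arrow_functor_simps [simp]:
  "f \<in> Ar C \<Longrightarrow> fob (arrow_functor C F) f = far F f"
  "s \<in> Ar (arrow_cat C) \<Longrightarrow> far (arrow_functor C F) s = map_square (far F) s"
  by (auto simp: arrow_functor_def)

lemma map_square_sel [simp]: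
  "sq_dom (map_square h s) = h (sq_dom s)" "sq_top (map_square h s) = h (sq_top s)"
  "sq_bot (map_square h s) = h (sq_bot s)" "sq_cod (map_square h s) = h (sq_cod s)"
  by (cases s; simp)+

lemma is_functor_arrow_functor:
  assumes "is_functor C D F"
  shows "is_functor (arrow_cat C) (arrow_cat D) (arrow_functor C F)"
proof -
  interpret is_functor C D F by fact
  interpret AC: category "arrow_cat C" by (rule category_arrow_cat) (rule C.category_axioms)
  interpret AD: category "arrow_cat D" by (rule category_arrow_cat) (rule D.category_axioms)
  have *: "map_square (far F) s \<in> Ar (arrow_cat D)" if "s \<in> Ar (arrow_cat C)" for s
  proof -
    note s = arrow_cat_ArD[OF that]
    have "Cmp D (far F (sq_cod s)) (far F (sq_top s)) = Cmp D (far F (sq_bot s)) (far F (sq_dom s))"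
      using s by (simp flip: far_Cmp')
    then show ?thesis using s(1-8) by (auto simp: arrow_cat_Ar)
  qed
  show ?thesis unfolding arrow_functor_def
  proof (rule is_functor_mk_functor)
    fix g f assume gf: "g \<in> Ar (arrow_cat C)" "f \<in> Ar (arrow_cat C)"
      "Dom (arrow_cat C) g = Cod (arrow_cat C) f"
    then have "sq_dom g = sq_cod f" by simp
    then show "map_square (far F) (Cmp (arrow_cat C) g f) =
        Cmp (arrow_cat D) (map_square (far F) g) (map_square (far F) f)"
      using gf by (auto simp: * arrow_cat_ArD intro!: square_eqI)
  qed (auto simp: * AC.category_axioms AD.category_axioms arrow_cat_ArD)
qed

lemma (in is_functor) map_square_Ar [simp]:
  "s \<in> Ar (arrow_cat C) \<Longrightarrow> map_square (far F) s \<in> Ar (arrow_cat D)"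
  using is_functor.far_simps(1)[OF is_functor_arrow_functor[OF is_functor_axioms], of s] by simp

lemma is_functor_into_arrow_cat:
  assumes "is_functor T (arrow_cat C) F" "f \<in> Ar T"
  shows "sq_dom (far F f) = fob F (Dom T f)" "sq_cod (far F f) = fob F (Cod T f)"
proof -
  interpret is_functor T "arrow_cat C" F by fact
  show "sq_dom (far F f) = fob F (Dom T f)" "sq_cod (far F f) = fob F (Cod T f)"
    using far_simps[OF assms(2)] by auto
qed

section \<open>Comprehension categories\<close>

context comp_cat
begin

sublocale P: is_functor "Tot X" "Base X" "Proj X"
  using Proj_fibration by (simp add: fibration_def)

sublocale Chi: is_functor "Tot X" "arrow_cat (Base X)" "Chi X"
  by (rule Chi_functor)

lemma Cod_Chi [simp]: "A \<in> Ob (Tot X) \<Longrightarrow> Cod (Base X) (fob (Chi X) A) = fob (Proj X) A"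
  using Chi.fob_Ob[of A] by (simp flip: cod_Chi)

lemma Chi_Ar [simp]: "A \<in> Ob (Tot X) \<Longrightarrow> fob (Chi X) A \<in> Ar (Base X)"
  using Chi.fob_Ob[of A] by simp

lemma sq_Chi [simp]:
  assumes "f \<in> Ar (Tot X)"
  shows "sq_dom (far (Chi X) f) = fob (Chi X) (Dom (Tot X) f)"
    "sq_cod (far (Chi X) f) = fob (Chi X) (Cod (Tot X) f)"
    "sq_bot (far (Chi X) f) = far (Proj X) f"
    "sq_top (far (Chi X) f) \<in> Ar (Base X)"
    "Dom (Base X) (sq_top (far (Chi X) f)) = ctx_ext X (Dom (Tot X) f)"
    "Cod (Base X) (sq_top (far (Chi X) f)) = ctx_ext X (Cod (Tot X) f)"
proof -
  note f = assms Chi.far_simps(1)[OF assms]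
  show 1: "sq_dom (far (Chi X) f) = fob (Chi X) (Dom (Tot X) f)"
    "sq_cod (far (Chi X) f) = fob (Chi X) (Cod (Tot X) f)"
    using is_functor_into_arrow_cat[OF Chi.is_functor_axioms assms] .
  show "sq_bot (far (Chi X) f) = far (Proj X) f"
    using f by (simp flip: cod_Chi)
  show "sq_top (far (Chi X) f) \<in> Ar (Base X)"
    "Dom (Base X) (sq_top (far (Chi X) f)) = ctx_ext X (Dom (Tot X) f)"
    "Cod (Base X) (sq_top (far (Chi X) f)) = ctx_ext X (Cod (Tot X) f)"
    using arrow_cat_ArD[OF f(2)] 1 by (auto simp: ctx_ext_def)
qed

lemma ctx_ext_Ob [simp]: "A \<in> Ob (Tot X) \<Longrightarrow> ctx_ext X A \<in> Ob (Base X)"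
  by (simp add: ctx_ext_def)

lemma Dom_Chi [simp]: "Dom (Base X) (fob (Chi X) A) = ctx_ext X A"
  by (simp add: ctx_ext_def)

end

subsection \<open>Maps\<close>

text \<open>\<open>pseudo_map\<close> does not itself say that \<open>X\<close> and \<open>Y\<close>
  are comprehension categories. Bundling the three makes all functors and the comparison
  transformation available at once.\<close>

locale pseudo_map' = X: comp_cat X + Y: comp_cat Y + pseudo_map X Y M
  for X :: "('o, 'a, 'e, 'b, 'z) compcat_scheme" and Y :: "('o, 'a, 'e, 'b, 'z) compcat_scheme"
    and M :: "('o, 'a, 'e, 'b, 'y) compmap_scheme"
begin

sublocale F: is_functor "Base X" "Base Y" "mbase M"
  by (rule mbase_functor)

sublocale Ft: is_functor "Tot X" "Tot Y" "mtotal M"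
  by (rule mtotal_functor)

sublocale AF: is_functor "arrow_cat (Base X)" "arrow_cat (Base Y)" "arrow_functor (Base X) (mbase M)"
  by (rule is_functor_arrow_functor[OF mbase_functor])

sublocale phi: nat_trans "Tot X" "arrow_cat (Base Y)"
  "comp_functor (Tot X) (Chi Y) (mtotal M)"
  "comp_functor (Tot X) (arrow_functor (Base X) (mbase M)) (Chi X)" "mcomp M"
  using mcomp_iso by (simp add: nat_iso_def)

lemma Proj_mtotal [simp]:
  "A \<in> Ob (Tot X) \<Longrightarrow> fob (Proj Y) (fob (mtotal M) A) = fob (mbase M) (fob (Proj X) A)"
  "f \<in> Ar (Tot X) \<Longrightarrow> far (Proj Y) (far (mtotal M) f) = far (mbase M) (far (Proj X) f)"
  using comp_functor_eqD[OF mtotal_over] by auto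

lemma mcomp_simps [simp]:
  assumes "A \<in> Ob (Tot X)"
  shows "mcomp M A \<in> Ar (arrow_cat (Base Y))"
    "iso_arr (arrow_cat (Base Y)) (mcomp M A)"
    "sq_dom (mcomp M A) = fob (Chi Y) (fob (mtotal M) A)"
    "sq_cod (mcomp M A) = far (mbase M) (fob (Chi X) A)"
    "sq_bot (mcomp M A) = Idn (Base Y) (fob (mbase M) (fob (Proj X) A))"
    "sq_top (mcomp M A) \<in> Ar (Base Y)"
    "Dom (Base Y) (sq_top (mcomp M A)) = ctx_ext Y (fob (mtotal M) A)"
    "Cod (Base Y) (sq_top (mcomp M A)) = fob (mbase M) (ctx_ext X A)"
proof -
  show A: "mcomp M A \<in> Ar (arrow_cat (Base Y))"
    by (rule phi.comp_simps[OF assms])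
  show "iso_arr (arrow_cat (Base Y)) (mcomp M A)"
    using mcomp_iso assms by (simp add: nat_iso_def)
  show d: "sq_dom (mcomp M A) = fob (Chi Y) (fob (mtotal M) A)"
    "sq_cod (mcomp M A) = far (mbase M) (fob (Chi X) A)"
    using phi.comp_simps[OF assms] assms by auto
  show "sq_bot (mcomp M A) = Idn (Base Y) (fob (mbase M) (fob (Proj X) A))"
    by (rule mcomp_over[OF assms])
  show "sq_top (mcomp M A) \<in> Ar (Base Y)"
    "Dom (Base Y) (sq_top (mcomp M A)) = ctx_ext Y (fob (mtotal M) A)"
    "Cod (Base Y) (sq_top (mcomp M A)) = fob (mbase M) (ctx_ext X A)"
    using arrow_cat_ArD[OF A] d assms by auto
qed

text \<open>The top edge of the naturality square of the comparison. It is the only informative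
  edge: the bottom edges of the comparisons are identities.\<close>

lemma mcomp_natural_top:
  assumes "f \<in> Ar (Tot X)"
  shows "Cmp (Base Y) (sq_top (mcomp M (Cod (Tot X) f))) (sq_top (far (Chi Y) (far (mtotal M) f))) =
    Cmp (Base Y) (far (mbase M) (sq_top (far (Chi X) f))) (sq_top (mcomp M (Dom (Tot X) f)))"
  using arg_cong[OF phi.natural'[OF assms refl refl], of sq_top] assms
  by simp

end

lemma pseudo_map'I: "comp_cat X \<Longrightarrow> comp_cat Y \<Longrightarrow> pseudo_map X Y M \<Longrightarrow> pseudo_map' X Y M"
  by (simp add: pseudo_map'_def)

lemma rooted_compcat_is_comp_cat: "rooted_comp_cat X \<Longrightarrow> comp_cat X"
  by (simp add: rooted_comp_cat_def)

lemma arrow_functor_id: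
  assumes "category C" shows "arrow_functor C (id_functor C) = id_functor (arrow_cat C)"
  unfolding arrow_functor_def id_functor_def[of "arrow_cat C"]
  by (rule mk_functor_eqI) (auto simp: arrow_cat_ArD intro!: square_eqI)

lemma id_map_sel [simp]:
  "mbase (id_map X) = id_functor (Base X)"
  "mtotal (id_map X) = id_functor (Tot X)"
  "mcomp (id_map X) = nt_id (Tot X) (arrow_cat (Base X)) (Chi X)"
  "mroot (id_map X) = Idn (Base X) (Root X)"
  by (simp_all add: id_map_def)

lemma rooted_pseudo_map_id_map:
  assumes "rooted_comp_cat X" shows "rooted_pseudo_map X X (id_map X)"
proof -
  interpret rooted_comp_cat X by fact
  have root: "Root X \<in> Ob (Base X)"
    using Root_terminal by (simp add: terminal_def)
  show ?thesis
  proof (intro rooted_pseudo_map.intro pseudo_map.intro rooted_pseudo_map_axioms.intro, unfold id_map_sel)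
    show "is_functor (Base X) (Base X) (id_functor (Base X))"
      "is_functor (Tot X) (Tot X) (id_functor (Tot X))"
      by (simp_all add: is_functor_id_functor P.C.category_axioms P.D.category_axioms)
    show "comp_functor (Tot X) (Proj X) (id_functor (Tot X)) =
        comp_functor (Tot X) (id_functor (Base X)) (Proj X)"
      by (simp add: comp_functor_id_left[OF P.is_functor_axioms]
          comp_functor_id_right[OF P.is_functor_axioms])
    show "cartesian (Tot X) (Base X) (Proj X) (far (id_functor (Tot X)) f)"
      if "cartesian (Tot X) (Base X) (Proj X) f" for f
      using that by (simp add: cartesian_def)
    show "nat_iso (Tot X) (arrow_cat (Base X)) (comp_functor (Tot X) (Chi X) (id_functor (Tot X)))
        (comp_functor (Tot X) (arrow_functor (Base X) (id_functor (Base X))) (Chi X))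
        (nt_id (Tot X) (arrow_cat (Base X)) (Chi X))"
      using Chi.is_functor_axioms
      by (simp add: arrow_functor_id P.D.category_axioms comp_functor_id_left[OF Chi.is_functor_axioms]
          comp_functor_id_right[OF Chi.is_functor_axioms] nat_iso_def nat_trans_nt_id Chi.D.iso_arr_Idn[simplified] del: arrow_cat_simps)
    show "sq_bot (nt_id (Tot X) (arrow_cat (Base X)) (Chi X) A) =
        Idn (Base X) (fob (id_functor (Base X)) (fob (Proj X) A))" if "A \<in> Ob (Tot X)" for A
      using that by simp
    show "Idn (Base X) (Root X) \<in> homset (Base X) (Root X) (fob (id_functor (Base X)) (Root X))"
      "iso_arr (Base X) (Idn (Base X) (Root X))"
      using root by simp_all
  qed
qed

lemma map_comp_sel [simp]:
  "mbase (map_comp X Y Z N M) = comp_functor (Base X) (mbase N) (mbase M)"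
  "mtotal (map_comp X Y Z N M) = comp_functor (Tot X) (mtotal N) (mtotal M)"
  "A \<in> Ob (Tot X) \<Longrightarrow> mcomp (map_comp X Y Z N M) A = Cmp (arrow_cat (Base Z))
       (far (arrow_functor (Base Y) (mbase N)) (mcomp M A)) (mcomp N (fob (mtotal M) A))"
  "mcomp (map_comp X Y Z N M) \<in> extensional (Ob (Tot X))"
  "mroot (map_comp X Y Z N M) = Cmp (Base Z) (far (mbase N) (mroot M)) (mroot N)"
  by (simp_all add: map_comp_def)

text \<open>Both comparison squares have identities as bottom edges, so composing them only composes
  the tops. Later computations use this explicit square instead of a composite in
  \<open>arrow_cat\<close>.\<close>

lemma mcomp_map_comp:
  assumes "pseudo_map' X Y M" "pseudo_map' Y Z N" "A \<in> Ob (Tot X)"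
  shows "mcomp (map_comp X Y Z N M) A =
      Square (fob (Chi Z) (fob (mtotal N) (fob (mtotal M) A)))
        (Cmp (Base Z) (far (mbase N) (sq_top (mcomp M A))) (sq_top (mcomp N (fob (mtotal M) A))))
        (Idn (Base Z) (fob (mbase N) (fob (mbase M) (fob (Proj X) A))))
        (far (mbase N) (far (mbase M) (fob (Chi X) A)))"
proof -
  interpret M: pseudo_map' X Y M by fact
  interpret N: pseudo_map' Y Z N by fact
  show ?thesis using assms(3) by simp
qed

lemma rooted_pseudo_map_map_comp:
  assumes X: "rooted_comp_cat X" and Y: "rooted_comp_cat Y" and Z: "rooted_comp_cat Z"
    and M: "rooted_pseudo_map X Y M" and N: "rooted_pseudo_map Y Z N"
  shows "rooted_pseudo_map X Z (map_comp X Y Z N M)"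
proof -
  interpret M0: rooted_pseudo_map X Y M by fact
  interpret N0: rooted_pseudo_map Y Z N by fact
  interpret M: pseudo_map' X Y M
    by (intro pseudo_map'I rooted_compcat_is_comp_cat X Y M0.pseudo_map_axioms)
  interpret N: pseudo_map' Y Z N
    by (intro pseudo_map'I rooted_compcat_is_comp_cat Y Z N0.pseudo_map_axioms)
  note AZ = category_arrow_cat[OF N.Y.P.D.category_axioms]
  have comp: "mcomp (map_comp X Y Z N M) A =
      Square (fob (Chi Z) (fob (mtotal N) (fob (mtotal M) A)))
        (Cmp (Base Z) (far (mbase N) (sq_top (mcomp M A))) (sq_top (mcomp N (fob (mtotal M) A))))
        (Idn (Base Z) (fob (mbase N) (fob (mbase M) (fob (Proj X) A))))
        (far (mbase N) (far (mbase M) (fob (Chi X) A)))"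
    "mcomp (map_comp X Y Z N M) A \<in> Ar (arrow_cat (Base Z))"
    "iso_arr (arrow_cat (Base Z)) (mcomp (map_comp X Y Z N M) A)" if "A \<in> Ob (Tot X)" for A
  proof -
    note A = that
    show "mcomp (map_comp X Y Z N M) A =
      Square (fob (Chi Z) (fob (mtotal N) (fob (mtotal M) A)))
        (Cmp (Base Z) (far (mbase N) (sq_top (mcomp M A))) (sq_top (mcomp N (fob (mtotal M) A))))
        (Idn (Base Z) (fob (mbase N) (fob (mbase M) (fob (Proj X) A))))
        (far (mbase N) (far (mbase M) (fob (Chi X) A)))"
      by (rule mcomp_map_comp[OF M.pseudo_map'_axioms N.pseudo_map'_axioms A])
    show iso: "iso_arr (arrow_cat (Base Z)) (mcomp (map_comp X Y Z N M) A)"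
      unfolding map_comp_sel(3)[OF A]
      by (rule category.iso_arr_Cmp[OF AZ]) (use A N.AF.far_iso[OF M.mcomp_simps(2)[OF A]] in auto)
    show "mcomp (map_comp X Y Z N M) A \<in> Ar (arrow_cat (Base Z))"
      by (rule category.iso_arr_Ar[OF AZ iso])
  qed
  have comp_sel:
    "sq_dom (mcomp (map_comp X Y Z N M) A) = fob (Chi Z) (fob (mtotal N) (fob (mtotal M) A))"
    "sq_top (mcomp (map_comp X Y Z N M) A) =
      Cmp (Base Z) (far (mbase N) (sq_top (mcomp M A))) (sq_top (mcomp N (fob (mtotal M) A)))"
    "sq_bot (mcomp (map_comp X Y Z N M) A) = Idn (Base Z) (fob (mbase N) (fob (mbase M) (fob (Proj X) A)))"
    "sq_cod (mcomp (map_comp X Y Z N M) A) = far (mbase N) (far (mbase M) (fob (Chi X) A))"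
    if "A \<in> Ob (Tot X)" for A
    using comp(1)[OF that] by simp_all
  have F: "is_functor (Base X) (Base Z) (comp_functor (Base X) (mbase N) (mbase M))"
    by (rule is_functor_comp_functor[OF M0.mbase_functor N0.mbase_functor])
  have Ft: "is_functor (Tot X) (Tot Z) (comp_functor (Tot X) (mtotal N) (mtotal M))"
    by (rule is_functor_comp_functor[OF M0.mtotal_functor N0.mtotal_functor])
  show ?thesis
  proof (intro rooted_pseudo_map.intro pseudo_map.intro rooted_pseudo_map_axioms.intro, unfold map_comp_sel(1,2))
    show "is_functor (Base X) (Base Z) (comp_functor (Base X) (mbase N) (mbase M))"
      "is_functor (Tot X) (Tot Z) (comp_functor (Tot X) (mtotal N) (mtotal M))"
      by (fact F Ft)+
    show "comp_functor (Tot X) (Proj Z) (comp_functor (Tot X) (mtotal N) (mtotal M)) =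
        comp_functor (Tot X) (comp_functor (Base X) (mbase N) (mbase M)) (Proj X)"
      by (rule is_functor_eqI[OF is_functor_comp_functor[OF Ft N.Y.P.is_functor_axioms]
          is_functor_comp_functor[OF M.X.P.is_functor_axioms F]]) auto
    show "cartesian (Tot Z) (Base Z) (Proj Z) (far (comp_functor (Tot X) (mtotal N) (mtotal M)) f)"
      if "cartesian (Tot X) (Base X) (Proj X) f" for f
      using N0.mtotal_cartesian[OF M0.mtotal_cartesian[OF that]] that by (simp add: cartesian_def)
    show "nat_iso (Tot X) (arrow_cat (Base Z))
        (comp_functor (Tot X) (Chi Z) (comp_functor (Tot X) (mtotal N) (mtotal M)))
        (comp_functor (Tot X) (arrow_functor (Base X) (comp_functor (Base X) (mbase N) (mbase M))) (Chi X))
        (mcomp (map_comp X Y Z N M))"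
      unfolding nat_iso_def
    proof (intro conjI ballI nat_transI)
      fix f assume f: "f \<in> Ar (Tot X)"
      \<comment> \<open>Naturality of the composite comparison pastes two squares: that of
        \<open>mcomp N\<close> at \<open>far (mtotal M) f\<close>, and the image under
        \<open>mbase N\<close> of that of \<open>mcomp M\<close> at \<open>f\<close>.\<close>
      have "Cmp (Base Z) (far (mbase N) (sq_top (mcomp M (Cod (Tot X) f))))
          (Cmp (Base Z) (sq_top (mcomp N (fob (mtotal M) (Cod (Tot X) f))))
            (sq_top (far (Chi Z) (far (mtotal N) (far (mtotal M) f))))) =
          Cmp (Base Z) (far (mbase N) (sq_top (mcomp M (Cod (Tot X) f))))
          (Cmp (Base Z) (far (mbase N) (sq_top (far (Chi Y) (far (mtotal M) f))))
           (sq_top (mcomp N (fob (mtotal M) (Dom (Tot X) f)))))"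
        using N.mcomp_natural_top[of "far (mtotal M) f"] f by simp
      also have "\<dots> = Cmp (Base Z) (far (mbase N) (Cmp (Base Y) (sq_top (mcomp M (Cod (Tot X) f)))
          (sq_top (far (Chi Y) (far (mtotal M) f)))))
           (sq_top (mcomp N (fob (mtotal M) (Dom (Tot X) f))))"
        using f by simp
      also have "\<dots> = Cmp (Base Z) (far (mbase N) (far (mbase M) (sq_top (far (Chi X) f))))
          (Cmp (Base Z) (far (mbase N) (sq_top (mcomp M (Dom (Tot X) f))))
            (sq_top (mcomp N (fob (mtotal M) (Dom (Tot X) f)))))"
        using f by (subst M.mcomp_natural_top) auto
      finally show "Cmp (arrow_cat (Base Z)) (mcomp (map_comp X Y Z N M) (Cod (Tot X) f))
          (far (comp_functor (Tot X) (Chi Z) (comp_functor (Tot X) (mtotal N) (mtotal M))) f) =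
         Cmp (arrow_cat (Base Z))
          (far (comp_functor (Tot X)
            (arrow_functor (Base X) (comp_functor (Base X) (mbase N) (mbase M))) (Chi X)) f)
          (mcomp (map_comp X Y Z N M) (Dom (Tot X) f))"
        using f comp(2,3) comp_sel is_functor.map_square_Ar[OF F]
        by (auto simp del: map_comp_sel intro!: square_eqI)
    qed (auto simp del: map_comp_sel(3) simp: comp(2,3) comp_sel
         intro!: is_functor_comp_functor[OF Ft N.Y.Chi_functor]
           is_functor_comp_functor[OF M.X.Chi_functor is_functor_arrow_functor[OF F]])
    show "sq_bot (mcomp (map_comp X Y Z N M) A) =
        Idn (Base Z) (fob (comp_functor (Base X) (mbase N) (mbase M)) (fob (Proj X) A))"
      if "A \<in> Ob (Tot X)" for A
      using that by (simp add: comp_sel del: map_comp_sel)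
    have "mroot M \<in> Ar (Base Y)" "mroot N \<in> Ar (Base Z)" "Root X \<in> Ob (Base X)"
      using X M0.mroot_hom N0.mroot_hom
      by (auto simp: rooted_comp_cat_def rooted_comp_cat_axioms_def terminal_def)
    then show "mroot (map_comp X Y Z N M) \<in>
        homset (Base Z) (Root Z) (fob (comp_functor (Base X) (mbase N) (mbase M)) (Root X))"
      "iso_arr (Base Z) (mroot (map_comp X Y Z N M))"
      using M0.mroot_hom N0.mroot_hom M0.mroot_iso N0.mroot_iso
      by (auto intro!: N.Y.P.D.iso_arr_Cmp N.F.far_iso)
  qed
qed

lemma rooted_compmap_eqI:
  fixes M N :: "('o, 'a, 'e, 'b) rooted_compmap"
  assumes "mbase M = mbase N" "mtotal M = mtotal N" "mcomp M = mcomp N" "mroot M = mroot N"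
  shows "M = N"
  using assms by simp

lemma map_comp_assoc:
  assumes W: "rooted_comp_cat W" and X: "rooted_comp_cat X" and Y: "rooted_comp_cat Y"
    and Z: "rooted_comp_cat Z"
    and L: "rooted_pseudo_map W X L" and M: "rooted_pseudo_map X Y M" and N: "rooted_pseudo_map Y Z N"
  shows "map_comp W Y Z N (map_comp W X Y M L) = map_comp W X Z (map_comp X Y Z N M) L"
proof -
  interpret L0: rooted_pseudo_map W X L by fact
  interpret M0: rooted_pseudo_map X Y M by fact
  interpret N0: rooted_pseudo_map Y Z N by fact
  interpret L: pseudo_map' W X L
    by (intro pseudo_map'I rooted_compcat_is_comp_cat W X L0.pseudo_map_axioms)
  interpret M: pseudo_map' X Y M
    by (intro pseudo_map'I rooted_compcat_is_comp_cat X Y M0.pseudo_map_axioms)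
  interpret N: pseudo_map' Y Z N
    by (intro pseudo_map'I rooted_compcat_is_comp_cat Y Z N0.pseudo_map_axioms)
  interpret LM: pseudo_map' W Y "map_comp W X Y M L"
    using rooted_pseudo_map_map_comp[OF W X Y L M]
    by (intro pseudo_map'I rooted_compcat_is_comp_cat W Y) (simp add: rooted_pseudo_map_def)
  interpret NM: pseudo_map' X Z "map_comp X Y Z N M"
    using rooted_pseudo_map_map_comp[OF X Y Z M N]
    by (intro pseudo_map'I rooted_compcat_is_comp_cat X Z) (simp add: rooted_pseudo_map_def)
  show ?thesis
  proof (rule rooted_compmap_eqI)
    show "mcomp (map_comp W Y Z N (map_comp W X Y M L)) = mcomp (map_comp W X Z (map_comp X Y Z N M) L)"
    proof (rule nt_eqI[where C = "Tot W"])
      fix A assume A: "A \<in> Ob (Tot W)"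
      have "mcomp (map_comp W Y Z N (map_comp W X Y M L)) A = Square
          (fob (Chi Z) (fob (mtotal N) (fob (mtotal M) (fob (mtotal L) A))))
          (Cmp (Base Z) (far (mbase N) (Cmp (Base Y) (far (mbase M) (sq_top (mcomp L A)))
            (sq_top (mcomp M (fob (mtotal L) A))))) (sq_top (mcomp N (fob (mtotal M) (fob (mtotal L) A)))))
          (Idn (Base Z) (fob (mbase N) (fob (mbase M) (fob (mbase L) (fob (Proj W) A)))))
          (far (mbase N) (far (mbase M) (far (mbase L) (fob (Chi W) A))))"
        using A mcomp_map_comp[OF LM.pseudo_map'_axioms N.pseudo_map'_axioms A]
          mcomp_map_comp[OF L.pseudo_map'_axioms M.pseudo_map'_axioms A] by simp
      also have "\<dots> = mcomp (map_comp W X Z (map_comp X Y Z N M) L) A"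
        using A mcomp_map_comp[OF L.pseudo_map'_axioms NM.pseudo_map'_axioms A]
          mcomp_map_comp[OF M.pseudo_map'_axioms N.pseudo_map'_axioms, of "fob (mtotal L) A"]
        by simp
      finally show "mcomp (map_comp W Y Z N (map_comp W X Y M L)) A =
        mcomp (map_comp W X Z (map_comp X Y Z N M) L) A" .
    qed simp_all
    show "mroot (map_comp W Y Z N (map_comp W X Y M L)) = mroot (map_comp W X Z (map_comp X Y Z N M) L)"
      using L0.mroot_hom M0.mroot_hom N0.mroot_hom by simp
  qed (simp_all add: comp_functor_assoc[OF L0.mbase_functor] comp_functor_assoc[OF L0.mtotal_functor])
qed

lemma map_comp_id:
  assumes X: "rooted_comp_cat X" and Y: "rooted_comp_cat Y" and M: "rooted_pseudo_map X Y M"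
  shows "map_comp X X Y M (id_map X) = M" "map_comp X Y Y (id_map Y) M = M"
proof -
  interpret M0: rooted_pseudo_map X Y M by fact
  interpret M: pseudo_map' X Y M
    by (intro pseudo_map'I rooted_compcat_is_comp_cat X Y M0.pseudo_map_axioms)
  have r: "Root X \<in> Ob (Base X)" using X
      by (auto simp: rooted_comp_cat_def rooted_comp_cat_axioms_def terminal_def)
  note r = r M0.mroot_hom
  show "map_comp X X Y M (id_map X) = M"
  proof (rule rooted_compmap_eqI)
    show "mcomp (map_comp X X Y M (id_map X)) = mcomp M"
      apply (rule nt_eqI[where C = "Tot X"])
      using M.phi.comp_ext by (auto intro!: square_eqI)
  qed (use r in \<open>simp_all add: comp_functor_id_right[OF M0.mbase_functor] comp_functor_id_right[OF M0.mtotal_functor]\<close>)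
  show "map_comp X Y Y (id_map Y) M = M"
  proof (rule rooted_compmap_eqI)
    show "mcomp (map_comp X Y Y (id_map Y) M) = mcomp M"
      apply (rule nt_eqI[where C = "Tot X"])
      using M.phi.comp_ext by (auto simp: arrow_functor_id[OF M.Y.P.D.category_axioms] intro!: square_eqI)
  qed (use r in \<open>simp_all add: comp_functor_id_left[OF M0.mbase_functor] comp_functor_id_left[OF M0.mtotal_functor]\<close>)
qed

subsection \<open>Transformations\<close>

text \<open>The membership condition in the arrow set of \<open>comp_hom\<close>, folded into one
  predicate for use in conditional rewrite rules. It includes that source and target are pseudo
  maps, because \<open>rooted_comp_trans\<close> alone does not say so.\<close>

definition comp_cell_between :: "('o, 'a, 'e, 'b) rooted_compcat \<Rightarrow> ('o, 'a, 'e, 'b) rooted_compcat \<Rightarrow>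
    ('o, 'a, 'e, 'b) rooted_compmap \<Rightarrow> ('o, 'a, 'e, 'b) rooted_compmap \<Rightarrow>
    ('o \<Rightarrow> 'a) \<Rightarrow> ('e \<Rightarrow> 'b) \<Rightarrow> bool" where
  "comp_cell_between X Y M N \<alpha> \<alpha>' \<longleftrightarrow>
     rooted_pseudo_map X Y M \<and> rooted_pseudo_map X Y N \<and> rooted_comp_trans X Y M N \<alpha> \<alpha>'"

lemma comp_cell_betweenD:
  assumes "comp_cell_between X Y M N \<alpha> \<alpha>'"
  shows "rooted_pseudo_map X Y M" "rooted_pseudo_map X Y N" "rooted_comp_trans X Y M N \<alpha> \<alpha>'"
    "nat_trans (Base X) (Base Y) (mbase M) (mbase N) \<alpha>"
    "nat_trans (Tot X) (Tot Y) (mtotal M) (mtotal N) \<alpha>'"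
  using assms
  by (auto simp: comp_cell_between_def rooted_comp_trans_def comp_trans_def)

lemma rooted_comp_transI:
  assumes "nat_trans (Base X) (Base Y) (mbase M) (mbase N) \<alpha>"
    and "nat_trans (Tot X) (Tot Y) (mtotal M) (mtotal N) \<alpha>'"
    and "\<And>A. A \<in> Ob (Tot X) \<Longrightarrow> far (Proj Y) (\<alpha>' A) = \<alpha> (fob (Proj X) A)"
    and "\<And>A. A \<in> Ob (Tot X) \<Longrightarrow>
      Cmp (Base Y) (sq_top (mcomp N A)) (sq_top (far (Chi Y) (\<alpha>' A))) =
      Cmp (Base Y) (\<alpha> (ctx_ext X A)) (sq_top (mcomp M A))"
    and "Cmp (Base Y) (\<alpha> (Root X)) (mroot M) = mroot N"
  shows "rooted_comp_trans X Y M N \<alpha> \<alpha>'"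
  using assms by (simp add: rooted_comp_trans_def comp_trans_def rooted_comp_trans_axioms_def)

lemma rooted_pseudo_map':
  "rooted_comp_cat X \<Longrightarrow> rooted_comp_cat Y \<Longrightarrow> rooted_pseudo_map X Y M \<Longrightarrow> pseudo_map' X Y M"
  by (simp add: pseudo_map'_def rooted_comp_cat_def rooted_pseudo_map_def)

lemma mroot_simps:
  assumes "rooted_pseudo_map X Y M"
  shows "mroot M \<in> Ar (Base Y)" "Dom (Base Y) (mroot M) = Root Y"
    "Cod (Base Y) (mroot M) = fob (mbase M) (Root X)"
  using rooted_pseudo_map.mroot_hom[OF assms] by simp_all

lemma Root_Ob: "rooted_comp_cat X \<Longrightarrow> Root X \<in> Ob (Base X)"
  by (simp add: rooted_comp_cat_def rooted_comp_cat_axioms_def terminal_def)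

lemma comp_cell_between_id:
  assumes X: "rooted_comp_cat X" and Y: "rooted_comp_cat Y" and M: "rooted_pseudo_map X Y M"
  shows "comp_cell_between X Y M M (nt_id (Base X) (Base Y) (mbase M)) (nt_id (Tot X) (Tot Y) (mtotal M))"
proof -
  interpret pseudo_map' X Y M by (rule rooted_pseudo_map'[OF X Y M])
  show ?thesis
    unfolding comp_cell_between_def
    by (intro conjI rooted_comp_transI M nat_trans_nt_id mbase_functor mtotal_functor)
      (use M X in \<open>auto simp: mroot_simps Root_Ob\<close>)
qed

lemma comp_cell_between_vcomp:
  assumes X: "rooted_comp_cat X" and Y: "rooted_comp_cat Y"
    and \<alpha>: "comp_cell_between X Y L M \<alpha> \<alpha>'" and \<beta>: "comp_cell_between X Y M N \<beta> \<beta>'"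
  shows "comp_cell_between X Y L N (nt_vcomp (Base X) (Base Y) \<beta> \<alpha>) (nt_vcomp (Tot X) (Tot Y) \<beta>' \<alpha>')"
proof -
  note \<alpha> = comp_cell_betweenD[OF \<alpha>] and \<beta> = comp_cell_betweenD[OF \<beta>]
  interpret L: pseudo_map' X Y L by (rule rooted_pseudo_map'[OF X Y \<alpha>(1)])
  interpret M: pseudo_map' X Y M by (rule rooted_pseudo_map'[OF X Y \<alpha>(2)])
  interpret N: pseudo_map' X Y N by (rule rooted_pseudo_map'[OF X Y \<beta>(2)])
  interpret \<alpha>: nat_trans "Base X" "Base Y" "mbase L" "mbase M" \<alpha> by (rule \<alpha>(4))
  interpret \<alpha>': nat_trans "Tot X" "Tot Y" "mtotal L" "mtotal M" \<alpha>' by (rule \<alpha>(5))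
  interpret \<beta>: nat_trans "Base X" "Base Y" "mbase M" "mbase N" \<beta> by (rule \<beta>(4))
  interpret \<beta>': nat_trans "Tot X" "Tot Y" "mtotal M" "mtotal N" \<beta>' by (rule \<beta>(5))
  interpret c\<alpha>: rooted_comp_trans X Y L M \<alpha> \<alpha>' by (rule \<alpha>(3))
  interpret c\<beta>: rooted_comp_trans X Y M N \<beta> \<beta>' by (rule \<beta>(3))
  show ?thesis
    unfolding comp_cell_between_def
  proof (intro conjI rooted_comp_transI nat_trans_nt_vcomp[OF \<alpha>(4) \<beta>(4)] nat_trans_nt_vcomp[OF \<alpha>(5) \<beta>(5)])
    fix A assume A: "A \<in> Ob (Tot X)"
    show "far (Proj Y) (nt_vcomp (Tot X) (Tot Y) \<beta>' \<alpha>' A) =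
        nt_vcomp (Base X) (Base Y) \<beta> \<alpha> (fob (Proj X) A)"
      using A by (simp add: c\<alpha>.total_over c\<beta>.total_over)
    have "Cmp (Base Y) (sq_top (mcomp N A)) (Cmp (Base Y) (sq_top (far (Chi Y) (\<beta>' A))) (sq_top (far (Chi Y) (\<alpha>' A)))) =
      Cmp (Base Y) (Cmp (Base Y) (sq_top (mcomp N A)) (sq_top (far (Chi Y) (\<beta>' A)))) (sq_top (far (Chi Y) (\<alpha>' A)))"
      using A by simp
    also have "\<dots> = Cmp (Base Y) (\<beta> (ctx_ext X A)) (Cmp (Base Y) (sq_top (mcomp M A)) (sq_top (far (Chi Y) (\<alpha>' A))))"
      using A by (subst c\<beta>.comp_compat) auto
    also have "\<dots> = Cmp (Base Y) (\<beta> (ctx_ext X A)) (Cmp (Base Y) (\<alpha> (ctx_ext X A)) (sq_top (mcomp L A)))"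
      using A by (simp add: c\<alpha>.comp_compat)
    finally show "Cmp (Base Y) (sq_top (mcomp N A)) (sq_top (far (Chi Y) (nt_vcomp (Tot X) (Tot Y) \<beta>' \<alpha>' A))) =
      Cmp (Base Y) (nt_vcomp (Base X) (Base Y) \<beta> \<alpha> (ctx_ext X A)) (sq_top (mcomp L A))"
      using A by simp
  next
    show "Cmp (Base Y) (nt_vcomp (Base X) (Base Y) \<beta> \<alpha> (Root X)) (mroot L) = mroot N"
      using X by (simp add: Root_Ob mroot_simps[OF \<alpha>(1)] c\<alpha>.root_compat c\<beta>.root_compat)
  qed (fact \<alpha>(1) \<beta>(2))+
qed

lemma comp_cell_between_hcomp:
  assumes X: "rooted_comp_cat X" and Y: "rooted_comp_cat Y" and Z: "rooted_comp_cat Z"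
    and \<alpha>: "comp_cell_between X Y M M' \<alpha> \<alpha>'" and \<beta>: "comp_cell_between Y Z N N' \<beta> \<beta>'"
  shows "comp_cell_between X Z (map_comp X Y Z N M) (map_comp X Y Z N' M')
    (nt_hcomp (Base X) (Base Z) (mbase N) (mbase M') \<beta> \<alpha>)
    (nt_hcomp (Tot X) (Tot Z) (mtotal N) (mtotal M') \<beta>' \<alpha>')"
proof -
  note \<alpha> = comp_cell_betweenD[OF \<alpha>] and \<beta> = comp_cell_betweenD[OF \<beta>]
  interpret M: pseudo_map' X Y M by (rule rooted_pseudo_map'[OF X Y \<alpha>(1)])
  interpret M': pseudo_map' X Y M' by (rule rooted_pseudo_map'[OF X Y \<alpha>(2)])
  interpret N: pseudo_map' Y Z N by (rule rooted_pseudo_map'[OF Y Z \<beta>(1)])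
  interpret N': pseudo_map' Y Z N' by (rule rooted_pseudo_map'[OF Y Z \<beta>(2)])
  interpret \<alpha>: nat_trans "Base X" "Base Y" "mbase M" "mbase M'" \<alpha> by (rule \<alpha>(4))
  interpret \<alpha>': nat_trans "Tot X" "Tot Y" "mtotal M" "mtotal M'" \<alpha>' by (rule \<alpha>(5))
  interpret \<beta>: nat_trans "Base Y" "Base Z" "mbase N" "mbase N'" \<beta> by (rule \<beta>(4))
  interpret \<beta>': nat_trans "Tot Y" "Tot Z" "mtotal N" "mtotal N'" \<beta>' by (rule \<beta>(5))
  interpret c\<alpha>: rooted_comp_trans X Y M M' \<alpha> \<alpha>' by (rule \<alpha>(3))
  interpret c\<beta>: rooted_comp_trans Y Z N N' \<beta> \<beta>' by (rule \<beta>(3))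
  note MN = mcomp_map_comp[OF M.pseudo_map'_axioms N.pseudo_map'_axioms]
    and MN' = mcomp_map_comp[OF M'.pseudo_map'_axioms N'.pseudo_map'_axioms]
  show ?thesis
    unfolding comp_cell_between_def
  proof (intro conjI rooted_comp_transI, unfold map_comp_sel(1,2))
    fix A assume A: "A \<in> Ob (Tot X)"
    show "far (Proj Z) (nt_hcomp (Tot X) (Tot Z) (mtotal N) (mtotal M') \<beta>' \<alpha>' A) =
        nt_hcomp (Base X) (Base Z) (mbase N) (mbase M') \<beta> \<alpha> (fob (Proj X) A)"
      using A by (simp add: c\<alpha>.total_over c\<beta>.total_over)
    let ?B = "fob (mtotal M') A" and ?E = "ctx_ext X A"
    \<comment> \<open>\<open>comp_compat\<close> for the second 2-cell at \<open>?B\<close>, with a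
      further arrow on the right.\<close>
    have *: "Cmp (Base Z) (sq_top (mcomp N' ?B)) (Cmp (Base Z) (sq_top (far (Chi Z) (\<beta>' ?B))) h) =
      Cmp (Base Z) (\<beta> (ctx_ext Y ?B)) (Cmp (Base Z) (sq_top (mcomp N ?B)) h)"
      if "h \<in> Ar (Base Z)" "Cod (Base Z) h = ctx_ext Z (fob (mtotal N) ?B)" for h
    proof -
      have "Cmp (Base Z) (sq_top (mcomp N' ?B)) (Cmp (Base Z) (sq_top (far (Chi Z) (\<beta>' ?B))) h) =
        Cmp (Base Z) (Cmp (Base Z) (sq_top (mcomp N' ?B)) (sq_top (far (Chi Z) (\<beta>' ?B)))) h"
        using A that by simp
      also have "\<dots> = Cmp (Base Z) (\<beta> (ctx_ext Y ?B)) (Cmp (Base Z) (sq_top (mcomp N ?B)) h)"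
        using A that by (subst c\<beta>.comp_compat) auto
      finally show ?thesis .
    qed
    \<comment> \<open>The chain uses, in turn: compatibility of the second 2-cell at
      \<open>?B\<close>; naturality of \<open>mcomp N\<close> at \<open>\<alpha>' A\<close>;
      naturality of \<beta> at the top edge of \<open>mcomp M' A\<close>; and the image under
      \<open>mbase N\<close> of the compatibility of the first 2-cell.\<close>
    have "Cmp (Base Z) (far (mbase N') (sq_top (mcomp M' A))) (Cmp (Base Z) (sq_top (mcomp N' ?B))
        (Cmp (Base Z) (sq_top (far (Chi Z) (\<beta>' ?B))) (sq_top (far (Chi Z) (far (mtotal N) (\<alpha>' A)))))) =
      Cmp (Base Z) (far (mbase N') (sq_top (mcomp M' A))) (Cmp (Base Z) (\<beta> (ctx_ext Y ?B))
        (Cmp (Base Z) (sq_top (mcomp N ?B)) (sq_top (far (Chi Z) (far (mtotal N) (\<alpha>' A))))))"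
      using A by (simp add: *)
    also have "\<dots> = Cmp (Base Z) (far (mbase N') (sq_top (mcomp M' A))) (Cmp (Base Z) (\<beta> (ctx_ext Y ?B))
        (Cmp (Base Z) (far (mbase N) (sq_top (far (Chi Y) (\<alpha>' A)))) (sq_top (mcomp N (fob (mtotal M) A)))))"
      using A N.mcomp_natural_top[of "\<alpha>' A"] by simp
    also have "\<dots> = Cmp (Base Z) (\<beta> (fob (mbase M') ?E)) (Cmp (Base Z) (far (mbase N) (sq_top (mcomp M' A)))
        (Cmp (Base Z) (far (mbase N) (sq_top (far (Chi Y) (\<alpha>' A)))) (sq_top (mcomp N (fob (mtotal M) A)))))"
      using A by (subst \<beta>.natural_Cmp[of "sq_top (mcomp M' A)" "ctx_ext Y ?B" "fob (mbase M') ?E"]) auto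
    also have "\<dots> = Cmp (Base Z) (\<beta> (fob (mbase M') ?E)) (Cmp (Base Z) (far (mbase N)
        (Cmp (Base Y) (sq_top (mcomp M' A)) (sq_top (far (Chi Y) (\<alpha>' A))))) (sq_top (mcomp N (fob (mtotal M) A))))"
      using A by simp
    also have "\<dots> = Cmp (Base Z) (\<beta> (fob (mbase M') ?E)) (Cmp (Base Z) (far (mbase N) (\<alpha> ?E))
        (Cmp (Base Z) (far (mbase N) (sq_top (mcomp M A))) (sq_top (mcomp N (fob (mtotal M) A)))))"
      using A by (subst c\<alpha>.comp_compat) auto
    finally show "Cmp (Base Z) (sq_top (mcomp (map_comp X Y Z N' M') A))
         (sq_top (far (Chi Z) (nt_hcomp (Tot X) (Tot Z) (mtotal N) (mtotal M') \<beta>' \<alpha>' A))) =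
        Cmp (Base Z) (nt_hcomp (Base X) (Base Z) (mbase N) (mbase M') \<beta> \<alpha> (ctx_ext X A))
         (sq_top (mcomp (map_comp X Y Z N M) A))"
      using A by (simp add: MN MN' del: map_comp_sel)
  next
    note [simp] = Root_Ob[OF X] Root_Ob[OF Y] mroot_simps[OF \<alpha>(1)] mroot_simps[OF \<beta>(1)]
       mroot_simps[OF \<alpha>(2)] mroot_simps[OF \<beta>(2)]
    \<comment> \<open>The same pattern at the root: the root condition of the first 2-cell under
      \<open>mbase N\<close>, then naturality of \<beta> at \<open>mroot M'\<close>, then the root
      condition of the second 2-cell.\<close>
    have "Cmp (Base Z) (\<beta> (fob (mbase M') (Root X))) (Cmp (Base Z) (far (mbase N) (\<alpha> (Root X)))
        (Cmp (Base Z) (far (mbase N) (mroot M)) (mroot N))) =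
      Cmp (Base Z) (\<beta> (fob (mbase M') (Root X))) (Cmp (Base Z) (far (mbase N) (Cmp (Base Y) (\<alpha> (Root X)) (mroot M))) (mroot N))"
      by simp
    also have "\<dots> = Cmp (Base Z) (far (mbase N') (mroot M')) (mroot N')"
      unfolding c\<alpha>.root_compat
      by (subst \<beta>.natural_Cmp[of "mroot M'" "Root Y"]) (auto simp: c\<beta>.root_compat)
    finally show "Cmp (Base Z) (nt_hcomp (Base X) (Base Z) (mbase N) (mbase M') \<beta> \<alpha> (Root X))
        (mroot (map_comp X Y Z N M)) = mroot (map_comp X Y Z N' M')"
      by simp
  qed (intro rooted_pseudo_map_map_comp nat_trans_nt_hcomp[OF \<alpha>(4) \<beta>(4)]
      nat_trans_nt_hcomp[OF \<alpha>(5) \<beta>(5)] X Y Z \<alpha> \<beta>)+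
qed

section \<open>The 2-category of rooted comprehension categories\<close>

lemma category_comp_hom:
  assumes X: "rooted_comp_cat X" and Y: "rooted_comp_cat Y"
  shows "category (comp_hom X Y)"
proof -
  note D = comp_cell_betweenD
  show ?thesis
    unfolding comp_hom_def comp_cell_between_def[symmetric]
    by (rule category_mk_cat)
      (auto simp: comp_cell_between_id[OF X Y] nt_vcomp_assoc[OF D(4) D(4) D(4)]
        nt_vcomp_assoc[OF D(5) D(5) D(5)] nt_vcomp_id[OF D(4)] nt_vcomp_id[OF D(5)]
        dest: D(1,2) comp_cell_between_vcomp[OF X Y])
qed

lemma comp_hom_simps [simp]:
  "Ob (comp_hom X Y) = {M. rooted_pseudo_map X Y M}"
  "Ar (comp_hom X Y) = {Cell M N (\<alpha>, \<alpha>') |M N \<alpha> \<alpha>'. comp_cell_between X Y M N \<alpha> \<alpha>'}"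
  "comp_cell_between X Y M N \<alpha> \<alpha>' \<Longrightarrow> Dom (comp_hom X Y) (Cell M N (\<alpha>, \<alpha>')) = M"
  "comp_cell_between X Y M N \<alpha> \<alpha>' \<Longrightarrow> Cod (comp_hom X Y) (Cell M N (\<alpha>, \<alpha>')) = N"
  "rooted_pseudo_map X Y M \<Longrightarrow> Idn (comp_hom X Y) M =
    Cell M M (nt_id (Base X) (Base Y) (mbase M), nt_id (Tot X) (Tot Y) (mtotal M))"
  "comp_cell_between X Y L M \<alpha> \<alpha>' \<Longrightarrow> comp_cell_between X Y M N \<beta> \<beta>' \<Longrightarrow>
    Cmp (comp_hom X Y) (Cell M N (\<beta>, \<beta>')) (Cell L M (\<alpha>, \<alpha>')) =
      Cell L N (nt_vcomp (Base X) (Base Y) \<beta> \<alpha>, nt_vcomp (Tot X) (Tot Y) \<beta>' \<alpha>')"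
  by (auto simp: comp_hom_def comp_cell_between_def[symmetric])

lemma CompCat_rtd_simps [simp]:
  "X \<in> TOb CompCat_rtd \<longleftrightarrow> rooted_comp_cat X"
  "THom CompCat_rtd X Y = comp_hom X Y"
  "TId CompCat_rtd X = id_map X"
  by (simp_all add: CompCat_rtd_def)

lemma CompCat_rtd_TComp [simp]:
  "rooted_pseudo_map X Y M \<Longrightarrow> rooted_pseudo_map Y Z N \<Longrightarrow>
    TComp1 CompCat_rtd X Y Z N M = map_comp X Y Z N M"
  "comp_cell_between X Y M M' \<alpha> \<alpha>' \<Longrightarrow> comp_cell_between Y Z N N' \<beta> \<beta>' \<Longrightarrow>
    TComp2 CompCat_rtd X Y Z (Cell N N' (\<beta>, \<beta>')) (Cell M M' (\<alpha>, \<alpha>')) =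
      Cell (map_comp X Y Z N M) (map_comp X Y Z N' M')
        (nt_hcomp (Base X) (Base Z) (mbase N) (mbase M') \<beta> \<alpha>,
         nt_hcomp (Tot X) (Tot Z) (mtotal N) (mtotal M') \<beta>' \<alpha>')"
  by (simp_all add: CompCat_rtd_def)

lemma two_category_CompCat_rtd: "two_category CompCat_rtd"
proof -
  note D = comp_cell_betweenD
  note F = pseudo_map.mbase_functor[OF rooted_pseudo_map.axioms(1)]
    and T = pseudo_map.mtotal_functor[OF rooted_pseudo_map.axioms(1)]
  show ?thesis
    apply (rule two_categoryI[where u = "\<lambda>X Y Z. \<lambda>(N, M). map_comp X Y Z N M"
        and v = "\<lambda>X Y Z. \<lambda>(t, s). Cell (map_comp X Y Z (src t) (src s)) (map_comp X Y Z (tgt t) (tgt s))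
          (nt_hcomp (Base X) (Base Z) (mbase (src t)) (mbase (tgt s))
             (fst (comps t)) (fst (comps s)),
           nt_hcomp (Tot X) (Tot Z) (mtotal (src t)) (mtotal (tgt s))
             (snd (comps t)) (snd (comps s)))"])
    subgoal by (simp add: category_comp_hom)
    subgoal by (simp add: rooted_pseudo_map_id_map)
    subgoal by (simp add: CompCat_rtd_def)
    subgoal by (simp add: rooted_pseudo_map_map_comp)
    subgoal by (auto simp: comp_cell_between_hcomp)
    subgoal by (auto simp: nt_hcomp_nt_id[OF F F] nt_hcomp_nt_id[OF T T] rooted_pseudo_map_map_comp)
    subgoal by (auto simp: nt_hcomp_nt_vcomp[OF D(4) D(4) D(4) D(4)] nt_hcomp_nt_vcomp[OF D(5) D(5) D(5) D(5)]
       comp_cell_between_hcomp dest: comp_cell_between_vcomp)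
    subgoal by (auto simp: map_comp_assoc)
    subgoal by (auto simp: map_comp_assoc[OF _ _ _ _ D(1) D(1) D(1)] map_comp_assoc[OF _ _ _ _ D(2) D(2) D(2)]
      nt_hcomp_assoc[OF D(4) D(4) D(4)] nt_hcomp_assoc[OF D(5) D(5) D(5)])
    subgoal by (simp add: map_comp_id)
    subgoal for X Y s
      by (auto simp: map_comp_id nt_hcomp_unit[OF D(4)] nt_hcomp_unit[OF D(5)] rooted_pseudo_map_id_map dest: D(1,2))
    done
qed

section \<open>Finite limits from pullbacks and a terminal object\<close>

subsection \<open>Products and equalizers\<close>

definition is_product :: "('o, 'a) cat \<Rightarrow> 'o \<Rightarrow> 'a \<Rightarrow> 'a \<Rightarrow> 'o \<Rightarrow> 'o \<Rightarrow> bool" where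
  "is_product C p a b x y \<longleftrightarrow> a \<in> homset C p x \<and> b \<in> homset C p y \<and>
     (\<forall>q a' b'. a' \<in> homset C q x \<and> b' \<in> homset C q y \<longrightarrow>
        (\<exists>!h. h \<in> homset C q p \<and> Cmp C a h = a' \<and> Cmp C b h = b'))"

definition is_equalizer :: "('o, 'a) cat \<Rightarrow> 'a \<Rightarrow> 'a \<Rightarrow> 'a \<Rightarrow> bool" where
  "is_equalizer C e a b \<longleftrightarrow> e \<in> Ar C \<and> Cod C e = Dom C a \<and> Cmp C a e = Cmp C b e \<and>
     (\<forall>h \<in> Ar C. Cod C h = Dom C a \<and> Cmp C a h = Cmp C b h \<longrightarrow>
        (\<exists>!k. k \<in> homset C (Dom C h) (Dom C e) \<and> Cmp C e k = h))"

lemma pullback_square_ArD: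
  assumes "pullback_square C (Square f u v g)"
  shows "Square f u v g \<in> Ar (arrow_cat C)" "f \<in> Ar C" "g \<in> Ar C" "u \<in> Ar C" "v \<in> Ar C"
    "Dom C u = Dom C f" "Cod C u = Dom C g" "Dom C v = Cod C f" "Cod C v = Cod C g"
    "Cmp C g u = Cmp C v f"
  using assms by (auto simp: pullback_square_def arrow_cat_Ar)

lemma pullback_square_ex1:
  assumes "pullback_square C (Square f u v g)"
    and "a \<in> homset C x (Dom C g)" "b \<in> homset C x (Cod C f)" "Cmp C g a = Cmp C v b"
  shows "\<exists>!h. h \<in> homset C x (Dom C f) \<and> Cmp C u h = a \<and> Cmp C f h = b"
  using assms(1)[unfolded pullback_square_def square.sel] assms(2-) by blast

lemma is_productI:
  assumes "a \<in> homset C p x" "b \<in> homset C p y"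
    and "\<And>q a' b'. a' \<in> homset C q x \<Longrightarrow> b' \<in> homset C q y \<Longrightarrow>
        \<exists>!h. h \<in> homset C q p \<and> Cmp C a h = a' \<and> Cmp C b h = b'"
  shows "is_product C p a b x y"
  unfolding is_product_def using assms by blast

lemma is_product_ex1:
  assumes "is_product C p a b x y" "a' \<in> homset C q x" "b' \<in> homset C q y"
  shows "\<exists>!h. h \<in> homset C q p \<and> Cmp C a h = a' \<and> Cmp C b h = b'"
  using assms unfolding is_product_def by blast

lemma is_equalizerI:
  assumes "e \<in> Ar C" "Cod C e = Dom C a" "Cmp C a e = Cmp C b e"
    and "\<And>h. h \<in> Ar C \<Longrightarrow> Cod C h = Dom C a \<Longrightarrow> Cmp C a h = Cmp C b h \<Longrightarrow>
        \<exists>!k. k \<in> homset C (Dom C h) (Dom C e) \<and> Cmp C e k = h"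
  shows "is_equalizer C e a b"
  unfolding is_equalizer_def using assms by blast

lemma is_equalizerD:
  assumes "is_equalizer C e a b"
  shows "e \<in> Ar C" "Cod C e = Dom C a" "Cmp C a e = Cmp C b e"
  using assms unfolding is_equalizer_def by blast+

lemma is_equalizer_ex1:
  assumes "is_equalizer C e a b" "h \<in> Ar C" "Cod C h = Dom C a" "Cmp C a h = Cmp C b h"
  shows "\<exists>!k. k \<in> homset C (Dom C h) (Dom C e) \<and> Cmp C e k = h"
  using assms unfolding is_equalizer_def by blast

lemma terminal_arrow_unique:
  "terminal C t \<Longrightarrow> f \<in> homset C x t \<Longrightarrow> g \<in> homset C x t \<Longrightarrow> x \<in> Ob C \<Longrightarrow> f = g"
  by (auto simp: terminal_def)

text \<open>Over a terminal object any two arrows out of \<open>q\<close> form a commutative square,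
  so the compatibility condition in the pullback property is vacuous.\<close>

lemma (in category) is_product_of_pullback:
  assumes t: "terminal C (Cod C g)" and pb: "pullback_square C (Square f u v g)"
  shows "is_product C (Dom C f) f u (Dom C v) (Dom C g)"
proof -
  note p = pullback_square_ArD[OF pb]
  have *: "\<exists>!h. h \<in> homset C q (Dom C f) \<and> Cmp C f h = a' \<and> Cmp C u h = b'"
    if "a' \<in> homset C q (Dom C v)" "b' \<in> homset C q (Dom C g)" for q a' b'
  proof -
    have "q \<in> Ob C" using that(1) by auto
    then have "Cmp C g b' = Cmp C v a'"
      by (intro terminal_arrow_unique[OF t, where x = q]) (use p that in auto)
    then show ?thesis
      using pullback_square_ex1[OF pb, of b' q a'] that p by (simp add: conj_commute)
  qed
  show ?thesis using p by (intro is_productI *) simp_all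
qed

text \<open>The equalizer of \<open>a, b : x \<rightarrow> y\<close> is the pullback of \<open>(1, a)\<close> and \<open>(1, b) : x \<rightarrow> x \<times> y\<close>.\<close>

lemma (in category) is_equalizer_of_pullback:
  assumes prod: "is_product C p q1 q2 x y"
    and ab: "a \<in> homset C x y" "b \<in> homset C x y" and ij: "i \<in> homset C x p" "j \<in> homset C x p"
    and i: "Cmp C q1 i = Idn C x" "Cmp C q2 i = a" and j: "Cmp C q1 j = Idn C x" "Cmp C q2 j = b"
    and pb: "pullback_square C (Square f u j i)"
  shows "is_equalizer C f a b"
proof -
  note p = pullback_square_ArD[OF pb]
  have q: "q1 \<in> homset C p x" "q2 \<in> homset C p y" using prod by (auto simp: is_product_def)
  have red: "Cmp C q1 (Cmp C i h) = h" "Cmp C q2 (Cmp C i h) = Cmp C a h"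
    "Cmp C q1 (Cmp C j h) = h" "Cmp C q2 (Cmp C j h) = Cmp C b h"
    if "h \<in> Ar C" "Cod C h = x" for h
  proof -
    have "Cmp C q1 (Cmp C i h) = Cmp C (Cmp C q1 i) h" "Cmp C q2 (Cmp C i h) = Cmp C (Cmp C q2 i) h"
      "Cmp C q1 (Cmp C j h) = Cmp C (Cmp C q1 j) h" "Cmp C q2 (Cmp C j h) = Cmp C (Cmp C q2 j) h"
      using that q ij by (simp_all del: i j)
    then show "Cmp C q1 (Cmp C i h) = h" "Cmp C q2 (Cmp C i h) = Cmp C a h"
      "Cmp C q1 (Cmp C j h) = h" "Cmp C q2 (Cmp C j h) = Cmp C b h"
      using that i j by simp_all
  qed
  have cod: "Cod C f = x" "Cod C u = x" using p ij by auto
  \<comment> \<open>Composing the pullback equation with \<open>q1\<close> identifies the two legs;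
    composing it with \<open>q2\<close> then gives \<open>Cmp C a f = Cmp C b f\<close>.\<close>
  have uf: "u = f"
    using red(1)[of u] red(3)[of f] p cod by simp
  have eq: "Cmp C a f = Cmp C b f"
    using red(2)[of u] red(4)[of f] p cod uf by simp
  have *: "\<exists>!k. k \<in> homset C (Dom C h) (Dom C f) \<and> Cmp C f k = h"
    if h: "h \<in> Ar C" "Cod C h = x" "Cmp C a h = Cmp C b h" for h
  proof -
    \<comment> \<open>If \<open>h\<close> equalizes \<open>a\<close> and \<open>b\<close>, then
      \<open>Cmp C i h\<close> and \<open>Cmp C j h\<close> have the same two projections, hence
      agree, and \<open>h\<close> serves as both legs of a cone over the pullback.\<close>
    have "\<exists>!k. k \<in> homset C (Dom C h) p \<and> Cmp C q1 k = h \<and> Cmp C q2 k = Cmp C a h"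
      using h ab by (intro is_product_ex1[OF prod]) auto
    moreover have "Cmp C i h \<in> homset C (Dom C h) p \<and> Cmp C q1 (Cmp C i h) = h \<and>
        Cmp C q2 (Cmp C i h) = Cmp C a h"
      "Cmp C j h \<in> homset C (Dom C h) p \<and> Cmp C q1 (Cmp C j h) = h \<and>
        Cmp C q2 (Cmp C j h) = Cmp C a h"
      using h ij red by auto
    ultimately have "Cmp C i h = Cmp C j h" by blast
    then show ?thesis
      using pullback_square_ex1[OF pb, of h "Dom C h" h] h cod ij uf by simp
  qed
  show ?thesis using p cod eq ab by (intro is_equalizerI *) simp_all
qed

subsection \<open>Limits of parts of a diagram\<close>

text \<open>The stages of the induction on the diagram: \<open>S\<close> and \<open>U\<close> are
  mere sets of objects and arrows and need not form a subcategory. All objects are inserted while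
  \<open>U\<close> is empty, and arrows only once \<open>S\<close> is \<open>Ob J\<close>.\<close>

definition partial_cone :: "('j, 'k) cat \<Rightarrow> ('o, 'a) cat \<Rightarrow> ('j, 'k, 'o, 'a) functr \<Rightarrow> 'j set \<Rightarrow> 'k set \<Rightarrow>
    'o \<Rightarrow> ('j \<Rightarrow> 'a) \<Rightarrow> bool" where
  "partial_cone J C D S U x l \<longleftrightarrow> x \<in> Ob C \<and> (\<forall>j \<in> S. l j \<in> homset C x (fob D j)) \<and>
     (\<forall>u \<in> U. Cmp C (far D u) (l (Dom J u)) = l (Cod J u))"

definition partial_limit :: "('j, 'k) cat \<Rightarrow> ('o, 'a) cat \<Rightarrow> ('j, 'k, 'o, 'a) functr \<Rightarrow> 'j set \<Rightarrow> 'k set \<Rightarrow>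
    'o \<Rightarrow> ('j \<Rightarrow> 'a) \<Rightarrow> bool" where
  "partial_limit J C D S U x l \<longleftrightarrow> partial_cone J C D S U x l \<and>
     (\<forall>y m. partial_cone J C D S U y m \<longrightarrow>
        (\<exists>!h. h \<in> homset C y x \<and> (\<forall>j \<in> S. Cmp C (l j) h = m j)))"

lemma limit_cone_partial: "limit_cone J C D x l \<longleftrightarrow> partial_limit J C D (Ob J) (Ar J) x l"
  by (simp add: limit_cone_def partial_limit_def cone_def partial_cone_def)

text \<open>Only the legs at \<open>S\<close> matter. This is what allows \<open>F\<close> to be
  moved across the composites defining the new legs, since functoriality is available only for legs
  that are arrows.\<close>

lemma partial_limit_cong:
  assumes "partial_limit J C D S U x l" "\<And>j. j \<in> S \<Longrightarrow> l j = l' j"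
    and "\<And>u. u \<in> U \<Longrightarrow> Dom J u \<in> S \<and> Cod J u \<in> S"
  shows "partial_limit J C D S U x l'"
proof -
  have "partial_cone J C D S U x l = partial_cone J C D S U x l'"
    using assms(2,3) by (auto simp: partial_cone_def)
  moreover have "(\<forall>j \<in> S. Cmp C (l j) h = m j) = (\<forall>j \<in> S. Cmp C (l' j) h = m j)" for h m
    using assms(2) by auto
  ultimately show ?thesis using assms(1) by (simp add: partial_limit_def)
qed

lemma partial_limit_terminal: "terminal C t \<Longrightarrow> partial_limit J C D {} {} t l"
  by (simp add: partial_limit_def partial_cone_def terminal_def)

text \<open>Transfers unique existence between two conditions that are known to agree only on arrows
  of the right type \<open>P\<close>.\<close>

lemma ex1_conj_cong:
  "(\<And>h. P h \<Longrightarrow> Q h \<longleftrightarrow> R h) \<Longrightarrow> \<exists>!h. P h \<and> R h \<Longrightarrow> \<exists>!h. P h \<and> Q h"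
  by blast

text \<open>With no arrows to respect, a cone over \<open>insert j S\<close> is a cone over
  \<open>S\<close>, that is an arrow into \<open>x\<close>, together with an arbitrary arrow into
  \<open>fob D j\<close>: an arrow into the product.\<close>

lemma (in category) partial_limit_insert_Ob:
  assumes lim: "partial_limit J C D S {} x l" and j: "j \<notin> S"
    and prod: "is_product C p a b x (fob D j)"
  shows "partial_limit J C D (insert j S) {} p (\<lambda>i. if i = j then b else Cmp C (l i) a)"
proof -
  have ab: "a \<in> homset C p x" "b \<in> homset C p (fob D j)"
    using prod by (auto simp: is_product_def)
  have l: "l i \<in> homset C x (fob D i)" if "i \<in> S" for i
    using lim that by (auto simp: partial_limit_def partial_cone_def)
  let ?l = "\<lambda>i. if i = j then b else Cmp C (l i) a"
  have "\<exists>!h. h \<in> homset C y p \<and> (\<forall>i \<in> insert j S. Cmp C (?l i) h = m i)"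
    if m: "partial_cone J C D (insert j S) {} y m" for y m
  proof -
    from m have "partial_cone J C D S {} y m" by (auto simp: partial_cone_def)
    with lim obtain h where h: "h \<in> homset C y x" "\<And>i. i \<in> S \<Longrightarrow> Cmp C (l i) h = m i"
      and uniq: "\<And>h'. h' \<in> homset C y x \<Longrightarrow> (\<forall>i \<in> S. Cmp C (l i) h' = m i) \<Longrightarrow> h' = h"
      unfolding partial_limit_def by metis
    have "m j \<in> homset C y (fob D j)" using m by (auto simp: partial_cone_def)
    with h have ex: "\<exists>!k. k \<in> homset C y p \<and> Cmp C a k = h \<and> Cmp C b k = m j"
      by (intro is_product_ex1[OF prod])
    have iff: "(\<forall>i \<in> insert j S. Cmp C (?l i) k = m i) \<longleftrightarrow> Cmp C a k = h \<and> Cmp C b k = m j"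
      if k: "k \<in> homset C y p" for k
    proof -
      have "(\<forall>i \<in> insert j S. Cmp C (?l i) k = m i) \<longleftrightarrow>
          Cmp C b k = m j \<and> (\<forall>i \<in> S. Cmp C (Cmp C (l i) a) k = m i)"
        using j by auto
      also have "(\<forall>i \<in> S. Cmp C (Cmp C (l i) a) k = m i) \<longleftrightarrow> (\<forall>i \<in> S. Cmp C (l i) (Cmp C a k) = m i)"
        using l ab k by (intro ball_cong refl) simp
      also have "\<dots> \<longleftrightarrow> Cmp C a k = h"
        using uniq[of "Cmp C a k"] h(2) k ab by auto
      finally show ?thesis by blast
    qed
    show ?thesis by (rule ex1_conj_cong[OF iff ex])
  qed
  moreover have "partial_cone J C D (insert j S) {} p ?l"
    using ab l by (auto simp: partial_cone_def)
  ultimately show ?thesis by (simp add: partial_limit_def)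
qed

text \<open>A cone over the smaller part is an arrow \<open>h\<close> into \<open>x\<close>; it
  respects \<open>u\<close> as well exactly if \<open>h\<close> equalizes the two arrows from
  \<open>x\<close> to \<open>fob D (Cod J u)\<close>, hence if it factors through
  \<open>e\<close>.\<close>

lemma (in category) partial_limit_insert_Ar:
  assumes D: "is_functor J C D" and lim: "partial_limit J C D (Ob J) U x l"
    and U: "U \<subseteq> Ar J" and u: "u \<in> Ar J"
    and eq: "is_equalizer C e (Cmp C (far D u) (l (Dom J u))) (l (Cod J u))"
  shows "partial_limit J C D (Ob J) (insert u U) (Dom C e) (\<lambda>i. Cmp C (l i) e)"
proof -
  interpret D: is_functor J C D by fact
  have l: "l i \<in> homset C x (fob D i)" if "i \<in> Ob J" for i
    using lim that by (auto simp: partial_limit_def partial_cone_def)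
  have lU: "Cmp C (far D v) (l (Dom J v)) = l (Cod J v)" if "v \<in> U" for v
    using lim that by (auto simp: partial_limit_def partial_cone_def)
  have e: "e \<in> Ar C" "Cod C e = x"
    "Cmp C (Cmp C (far D u) (l (Dom J u))) e = Cmp C (l (Cod J u)) e"
    using eq u l by (auto simp: is_equalizer_def)
  let ?l = "\<lambda>i. Cmp C (l i) e"
  have lU': "Cmp C (far D v) (Cmp C (l (Dom J v)) h) = Cmp C (l (Cod J v)) h"
    if "v \<in> U" "h \<in> Ar C" "Cod C h = x" for v h
    using that U l[of "Dom J v"] lU[of v] by (simp add: subset_iff flip: Cmp_assoc')
  have e': "Cmp C (far D u) (Cmp C (l (Dom J u)) e) = Cmp C (l (Cod J u)) e"
    using e l[of "Dom J u"] u by simp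
  have "\<exists>!h. h \<in> homset C y (Dom C e) \<and> (\<forall>i \<in> Ob J. Cmp C (?l i) h = m i)"
    if m: "partial_cone J C D (Ob J) (insert u U) y m" for y m
  proof -
    from m have "partial_cone J C D (Ob J) U y m" by (auto simp: partial_cone_def)
    with lim obtain h where h: "h \<in> homset C y x" "\<And>i. i \<in> Ob J \<Longrightarrow> Cmp C (l i) h = m i"
      and uniq: "\<And>h'. h' \<in> homset C y x \<Longrightarrow> (\<forall>i \<in> Ob J. Cmp C (l i) h' = m i) \<Longrightarrow> h' = h"
      unfolding partial_limit_def by metis
    have "Cmp C (far D u) (m (Dom J u)) = m (Cod J u)" using m by (auto simp: partial_cone_def)
    then have "Cmp C (Cmp C (far D u) (l (Dom J u))) h = Cmp C (l (Cod J u)) h"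
      using h u l[of "Dom J u"] by simp
    then have ex: "\<exists>!k. k \<in> homset C y (Dom C e) \<and> Cmp C e k = h"
      using is_equalizer_ex1[OF eq, of h] h u l[of "Dom J u"] by simp
    have iff: "(\<forall>i \<in> Ob J. Cmp C (?l i) k = m i) \<longleftrightarrow> Cmp C e k = h"
      if k: "k \<in> homset C y (Dom C e)" for k
    proof -
      have "(\<forall>i \<in> Ob J. Cmp C (?l i) k = m i) \<longleftrightarrow> (\<forall>i \<in> Ob J. Cmp C (l i) (Cmp C e k) = m i)"
        using l e k by (intro ball_cong refl) simp
      also have "\<dots> \<longleftrightarrow> Cmp C e k = h"
        using uniq[of "Cmp C e k"] h(2) k e by auto
      finally show ?thesis .
    qed
    show ?thesis by (rule ex1_conj_cong[OF iff ex])
  qed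
  moreover have "partial_cone J C D (Ob J) (insert u U) (Dom C e) ?l"
    using e e' l u U by (auto simp: partial_cone_def lU' subset_iff)
  ultimately show ?thesis by (simp add: partial_limit_def)
qed

text \<open>Together with \<open>limit_cone_unique\<close> this passes from the one limit cone that
  the induction produces to arbitrary ones, as the definition of preservation demands.\<close>

lemma (in category) limit_cone_iso:
  assumes D: "is_functor J C D" and lim: "limit_cone J C D x0 l0"
    and h: "h \<in> homset C x x0" and k: "k \<in> homset C x0 x"
    and hk: "Cmp C h k = Idn C x0" and kh: "Cmp C k h = Idn C x"
    and l: "\<And>j. j \<in> Ob J \<Longrightarrow> l j = Cmp C (l0 j) h"
  shows "limit_cone J C D x l"
proof -
  interpret D: is_functor J C D by fact
  have l0: "l0 j \<in> homset C x0 (fob D j)" if "j \<in> Ob J" for j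
    using lim that by (auto simp: limit_cone_def cone_def)
  have l0': "Cmp C (far D u) (l0 (Dom J u)) = l0 (Cod J u)" if "u \<in> Ar J" for u
    using lim that by (auto simp: limit_cone_def cone_def)
  have "Cmp C (far D u) (Cmp C (l0 (Dom J u)) h) = Cmp C (l0 (Cod J u)) h" if "u \<in> Ar J" for u
    using that h l0[of "Dom J u"] by (simp flip: l0')
  then have "cone J C D x l"
    using l0 l h by (auto simp: cone_def)
  moreover have "\<exists>!n. n \<in> homset C y x \<and> (\<forall>j \<in> Ob J. Cmp C (l j) n = m j)" if "cone J C D y m" for y m
  proof -
    from that lim obtain n where n: "n \<in> homset C y x0" "\<And>j. j \<in> Ob J \<Longrightarrow> Cmp C (l0 j) n = m j"
      and uniq: "\<And>n'. n' \<in> homset C y x0 \<Longrightarrow> (\<forall>j \<in> Ob J. Cmp C (l0 j) n' = m j) \<Longrightarrow> n' = n"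
      unfolding limit_cone_def by metis
    have hk': "Cmp C h (Cmp C k n) = n"
      using h k n hk Cmp_assoc'[of h k n] by simp
    show ?thesis
    proof (rule ex1I[of _ "Cmp C k n"])
      show "Cmp C k n \<in> homset C y x \<and> (\<forall>j \<in> Ob J. Cmp C (l j) (Cmp C k n) = m j)"
        using h k n l0 by (auto simp: l hk')
      fix w assume w: "w \<in> homset C y x \<and> (\<forall>j \<in> Ob J. Cmp C (l j) w = m j)"
      have "Cmp C h w = n"
        by (rule uniq) (use w h l0 l in \<open>auto simp flip: Cmp_assoc'\<close>)
      moreover have "Cmp C k (Cmp C h w) = w"
        using h k w kh Cmp_assoc'[of k h w] by simp
      ultimately show "w = Cmp C k n" by simp
    qed
  qed
  ultimately show ?thesis by (simp add: limit_cone_def)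
qed

lemma (in category) limit_cone_unique:
  assumes "limit_cone J C D x l" "limit_cone J C D x0 l0"
  obtains h k where "h \<in> homset C x x0" "k \<in> homset C x0 x" "Cmp C h k = Idn C x0" "Cmp C k h = Idn C x"
    "\<And>j. j \<in> Ob J \<Longrightarrow> l j = Cmp C (l0 j) h"
proof -
  have l: "\<And>j. j \<in> Ob J \<Longrightarrow> l j \<in> homset C x (fob D j)" "\<And>j. j \<in> Ob J \<Longrightarrow> l0 j \<in> homset C x0 (fob D j)"
    and xx: "x \<in> Ob C" "x0 \<in> Ob C"
    using assms by (auto simp: limit_cone_def cone_def)
  obtain h where h: "h \<in> homset C x x0" "\<And>j. j \<in> Ob J \<Longrightarrow> Cmp C (l0 j) h = l j"
    using assms unfolding limit_cone_def by metis
  obtain k where k: "k \<in> homset C x0 x" "\<And>j. j \<in> Ob J \<Longrightarrow> Cmp C (l j) k = l0 j"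
    using assms unfolding limit_cone_def by metis
  have "\<exists>!n. n \<in> homset C x x \<and> (\<forall>j \<in> Ob J. Cmp C (l j) n = l j)"
    using assms(1) unfolding limit_cone_def by metis
  moreover have "Cmp C k h \<in> homset C x x \<and> (\<forall>j \<in> Ob J. Cmp C (l j) (Cmp C k h) = l j)"
    using h k l by (auto simp flip: Cmp_assoc')
  moreover have "Idn C x \<in> homset C x x \<and> (\<forall>j \<in> Ob J. Cmp C (l j) (Idn C x) = l j)"
    using xx l by auto
  ultimately have 1: "Cmp C k h = Idn C x" by blast
  have "\<exists>!n. n \<in> homset C x0 x0 \<and> (\<forall>j \<in> Ob J. Cmp C (l0 j) n = l0 j)"
    using assms(2) unfolding limit_cone_def by metis
  moreover have "Cmp C h k \<in> homset C x0 x0 \<and> (\<forall>j \<in> Ob J. Cmp C (l0 j) (Cmp C h k) = l0 j)"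
    using h k l by (auto simp flip: Cmp_assoc')
  moreover have "Idn C x0 \<in> homset C x0 x0 \<and> (\<forall>j \<in> Ob J. Cmp C (l0 j) (Idn C x0) = l0 j)"
    using xx l by auto
  ultimately have "Cmp C h k = Idn C x0" by blast
  with 1 h k show thesis using that by metis
qed

section \<open>Functors preserving pullbacks and terminal objects\<close>

definition has_pullbacks :: "('o, 'a) cat \<Rightarrow> bool" where
  "has_pullbacks C \<longleftrightarrow> (\<forall>v g. v \<in> Ar C \<and> g \<in> Ar C \<and> Cod C v = Cod C g \<longrightarrow>
     (\<exists>f u. pullback_square C (Square f u v g)))"

lemma has_pullbacksE:
  assumes "has_pullbacks C" "v \<in> Ar C" "g \<in> Ar C" "Cod C v = Cod C g"
  obtains f u where "pullback_square C (Square f u v g)"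
  using assms unfolding has_pullbacks_def by blast

definition preserves_pullbacks :: "('o, 'a) cat \<Rightarrow> ('p, 'b) cat \<Rightarrow> ('o, 'a, 'p, 'b) functr \<Rightarrow> bool" where
  "preserves_pullbacks C C' F \<longleftrightarrow>
     (\<forall>s. pullback_square C s \<longrightarrow> pullback_square C' (map_square (far F) s))"

definition preserves_terminals :: "('o, 'a) cat \<Rightarrow> ('p, 'b) cat \<Rightarrow> ('o, 'a, 'p, 'b) functr \<Rightarrow> bool" where
  "preserves_terminals C C' F \<longleftrightarrow> (\<forall>t. terminal C t \<longrightarrow> terminal C' (fob F t))"

text \<open>Limits in \<open>C'\<close> arise only as images of limits in \<open>C\<close>. Each
  construction below therefore returns one object of \<open>C\<close> with its universal property in
  \<open>C\<close> and that of its image in \<open>C'\<close>.\<close>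

locale pullback_terminal_functor = is_functor C C' F
  for C :: "('o, 'a) cat" and C' :: "('p, 'b) cat" and F +
  assumes has_pullbacks: "has_pullbacks C"
    and has_terminal: "\<exists>t. terminal C t"
    and preserves_pullbacks: "preserves_pullbacks C C' F"
    and preserves_terminals: "preserves_terminals C C' F"
begin

lemma preserves_pullback:
  "pullback_square C (Square f u v g) \<Longrightarrow> pullback_square C' (Square (far F f) (far F u) (far F v) (far F g))"
  using preserves_pullbacks unfolding preserves_pullbacks_def by fastforce

lemma preserved_product:
  assumes "x \<in> Ob C" "y \<in> Ob C"
  obtains p a b where "is_product C p a b x y"
    "is_product C' (fob F p) (far F a) (far F b) (fob F x) (fob F y)"
proof -
  obtain t where t: "terminal C t" using has_terminal by blast
  then have t': "terminal C' (fob F t)"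
    using preserves_terminals by (simp add: preserves_terminals_def)
  obtain v g where vg: "v \<in> homset C x t" "g \<in> homset C y t"
    using t assms by (metis terminal_def)
  then obtain f u where pb: "pullback_square C (Square f u v g)"
    using vg by (auto elim: has_pullbacksE[OF has_pullbacks, of v g])
  note pb' = preserves_pullback[OF pb] and p = pullback_square_ArD[OF pb]
  show thesis
    using that[of "Dom C f" f u] C.is_product_of_pullback[OF _ pb]
      D.is_product_of_pullback[OF _ pb'] t t' vg p by simp
qed

lemma preserved_equalizer:
  assumes ab: "a \<in> homset C x y" "b \<in> homset C x y"
  obtains e where "is_equalizer C e a b" "is_equalizer C' (far F e) (far F a) (far F b)"
proof -
  have xy: "x \<in> Ob C" "y \<in> Ob C" using ab by auto
  obtain p q1 q2 where prod: "is_product C p q1 q2 x y"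
    and prod': "is_product C' (fob F p) (far F q1) (far F q2) (fob F x) (fob F y)"
    using preserved_product[OF xy] .
  have q: "q1 \<in> homset C p x" "q2 \<in> homset C p y" using prod by (auto simp: is_product_def)
  have ex: "\<exists>i \<in> homset C x p. Cmp C q1 i = Idn C x \<and> Cmp C q2 i = c" if "c \<in> homset C x y" for c
  proof -
    have "Idn C x \<in> homset C x x" using xy by auto
    with prod that have "\<exists>!i. i \<in> homset C x p \<and> Cmp C q1 i = Idn C x \<and> Cmp C q2 i = c"
      unfolding is_product_def by blast
    then show ?thesis by blast
  qed
  obtain i where i: "i \<in> homset C x p" "Cmp C q1 i = Idn C x" "Cmp C q2 i = a"
    using ex[OF ab(1)] by blast
  obtain j where j: "j \<in> homset C x p" "Cmp C q1 j = Idn C x" "Cmp C q2 j = b"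
    using ex[OF ab(2)] by blast
  obtain f u where pb: "pullback_square C (Square f u j i)"
    using i j by (auto elim: has_pullbacksE[OF has_pullbacks, of j i])
  \<comment> \<open>The equations expressing that \<open>i\<close> and \<open>j\<close> are the
    pairings of an identity with \<open>a\<close> and \<open>b\<close> survive under
    \<open>F\<close>. As product and pullback are preserved too, the same criterion applies in
    \<open>C'\<close>.\<close>
  have "Cmp C' (far F q1) (far F i) = Idn C' (fob F x)" "Cmp C' (far F q1) (far F j) = Idn C' (fob F x)"
    "Cmp C' (far F q2) (far F i) = far F a" "Cmp C' (far F q2) (far F j) = far F b"
    using q i j xy by (simp_all flip: far_Cmp')
  then have "is_equalizer C' (far F f) (far F a) (far F b)"
    using ab i j
    by (intro D.is_equalizer_of_pullback[OF prod' _ _ _ _ _ _ _ _ preserves_pullback[OF pb]]) auto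
  moreover have "is_equalizer C f a b"
    using ab i j by (intro C.is_equalizer_of_pullback[OF prod _ _ _ _ _ _ _ _ pb]) auto
  ultimately show thesis using that by blast
qed

lemma preserved_partial_limit_Ob:
  assumes D: "is_functor J C D" and S: "finite S" "S \<subseteq> Ob J"
  shows "\<exists>x l. partial_limit J C D S {} x l \<and>
    partial_limit J C' (comp_functor J F D) S {} (fob F x) (\<lambda>j. far F (l j))"
  using S
proof (induction S)
  case empty
  obtain t where "terminal C t" using has_terminal by blast
  then show ?case
    using preserves_terminals partial_limit_terminal by (metis preserves_terminals_def)
next
  case (insert j S)
  interpret D: is_functor J C D by fact
  obtain x l where l: "partial_limit J C D S {} x l"
    "partial_limit J C' (comp_functor J F D) S {} (fob F x) (\<lambda>j. far F (l j))"
    using insert by auto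
  have x: "x \<in> Ob C" and leg: "\<And>i. i \<in> S \<Longrightarrow> l i \<in> homset C x (fob D i)"
    using l(1) by (auto simp: partial_limit_def partial_cone_def)
  obtain p a b where prod: "is_product C p a b x (fob D j)"
    "is_product C' (fob F p) (far F a) (far F b) (fob F x) (fob F (fob D j))"
    using preserved_product[OF x, of "fob D j"] insert.prems by auto
  have a: "a \<in> homset C p x" using prod(1) by (auto simp: is_product_def)
  have "partial_limit J C' (comp_functor J F D) (insert j S) {} (fob F p)
      (\<lambda>i. if i = j then far F b else Cmp C' (far F (l i)) (far F a))"
    by (rule D.partial_limit_insert_Ob[OF l(2)]) (use prod insert in auto)
  \<comment> \<open>The limit in \<open>C'\<close> was built from the images of \<open>a\<close>,
    \<open>b\<close> and the old legs; here its legs are rewritten as images of the new legs in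
    \<open>C\<close>, which the induction requires.\<close>
  then have "partial_limit J C' (comp_functor J F D) (insert j S) {} (fob F p)
      (\<lambda>i. far F (if i = j then b else Cmp C (l i) a))"
    by (rule partial_limit_cong) (use leg a insert.hyps in auto)
  with C.partial_limit_insert_Ob[OF l(1) insert.hyps(2) prod(1)] show ?case by blast
qed

lemma preserved_partial_limit_Ar:
  assumes D: "is_functor J C D" and J: "finite (Ob J)" and U: "finite U" "U \<subseteq> Ar J"
  shows "\<exists>x l. partial_limit J C D (Ob J) U x l \<and>
    partial_limit J C' (comp_functor J F D) (Ob J) U (fob F x) (\<lambda>j. far F (l j))"
  using U
proof (induction U)
  case empty
  show ?case using preserved_partial_limit_Ob[OF D J] by simp
next
  case (insert u U)
  interpret D: is_functor J C D by fact
  have FD: "is_functor J C' (comp_functor J F D)"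
    by (rule is_functor_comp_functor[OF D is_functor_axioms])
  obtain x l where l: "partial_limit J C D (Ob J) U x l"
    "partial_limit J C' (comp_functor J F D) (Ob J) U (fob F x) (\<lambda>j. far F (l j))"
    using insert by auto
  have leg: "\<And>i. i \<in> Ob J \<Longrightarrow> l i \<in> homset C x (fob D i)"
    using l(1) by (auto simp: partial_limit_def partial_cone_def)
  have u: "u \<in> Ar J" "U \<subseteq> Ar J" using insert.prems by auto
  obtain e where e: "is_equalizer C e (Cmp C (far D u) (l (Dom J u))) (l (Cod J u))"
    "is_equalizer C' (far F e) (far F (Cmp C (far D u) (l (Dom J u)))) (far F (l (Cod J u)))"
  proof (rule preserved_equalizer)
    show "Cmp C (far D u) (l (Dom J u)) \<in> homset C x (fob D (Cod J u))"
      "l (Cod J u) \<in> homset C x (fob D (Cod J u))"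
      using leg u by auto
  qed
  have e': "e \<in> Ar C" "Cod C e = x" using is_equalizerD[OF e(1)] leg[of "Dom J u"] u by auto
  have "partial_limit J C' (comp_functor J F D) (Ob J) (insert u U) (fob F (Dom C e))
      (\<lambda>i. Cmp C' (far F (l i)) (far F e))"
    using D.partial_limit_insert_Ar[OF FD l(2) u(2,1), of "far F e"] e e' leg u by simp
  then have "partial_limit J C' (comp_functor J F D) (Ob J) (insert u U) (fob F (Dom C e))
      (\<lambda>i. far F (Cmp C (l i) e))"
    by (rule partial_limit_cong) (use e' leg u in auto)
  with C.partial_limit_insert_Ar[OF D l(1) u(2,1) e(1)] show ?case
    by (intro exI[of _ "Dom C e"] exI[of _ "\<lambda>i. Cmp C (l i) e"] conjI)
qed

lemma preserved_finite_limit: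
  assumes "finite_diagram J C D"
  obtains x l where "limit_cone J C D x l"
    "limit_cone J C' (comp_functor J F D) (fob F x) (\<lambda>j. far F (l j))"
  using assms preserved_partial_limit_Ar[of J D "Ar J"]
  by (auto simp: finite_diagram_def limit_cone_partial)

lemma has_finite_limits: "has_finite_limits C"
  unfolding has_finite_limits_def using preserved_finite_limit by metis

text \<open>A given limit cone is isomorphic to the constructed one, whose image is a limit by
  construction, and \<open>F\<close> maps the comparison isomorphism to an isomorphism.\<close>

lemma preserves_finite_limits: "preserves_finite_limits C C' F"
  unfolding preserves_finite_limits_def
proof (intro allI impI, elim conjE)
  fix J D x l assume fin: "finite_diagram J C D" and lim: "limit_cone J C D x l"
  interpret D: is_functor J C D using fin by (simp add: finite_diagram_def)
  have FD: "is_functor J C' (comp_functor J F D)"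
    by (rule is_functor_comp_functor[OF D.is_functor_axioms is_functor_axioms])
  obtain x0 l0 where l0: "limit_cone J C D x0 l0"
    "limit_cone J C' (comp_functor J F D) (fob F x0) (\<lambda>j. far F (l0 j))"
    using preserved_finite_limit[OF fin] .
  have leg: "l0 j \<in> homset C x0 (fob D j)" if "j \<in> Ob J" for j
    using l0(1) that by (auto simp: limit_cone_def cone_def)
  have xx: "x \<in> Ob C" "x0 \<in> Ob C" using lim l0 by (auto simp: limit_cone_def cone_def)
  obtain h k where hk: "h \<in> homset C x x0" "k \<in> homset C x0 x" "Cmp C h k = Idn C x0"
    "Cmp C k h = Idn C x" "\<And>j. j \<in> Ob J \<Longrightarrow> l j = Cmp C (l0 j) h"
    using C.limit_cone_unique[OF lim l0(1)] by metis
  show "limit_cone J C' (comp_functor J F D) (fob F x) (\<lambda>j. far F (l j))"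
  proof (rule D.limit_cone_iso[OF FD l0(2)])
    show "far F h \<in> homset C' (fob F x) (fob F x0)" "far F k \<in> homset C' (fob F x0) (fob F x)"
      using hk by simp_all
    show "Cmp C' (far F h) (far F k) = Idn C' (fob F x0)" "Cmp C' (far F k) (far F h) = Idn C' (fob F x)"
      using hk xx by (simp_all flip: far_Cmp')
    show "far F (l j) = Cmp C' (far F (l0 j)) (far F h)" if "j \<in> Ob J" for j
      using that hk leg by simp
  qed
qed

end

subsection \<open>Pullbacks and terminal objects as finite limits\<close>

lemma limit_cone_empty:
  "Ob J = {} \<Longrightarrow> Ar J = {} \<Longrightarrow> limit_cone J C D x l \<longleftrightarrow> terminal C x"
  by (auto simp: limit_cone_def cone_def terminal_def)

definition empty_cat :: "(nat, nat) cat" where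
  "empty_cat = mk_cat {} {} (\<lambda>_. 0) (\<lambda>_. 0) (\<lambda>_. 0) (\<lambda>_ _. 0)"

lemma finite_diagram_empty:
  assumes "category C" shows "finite_diagram empty_cat C (mk_functor empty_cat u v)"
proof -
  have "category empty_cat" unfolding empty_cat_def by (rule category_mk_cat) auto
  then have "is_functor empty_cat C (mk_functor empty_cat u v)"
    by (rule is_functor_mk_functor[OF _ assms]) (auto simp: empty_cat_def)
  then show ?thesis by (simp add: finite_diagram_def empty_cat_def)
qed

text \<open>The shape \<open>0 \<rightarrow> 2 \<leftarrow> 1\<close>: the arrows \<open>0, 1, 2\<close> are identities, and \<open>3 : 0 \<rightarrow> 2\<close>, \<open>4 : 1 \<rightarrow> 2\<close>.\<close>

definition cospan :: "(nat, nat) cat" where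
  "cospan = mk_cat {0, 1, 2} {0, 1, 2, 3, 4} (\<lambda>f. if f = 3 then 0 else if f = 4 then 1 else f)
     (\<lambda>f. if f = 3 \<or> f = 4 then 2 else f) (\<lambda>x. x) (\<lambda>g f. if g < 3 then f else g)"

text \<open>The arrows 3 and 4 start at 0 and 1 and both end at 2, so in every composite one factor
  is an identity. The test \<open>g < 3\<close> in the composition of \<open>cospan\<close> picks
  the other factor.\<close>

lemma category_cospan: "category cospan"
  unfolding cospan_def by (rule category_mk_cat; (elim insertE emptyE)?; simp)

lemma cospan_simps [simp]:
  "Ob cospan = {0, 1, 2}" "Ar cospan = {0, 1, 2, 3, 4}"
  "Dom cospan 0 = 0" "Dom cospan (Suc 0) = 1" "Dom cospan 2 = 2" "Dom cospan 3 = 0" "Dom cospan 4 = 1"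
  "Cod cospan 0 = 0" "Cod cospan (Suc 0) = 1" "Cod cospan 2 = 2" "Cod cospan 3 = 2" "Cod cospan 4 = 2"
  "Idn cospan 0 = 0" "Idn cospan (Suc 0) = 1" "Idn cospan 2 = 2"
  by (simp_all add: cospan_def)

text \<open>The numbering matches \<open>Square f u v g\<close>: for a limit cone, the leg at 0 is
  the top edge \<open>u\<close> and the leg at 1 is the left edge \<open>f\<close>.\<close>

definition cospan_diagram :: "('o, 'a) cat \<Rightarrow> 'a \<Rightarrow> 'a \<Rightarrow> (nat, nat, 'o, 'a) functr" where
  "cospan_diagram C g v = mk_functor cospan
     (\<lambda>x. if x = 0 then Dom C g else if x = 1 then Dom C v else Cod C g)
     (\<lambda>f. if f = 3 then g else if f = 4 then v else
       Idn C (if f = 0 then Dom C g else if f = 1 then Dom C v else Cod C g))"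

lemma (in category) finite_diagram_cospan:
  assumes "g \<in> Ar C" "v \<in> Ar C" "Cod C g = Cod C v"
  shows "finite_diagram cospan C (cospan_diagram C g v)"
proof -
  have "is_functor cospan C (cospan_diagram C g v)"
    unfolding cospan_diagram_def
    by (rule is_functor_mk_functor[OF category_cospan category_axioms]; unfold cospan_simps(1,2);
        (elim insertE emptyE)?; simp add: cospan_def assms)
  then show ?thesis by (simp add: finite_diagram_def)
qed

text \<open>Identities impose no condition, and that \<open>l 2\<close> is an arrow of the right
  type follows from its being a composite.\<close>

lemma cospan_cone_iff:
  assumes "is_functor cospan C D"
  shows "cone cospan C D x l \<longleftrightarrow> x \<in> Ob C \<and> l 0 \<in> homset C x (Dom C (far D 3)) \<and>
    l 1 \<in> homset C x (Dom C (far D 4)) \<and> Cmp C (far D 4) (l 1) = l 2 \<and> Cmp C (far D 3) (l 0) = l 2"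
proof -
  interpret is_functor cospan C D by fact
  have D: "far D 3 \<in> Ar C" "far D 4 \<in> Ar C" "Dom C (far D 3) = fob D 0" "Dom C (far D 4) = fob D 1"
    "Cod C (far D 3) = fob D 2" "Cod C (far D 4) = fob D 2"
    "far D 0 = Idn C (fob D 0)" "far D (Suc 0) = Idn C (fob D 1)" "far D 2 = Idn C (fob D 2)"
    using far_simps[of 3] far_simps[of 4] far_Idn'[of 0] far_Idn'[of 1] far_Idn'[of 2] by auto
  have "l 2 \<in> homset C x (fob D 2)"
    if "l 0 \<in> homset C x (fob D 0)" "Cmp C (far D 3) (l 0) = l 2"
    using that D(1-6) by (simp flip: that(2))
  then show ?thesis
    by (intro iffI) (use D in \<open>auto simp: cone_def\<close>)
qed

lemma limit_cone_cone: "limit_cone J C D x l \<Longrightarrow> cone J C D x l"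
  by (simp add: limit_cone_def)

lemma limit_cone_ex1:
  "limit_cone J C D x l \<Longrightarrow> cone J C D y m \<Longrightarrow>
    \<exists>!h. h \<in> homset C y x \<and> (\<forall>j \<in> Ob J. Cmp C (l j) h = m j)"
  unfolding limit_cone_def by blast

lemma pullback_squareI:
  assumes "Square f u v g \<in> Ar (arrow_cat C)"
    and "\<And>x a b. a \<in> homset C x (Dom C g) \<Longrightarrow> b \<in> homset C x (Cod C f) \<Longrightarrow> Cmp C g a = Cmp C v b \<Longrightarrow>
      \<exists>!h. h \<in> homset C x (Dom C f) \<and> Cmp C u h = a \<and> Cmp C f h = b"
  shows "pullback_square C (Square f u v g)"
  unfolding pullback_square_def square.sel using assms by blast

text \<open>The leg at 2 is the composite of \<open>l 0\<close> with \<open>far D 3\<close>. It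
  constrains neither the existence nor the uniqueness of mediating arrows, so the limit property is
  that of the two remaining legs.\<close>

lemma cospan_limit_iff:
  assumes "is_functor cospan C D"
  shows "limit_cone cospan C D x l \<longleftrightarrow> Dom C (l 1) = x \<and> Cmp C (far D 3) (l 0) = l 2 \<and>
    pullback_square C (Square (l 1) (l 0) (far D 4) (far D 3))"
proof -
  interpret is_functor cospan C D by fact
  have D3: "far D 3 \<in> Ar C" "far D 4 \<in> Ar C" "Cod C (far D 3) = Cod C (far D 4)"
    using far_simps[of 3] far_simps[of 4] by auto
  show ?thesis
  proof
    assume lim: "limit_cone cospan C D x l"
    then have c: "x \<in> Ob C" "l 0 \<in> homset C x (Dom C (far D 3))" "l 1 \<in> homset C x (Dom C (far D 4))"
      "Cmp C (far D 4) (l 1) = l 2" "Cmp C (far D 3) (l 0) = l 2"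
      using cospan_cone_iff[OF assms] limit_cone_cone[OF lim] by auto
    have *: "\<exists>!h. h \<in> homset C y x \<and> Cmp C (l 0) h = a \<and> Cmp C (l 1) h = b"
      if ab: "a \<in> homset C y (Dom C (far D 3))" "b \<in> homset C y (Dom C (far D 4))"
        "Cmp C (far D 3) a = Cmp C (far D 4) b" for y a b
    proof -
      \<comment> \<open>The third leg is the diagonal of the square; by the assumed commutativity it
        equals the composite through \<open>far D 4\<close>.\<close>
      define m where "m = (\<lambda>i::nat. if i = 0 then a else if i = 1 then b else Cmp C (far D 3) a)"
      have "cone cospan C D y m"
        using ab by (auto simp: cospan_cone_iff[OF assms] m_def)
      then have ex: "\<exists>!h. h \<in> homset C y x \<and> (\<forall>j \<in> {0, 1, 2}. Cmp C (l j) h = m j)"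
        using limit_cone_ex1[OF lim, of y m] by simp
      have "Cmp C (l 2) h = Cmp C (far D 3) (Cmp C (l 0) h)" if "h \<in> homset C y x" for h
        using D.Cmp_assoc'[of "far D 3" "l 0" h] c D3 that by simp
      then have "(\<forall>j \<in> {0, 1, 2}. Cmp C (l j) h = m j) \<longleftrightarrow> Cmp C (l 0) h = a \<and> Cmp C (l 1) h = b"
        if "h \<in> homset C y x" for h
        using that by (auto simp: m_def)
      then show ?thesis by (rule ex1_conj_cong[OF sym ex])
    qed
    have "pullback_square C (Square (l 1) (l 0) (far D 4) (far D 3))"
      by (rule pullback_squareI) (use c D3 * in \<open>simp_all add: arrow_cat_Ar\<close>)
    then show "Dom C (l 1) = x \<and> Cmp C (far D 3) (l 0) = l 2 \<and>
        pullback_square C (Square (l 1) (l 0) (far D 4) (far D 3))"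
      using c by simp
  next
    assume R: "Dom C (l 1) = x \<and> Cmp C (far D 3) (l 0) = l 2 \<and>
        pullback_square C (Square (l 1) (l 0) (far D 4) (far D 3))"
    then have pb: "pullback_square C (Square (l 1) (l 0) (far D 4) (far D 3))" by blast
    note p = pullback_square_ArD[OF pb]
    have c: "cone cospan C D x l"
      using R p by (auto simp: cospan_cone_iff[OF assms])
    have "\<exists>!h. h \<in> homset C y x \<and> (\<forall>j \<in> Ob cospan. Cmp C (l j) h = m j)" if "cone cospan C D y m" for y m
    proof -
      have m: "m 0 \<in> homset C y (Dom C (far D 3))" "m 1 \<in> homset C y (Dom C (far D 4))"
        "Cmp C (far D 4) (m 1) = m 2" "Cmp C (far D 3) (m 0) = m 2"
        using that by (auto simp: cospan_cone_iff[OF assms])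
      have "\<exists>!h. h \<in> homset C y x \<and> Cmp C (l 0) h = m 0 \<and> Cmp C (l 1) h = m 1"
        using pullback_square_ex1[OF pb, of "m 0" y "m 1"] m p R by simp
      moreover have "(\<forall>j \<in> Ob cospan. Cmp C (l j) h = m j) \<longleftrightarrow> Cmp C (l 0) h = m 0 \<and> Cmp C (l 1) h = m 1"
        if h: "h \<in> homset C y x" for h
      proof -
        have "Cmp C (l 2) h = m 2" if "Cmp C (l 0) h = m 0"
        proof -
          have "Cmp C (l 2) h = Cmp C (Cmp C (far D 3) (l 0)) h" using R by simp
          also have "\<dots> = Cmp C (far D 3) (Cmp C (l 0) h)"
            using h p(1-9) D3 R by (intro D.Cmp_assoc') auto
          also have "\<dots> = m 2" using that m by simp
          finally show ?thesis .
        qed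
        then show ?thesis by auto
      qed
      ultimately show ?thesis by (rule ex1_conj_cong[rotated])
    qed
    with c show "limit_cone cospan C D x l" unfolding limit_cone_def by blast
  qed
qed

lemma cospan_diagram_far [simp]:
  "far (cospan_diagram C g v) 3 = g" "far (cospan_diagram C g v) 4 = v"
  by (simp_all add: cospan_diagram_def)

lemma preserves_pullbacks_id: "preserves_pullbacks C C (id_functor C)"
  unfolding preserves_pullbacks_def
proof (intro allI impI)
  fix s assume s: "pullback_square C s"
  then have "s \<in> Ar (arrow_cat C)" by (simp add: pullback_square_def)
  then have "map_square (far (id_functor C)) s = s"
    by (intro square_eqI) (auto simp: arrow_cat_ArD)
  with s show "pullback_square C (map_square (far (id_functor C)) s)" by simp
qed

lemma has_finite_limits_iff:
  assumes "category C"
  shows "has_finite_limits C \<longleftrightarrow> has_pullbacks C \<and> (\<exists>t. terminal C t)"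
proof
  interpret category C by fact
  assume L: "has_finite_limits C"
  obtain x l where "limit_cone empty_cat C (mk_functor empty_cat undefined undefined) x l"
    using L finite_diagram_empty[OF assms] unfolding has_finite_limits_def by metis
  then have "terminal C x"
    by (subst (asm) limit_cone_empty) (simp_all add: empty_cat_def)
  moreover have "\<exists>f u. pullback_square C (Square f u v g)"
    if "v \<in> Ar C" "g \<in> Ar C" "Cod C v = Cod C g" for v g
  proof -
    have fin: "finite_diagram cospan C (cospan_diagram C g v)"
      using finite_diagram_cospan that by simp
    then obtain x l where "limit_cone cospan C (cospan_diagram C g v) x l"
      using L unfolding has_finite_limits_def by metis
    then show ?thesis
      using fin by (subst (asm) cospan_limit_iff) (auto simp: finite_diagram_def)
  qed
  ultimately show "has_pullbacks C \<and> (\<exists>t. terminal C t)"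
    by (auto simp: has_pullbacks_def)
next
  assume R: "has_pullbacks C \<and> (\<exists>t. terminal C t)"
  interpret id: is_functor C C "id_functor C" by (rule is_functor_id_functor[OF assms])
  \<comment> \<open>Only existence of limits is wanted, so the functor is taken to be the identity,
    for which both preservation conditions hold trivially.\<close>
  interpret pullback_terminal_functor C C "id_functor C"
  proof
    show "has_pullbacks C" "\<exists>t. terminal C t" using R by auto
    show "preserves_terminals C C (id_functor C)"
      by (auto simp: preserves_terminals_def terminal_def)
    show "preserves_pullbacks C C (id_functor C)" by (rule preserves_pullbacks_id)
  qed
  show "has_finite_limits C" by (rule has_finite_limits)
qed

lemma preserves_finite_limits_iff:
  assumes F: "is_functor C C' F" and C: "has_finite_limits C"
  shows "preserves_finite_limits C C' F \<longleftrightarrow> preserves_pullbacks C C' F \<and> preserves_terminals C C' F"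
proof
  interpret is_functor C C' F by fact
  assume L: "preserves_finite_limits C C' F"
  have "terminal C' (fob F t)" if t: "terminal C t" for t
  proof -
    \<comment> \<open>A cone over the empty diagram has no legs, so \<open>undefined\<close> serves
      as the family of legs.\<close>
    have "limit_cone empty_cat C (mk_functor empty_cat undefined undefined) t undefined"
      using t by (subst limit_cone_empty) (simp_all add: empty_cat_def)
    then have "limit_cone empty_cat C' (comp_functor empty_cat F (mk_functor empty_cat undefined undefined))
        (fob F t) (\<lambda>j. far F (undefined j))"
      using L finite_diagram_empty[OF C.category_axioms] unfolding preserves_finite_limits_def by blast
    then show ?thesis
      by (subst (asm) limit_cone_empty) (simp_all add: empty_cat_def)
  qed
  moreover have "pullback_square C' (map_square (far F) s)" if s: "pullback_square C s" for s
  proof (cases s)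
    case [simp]: (Square f u v g)
    note p = pullback_square_ArD[OF s[unfolded Square]]
    have fin: "finite_diagram cospan C (cospan_diagram C g v)"
      using C.finite_diagram_cospan p by simp
    then have D: "is_functor cospan C (cospan_diagram C g v)" by (simp add: finite_diagram_def)
    \<comment> \<open>The pullback square read as a cone: the diagonal is added as the leg at vertex
      2.\<close>
    let ?l = "\<lambda>i::nat. if i = 0 then u else if i = 1 then f else Cmp C g u"
    have "limit_cone cospan C (cospan_diagram C g v) (Dom C f) ?l"
      using s by (simp add: cospan_limit_iff[OF D])
    then have "limit_cone cospan C' (comp_functor cospan F (cospan_diagram C g v)) (fob F (Dom C f))
        (\<lambda>i. far F (?l i))"
      using L fin unfolding preserves_finite_limits_def by blast
    then show ?thesis
      by (simp add: cospan_limit_iff[OF is_functor_comp_functor[OF D F]])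
  qed
  ultimately show "preserves_pullbacks C C' F \<and> preserves_terminals C C' F"
    by (simp add: preserves_pullbacks_def preserves_terminals_def)
next
  assume R: "preserves_pullbacks C C' F \<and> preserves_terminals C C' F"
  interpret is_functor C C' F by fact
  interpret pullback_terminal_functor C C' F
    by unfold_locales (use R C has_finite_limits_iff[OF C.category_axioms] in auto)
  show "preserves_finite_limits C C' F" by (rule preserves_finite_limits)
qed

section \<open>Isomorphisms and equivalences of 2-categories\<close>

definition inv_functor ::
  "('o, 'a) cat \<Rightarrow> ('p, 'b) cat \<Rightarrow> ('o, 'a, 'p, 'b) functr \<Rightarrow> ('p, 'b, 'o, 'a) functr" where
  "inv_functor C D F = mk_functor D (inv_into (Ob C) (fob F)) (inv_into (Ar C) (far F))"

locale bijective_functor = is_functor +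
  assumes bij_Ob: "bij_betw (fob F) (Ob C) (Ob D)"
    and bij_Ar: "bij_betw (far F) (Ar C) (Ar D)"
begin

lemma inv_fob:
  assumes "y \<in> Ob D"
  shows "fob (inv_functor C D F) y \<in> Ob C" "fob F (fob (inv_functor C D F) y) = y"
  using assms bij_betw_apply[OF bij_betw_inv_into[OF bij_Ob], of y] bij_betw_inv_into_right[OF bij_Ob, of y]
  by (simp_all add: inv_functor_def)

lemma inv_far:
  assumes "g \<in> Ar D"
  shows "far (inv_functor C D F) g \<in> Ar C" "far F (far (inv_functor C D F) g) = g"
  using assms bij_betw_apply[OF bij_betw_inv_into[OF bij_Ar], of g] bij_betw_inv_into_right[OF bij_Ar, of g]
  by (simp_all add: inv_functor_def)

lemma fob_inj: "x \<in> Ob C \<Longrightarrow> y \<in> Ob C \<Longrightarrow> fob F x = fob F y \<Longrightarrow> x = y"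
  using bij_Ob by (auto simp: bij_betw_def inj_on_def)

lemma far_inj: "f \<in> Ar C \<Longrightarrow> g \<in> Ar C \<Longrightarrow> far F f = far F g \<Longrightarrow> f = g"
  using bij_Ar by (auto simp: bij_betw_def inj_on_def)

lemma inv_fob_eq: "x \<in> Ob C \<Longrightarrow> fob F x = y \<Longrightarrow> fob (inv_functor C D F) y = x"
  using inv_fob[of y] fob_inj by auto

lemma inv_far_eq: "f \<in> Ar C \<Longrightarrow> far F f = g \<Longrightarrow> far (inv_functor C D F) g = f"
  using inv_far[of g] far_inj by auto

text \<open>\<open>F\<close> is injective on objects and arrows, so each law for the inverse may be
  verified after applying \<open>F\<close>; \<open>inv_fob_eq\<close> and \<open>inv_far_eq\<close>
  express this.\<close>

lemma is_functor_inv: "is_functor D C (inv_functor C D F)"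
proof -
  have "is_functor D C (mk_functor D (fob (inv_functor C D F)) (far (inv_functor C D F)))"
  proof (rule is_functor_mk_functor)
    fix f assume f: "f \<in> Ar D"
    note i = inv_far[OF f]
    show "Dom C (far (inv_functor C D F) f) = fob (inv_functor C D F) (Dom D f)"
      using i by (metis inv_fob_eq C.Dom_Ob far_simps(2))
    show "Cod C (far (inv_functor C D F) f) = fob (inv_functor C D F) (Cod D f)"
      using i by (metis inv_fob_eq C.Cod_Ob far_simps(3))
  next
    fix x assume "x \<in> Ob D"
    then show "far (inv_functor C D F) (Idn D x) = Idn C (fob (inv_functor C D F) x)"
      using inv_fob[of x] by (intro inv_far_eq) auto
  next
    fix g f assume gf: "g \<in> Ar D" "f \<in> Ar D" "Dom D g = Cod D f"
    note i = inv_far[OF gf(1)] inv_far[OF gf(2)]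
    \<comment> \<open>Composability of the preimages has to be established before their composite
      can be used; it follows from injectivity on objects.\<close>
    have "fob F (Dom C (far (inv_functor C D F) g)) = fob F (Cod C (far (inv_functor C D F) f))"
      using i gf by (metis far_simps(2,3))
    then have "Dom C (far (inv_functor C D F) g) = Cod C (far (inv_functor C D F) f)"
      using i by (intro fob_inj) auto
    then show "far (inv_functor C D F) (Cmp D g f) =
        Cmp C (far (inv_functor C D F) g) (far (inv_functor C D F) f)"
      using i by (intro inv_far_eq) auto
  qed (auto simp: inv_fob inv_far C.category_axioms D.category_axioms)
  also have "mk_functor D (fob (inv_functor C D F)) (far (inv_functor C D F)) = inv_functor C D F"
    by (simp add: inv_functor_def mk_functor_def)
  finally show ?thesis .
qed

lemma comp_inv_functor:
  "comp_functor C (inv_functor C D F) F = id_functor C"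
  "comp_functor D F (inv_functor C D F) = id_functor D"
  unfolding comp_functor_def id_functor_def
  by (auto intro!: mk_functor_eqI simp: inv_fob_eq inv_far_eq inv_fob inv_far)

end

text \<open>Saves constructing the inverse by hand: its preservation equations hold because they
  hold after applying \<Psi>, which is injective on cells. The inverse hom-functors are restricted
  to their carriers, so the composites equal \<open>id_functor\<close> literally.\<close>

lemma isomorphic_two_cats_of_bij:
  assumes "two_functor L K \<Psi>" and ob: "bij_betw (Fob \<Psi>) (TOb L) (TOb K)"
    and hob: "\<And>X Y. X \<in> TOb L \<Longrightarrow> Y \<in> TOb L \<Longrightarrow>
      bij_betw (fob (Fhom \<Psi> X Y)) (Ob (THom L X Y)) (Ob (THom K (Fob \<Psi> X) (Fob \<Psi> Y)))"
    and har: "\<And>X Y. X \<in> TOb L \<Longrightarrow> Y \<in> TOb L \<Longrightarrow>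
      bij_betw (far (Fhom \<Psi> X Y)) (Ar (THom L X Y)) (Ar (THom K (Fob \<Psi> X) (Fob \<Psi> Y)))"
  shows "isomorphic_two_cats K L"
proof -
  interpret \<Psi>: two_functor L K \<Psi> by fact
  define r where "r = inv_into (TOb L) (Fob \<Psi>)"
  have r: "r X \<in> TOb L" "Fob \<Psi> (r X) = X" if "X \<in> TOb K" for X
    using that bij_betw_apply[OF bij_betw_inv_into[OF ob]] bij_betw_inv_into_right[OF ob]
    by (simp_all add: r_def)
  have rL: "r (Fob \<Psi> X) = X" if "X \<in> TOb L" for X
    using that bij_betw_inv_into_left[OF ob] by (simp add: r_def)
  define I where "I X Y = inv_functor (THom L (r X) (r Y)) (THom K X Y) (Fhom \<Psi> (r X) (r Y))" for X Y
  have B: "bijective_functor (THom L (r X) (r Y)) (THom K X Y) (Fhom \<Psi> (r X) (r Y))"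
    if "X \<in> TOb K" "Y \<in> TOb K" for X Y
    using \<Psi>.Fhom_functor[of "r X" "r Y"] hob[of "r X" "r Y"] har[of "r X" "r Y"] r[OF that(1)] r[OF that(2)]
    by (simp add: bijective_functor_def bijective_functor_axioms_def)
  note Ifob = bijective_functor.inv_fob[OF B, folded I_def] and Ifar = bijective_functor.inv_far[OF B, folded I_def]
    and Ifob_eq = bijective_functor.inv_fob_eq[OF B, folded I_def]
    and Ifar_eq = bijective_functor.inv_far_eq[OF B, folded I_def]
  define \<Phi> where "\<Phi> = \<lparr>Fob = r, Fhom = I\<rparr>"
  have "two_functor K L \<Phi>"
  proof (intro two_functor.intro two_functor_axioms.intro \<Psi>.K.two_category_axioms \<Psi>.L.two_category_axioms)
    show "Fob \<Phi> X \<in> TOb L" if "X \<in> TOb K" for X using r that by (simp add: \<Phi>_def)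
    show "is_functor (THom K X Y) (THom L (Fob \<Phi> X) (Fob \<Phi> Y)) (Fhom \<Phi> X Y)"
      if "X \<in> TOb K" "Y \<in> TOb K" for X Y
      using bijective_functor.is_functor_inv[OF B[OF that]] by (simp add: \<Phi>_def I_def)
    show "fob (Fhom \<Phi> X X) (TId K X) = TId L (Fob \<Phi> X)" if X: "X \<in> TOb K" for X
      unfolding \<Phi>_def two_functr.simps
      using r[OF X] \<Psi>.preserves_TId[of "r X"] by (intro Ifob_eq X) (simp_all add: \<Psi>.K.TId_ob)
  next
    fix X Y Z f g assume XYZ: "X \<in> TOb K" "Y \<in> TOb K" "Z \<in> TOb K"
      and fg: "f \<in> Ob (THom K X Y)" "g \<in> Ob (THom K Y Z)"
    show "fob (Fhom \<Phi> X Z) (TComp1 K X Y Z g f) =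
       TComp1 L (Fob \<Phi> X) (Fob \<Phi> Y) (Fob \<Phi> Z) (fob (Fhom \<Phi> Y Z) g) (fob (Fhom \<Phi> X Y) f)"
      unfolding \<Phi>_def two_functr.simps
      using XYZ fg r by (intro Ifob_eq) (simp_all add: Ifob \<Psi>.preserves_TComp1)
  next
    fix X Y Z s t assume XYZ: "X \<in> TOb K" "Y \<in> TOb K" "Z \<in> TOb K"
      and st: "s \<in> Ar (THom K X Y)" "t \<in> Ar (THom K Y Z)"
    show "far (Fhom \<Phi> X Z) (TComp2 K X Y Z t s) =
       TComp2 L (Fob \<Phi> X) (Fob \<Phi> Y) (Fob \<Phi> Z) (far (Fhom \<Phi> Y Z) t) (far (Fhom \<Phi> X Y) s)"
      unfolding \<Phi>_def two_functr.simps
      using XYZ st r by (intro Ifar_eq) (simp_all add: Ifar \<Psi>.preserves_TComp2)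
  qed
  moreover have "comp_functor (THom K X Y) (Fhom \<Psi> (r X) (r Y)) (I X Y) = id_functor (THom K X Y)"
    if "X \<in> TOb K" "Y \<in> TOb K" for X Y
    using bijective_functor.comp_inv_functor(2)[OF B[OF that]] by (simp add: I_def)
  then have "two_functor_left_inverse K \<Phi> \<Psi>"
    using r by (simp add: two_functor_left_inverse_def \<Phi>_def)
  moreover have "comp_functor (THom L X Y) (I (Fob \<Psi> X) (Fob \<Psi> Y)) (Fhom \<Psi> X Y) = id_functor (THom L X Y)"
    if "X \<in> TOb L" "Y \<in> TOb L" for X Y
    using bijective_functor.comp_inv_functor(1)[OF B[OF \<Psi>.Fob_ob[OF that(1)] \<Psi>.Fob_ob[OF that(2)]]]
    by (simp add: I_def rL[OF that(1)] rL[OF that(2)])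
  then have "two_functor_left_inverse L \<Psi> \<Phi>"
    using rL by (simp add: two_functor_left_inverse_def \<Phi>_def)
  ultimately show ?thesis
    using assms(1) unfolding isomorphic_two_cats_def by blast
qed

section \<open>Inclusions of essentially surjective full subcategories\<close>

definition inclusion :: "('o, 'a) cat \<Rightarrow> 'o set \<Rightarrow> ('o, 'a, 'o, 'a) functr" where
  "inclusion C S = mk_functor (full_subcat C S) (\<lambda>x. x) (\<lambda>f. f)"

lemma inclusion_simps [simp]:
  "x \<in> Ob C \<Longrightarrow> x \<in> S \<Longrightarrow> fob (inclusion C S) x = x"
  "f \<in> Ar C \<Longrightarrow> Dom C f \<in> S \<Longrightarrow> Cod C f \<in> S \<Longrightarrow> far (inclusion C S) f = f"
  by (simp_all add: inclusion_def)

lemma is_functor_inclusion: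
  assumes "category C" shows "is_functor (full_subcat C S) C (inclusion C S)"
  unfolding inclusion_def
  by (rule is_functor_mk_functor[OF category_full_subcat[OF assms] assms]) auto

lemma isomorphicE:
  assumes "category C" "isomorphic C x y"
  obtains e e' where "e \<in> homset C x y" "e' \<in> homset C y x" "Cmp C e' e = Idn C x" "Cmp C e e' = Idn C y"
  using assms unfolding isomorphic_def iso_arr_def by auto

text \<open>A full inclusion that meets every isomorphism class is an equivalence. The quasi-inverse
  needs a choice, for each \<open>x\<close>, of an object \<open>r x\<close> in \<open>S\<close>
  with mutually inverse arrows \<open>e x\<close> and \<open>e' x\<close>.\<close>

lemma equivalence_inclusion:
  assumes "category C" and S: "\<And>x. x \<in> Ob C \<Longrightarrow> \<exists>y \<in> Ob C \<inter> S. isomorphic C x y"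
  shows "equivalence (full_subcat C S) C (inclusion C S)"
proof -
  interpret category C by fact
  have "\<exists>q. case q of (y, e, e') \<Rightarrow> y \<in> Ob C \<and> y \<in> S \<and> e \<in> homset C x y \<and> e' \<in> homset C y x \<and>
      Cmp C e' e = Idn C x \<and> Cmp C e e' = Idn C y" if x: "x \<in> Ob C" for x
  proof -
    obtain y where y: "y \<in> Ob C" "y \<in> S" "isomorphic C x y" using S[OF x] by blast
    obtain e e' where "e \<in> homset C x y" "e' \<in> homset C y x" "Cmp C e' e = Idn C x" "Cmp C e e' = Idn C y"
      by (rule isomorphicE[OF assms(1) y(3)])
    with y show ?thesis by (intro exI[of _ "(y, e, e')"]) simp
  qed
  \<comment> \<open>The condition on \<open>x\<close> is moved under the existential quantifier, so
    that \<open>choice_iff\<close> yields a single total function.\<close>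
  then have "\<forall>x. \<exists>q. x \<in> Ob C \<longrightarrow> (case q of (y, e, e') \<Rightarrow> y \<in> Ob C \<and> y \<in> S \<and> e \<in> homset C x y \<and>
      e' \<in> homset C y x \<and> Cmp C e' e = Idn C x \<and> Cmp C e e' = Idn C y)" by blast
  then obtain p where p: "\<And>x. x \<in> Ob C \<Longrightarrow> case p x of (y, e, e') \<Rightarrow> y \<in> Ob C \<and> y \<in> S \<and>
      e \<in> homset C x y \<and> e' \<in> homset C y x \<and> Cmp C e' e = Idn C x \<and> Cmp C e e' = Idn C y"
    unfolding choice_iff by blast
  define r e e' where "r = (\<lambda>x. fst (p x))" and "e = (\<lambda>x. fst (snd (p x)))" and "e' = (\<lambda>x. snd (snd (p x)))"
  have e: "r x \<in> Ob C" "r x \<in> S" "e x \<in> Ar C" "Dom C (e x) = x" "Cod C (e x) = r x"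
    "e' x \<in> Ar C" "Dom C (e' x) = r x" "Cod C (e' x) = x"
    "Cmp C (e' x) (e x) = Idn C x" "Cmp C (e x) (e' x) = Idn C (r x)" if "x \<in> Ob C" for x
    using p[OF that] by (auto simp: r_def e_def e'_def)
  have ee: "Cmp C (e' x) (Cmp C (e x) h) = h" if "x \<in> Ob C" "h \<in> Ar C" "Cod C h = x" for x h
    using e[OF that(1)] that Cmp_assoc'[of "e' x" "e x" h] by simp
  \<comment> \<open>Conjugation by the chosen isomorphisms. It makes \<open>e\<close> natural from
    the identity to \<open>G\<close> and \<open>e'\<close> natural in the other direction, which
    gives unit and counit.\<close>
  define G where "G = mk_functor C r (\<lambda>f. Cmp C (e (Cod C f)) (Cmp C f (e' (Dom C f))))"
  have G: "is_functor C (full_subcat C S) G"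
    unfolding G_def
    by (rule is_functor_mk_functor[OF category_axioms category_full_subcat[OF category_axioms]])
      (simp_all add: e ee)
  note incl = is_functor_inclusion[OF category_axioms, of S]
  have Gob: "fob G x = r x" if "x \<in> Ob C" for x using that by (simp add: G_def)
  have Gar: "far G f = Cmp C (e (Cod C f)) (Cmp C f (e' (Dom C f)))" if "f \<in> Ar C" for f
    using that by (simp add: G_def)
  have "nat_trans (full_subcat C S) (full_subcat C S) (id_functor (full_subcat C S))
      (comp_functor (full_subcat C S) G (inclusion C S)) (restrict e (Ob C \<inter> S))"
    by (rule nat_transI[OF is_functor_id_functor[OF category_full_subcat[OF category_axioms]]
        is_functor_comp_functor[OF incl G]])
      (simp_all add: e Gob Gar)
  moreover have "iso_arr (full_subcat C S) (restrict e (Ob C \<inter> S) x)" if "x \<in> Ob C \<inter> S" for x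
    using that e by (intro category.iso_arrI[OF category_full_subcat[OF category_axioms], where g = "e' x"]) simp_all
  moreover have "nat_trans C C (comp_functor C (inclusion C S) G) (id_functor C) (restrict e' (Ob C))"
    by (rule nat_transI[OF is_functor_comp_functor[OF G incl] is_functor_id_functor[OF category_axioms]])
      (simp_all add: e ee Gob Gar)
  moreover have "iso_arr C (restrict e' (Ob C) x)" if "x \<in> Ob C" for x
    using that e by (intro iso_arrI[where g = "e x"]) simp_all
  ultimately show ?thesis
    unfolding equivalence_def nat_iso_def using incl G
    by (intro conjI exI[of _ G] exI[of _ "restrict e (Ob C \<inter> S)"] exI[of _ "restrict e' (Ob C)"]) simp_all
qed

lemma internally_equivalent_refl:
  assumes "two_category K" "X \<in> TOb K" shows "internally_equivalent K X X"
proof -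
  interpret two_category K by fact
  interpret category "THom K X X" by (rule hom_category) fact+
  have "isomorphic (THom K X X) (TId K X) (TId K X)"
    unfolding isomorphic_def using assms TId_ob
    by (intro bexI[of _ "TId2 K X"]) simp_all
  then show ?thesis
    unfolding internally_equivalent_def using assms TId_ob unit1[of X X "TId K X"]
    by (intro bexI[of _ "TId K X"] conjI) simp_all
qed

text \<open>The inclusion is the identity on objects and full on 2-cells, so surjectivity up to
  equivalence is reflexivity, and on hom-categories only essential surjectivity is left, which is
  the premise on \<open>S\<close>.\<close>

lemma equivalent_two_cats_locally_full_sub:
  assumes K: "two_category K" and sub: "two_category (locally_full_sub_two_cat K S)"
    and S: "\<And>X Y f. X \<in> TOb K \<Longrightarrow> Y \<in> TOb K \<Longrightarrow> f \<in> Ob (THom K X Y) \<Longrightarrow>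
      \<exists>g \<in> Ob (THom K X Y) \<inter> S X Y. isomorphic (THom K X Y) f g"
  shows "equivalent_two_cats (locally_full_sub_two_cat K S) K"
proof -
  interpret K: two_category K by fact
  interpret L: two_category "locally_full_sub_two_cat K S" by fact
  define \<Phi> where "\<Phi> = \<lparr>Fob = (\<lambda>X. X), Fhom = (\<lambda>X Y. inclusion (THom K X Y) (S X Y))\<rparr>"
  have "two_functor (locally_full_sub_two_cat K S) K \<Phi>"
  proof (intro two_functor.intro two_functor_axioms.intro K sub)
    fix X assume "X \<in> TOb (locally_full_sub_two_cat K S)"
    then show "Fob \<Phi> X \<in> TOb K" "fob (Fhom \<Phi> X X) (TId (locally_full_sub_two_cat K S) X) = TId K (Fob \<Phi> X)"
      using L.TId_ob[of X] by (auto simp: \<Phi>_def)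
  next
    fix X Y assume "X \<in> TOb (locally_full_sub_two_cat K S)" "Y \<in> TOb (locally_full_sub_two_cat K S)"
    then show "is_functor (THom (locally_full_sub_two_cat K S) X Y) (THom K (Fob \<Phi> X) (Fob \<Phi> Y)) (Fhom \<Phi> X Y)"
      by (simp add: \<Phi>_def is_functor_inclusion K.hom_category)
  next
    fix X Y Z f g assume "X \<in> TOb (locally_full_sub_two_cat K S)" "Y \<in> TOb (locally_full_sub_two_cat K S)"
      "Z \<in> TOb (locally_full_sub_two_cat K S)" "f \<in> Ob (THom (locally_full_sub_two_cat K S) X Y)"
      "g \<in> Ob (THom (locally_full_sub_two_cat K S) Y Z)"
    with L.TComp1_Ob[OF this] show "fob (Fhom \<Phi> X Z) (TComp1 (locally_full_sub_two_cat K S) X Y Z g f) =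
       TComp1 K (Fob \<Phi> X) (Fob \<Phi> Y) (Fob \<Phi> Z) (fob (Fhom \<Phi> Y Z) g) (fob (Fhom \<Phi> X Y) f)"
      by (simp add: \<Phi>_def)
  next
    fix X Y Z s t assume XYZ: "X \<in> TOb (locally_full_sub_two_cat K S)" "Y \<in> TOb (locally_full_sub_two_cat K S)"
      "Z \<in> TOb (locally_full_sub_two_cat K S)" and st: "s \<in> Ar (THom (locally_full_sub_two_cat K S) X Y)"
      "t \<in> Ar (THom (locally_full_sub_two_cat K S) Y Z)"
    with L.TComp2_simps(1)[OF XYZ st] show "far (Fhom \<Phi> X Z) (TComp2 (locally_full_sub_two_cat K S) X Y Z t s) =
       TComp2 K (Fob \<Phi> X) (Fob \<Phi> Y) (Fob \<Phi> Z) (far (Fhom \<Phi> Y Z) t) (far (Fhom \<Phi> X Y) s)"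
      by (simp add: \<Phi>_def)
  qed
  moreover have "equivalence (THom (locally_full_sub_two_cat K S) X Y) (THom K (Fob \<Phi> X) (Fob \<Phi> Y)) (Fhom \<Phi> X Y)"
    if "X \<in> TOb K" "Y \<in> TOb K" for X Y
    using equivalence_inclusion[OF K.hom_category[OF that] S[OF that]] by (simp add: \<Phi>_def)
  moreover have "\<exists>X \<in> TOb K. internally_equivalent K (Fob \<Phi> X) Y" if "Y \<in> TOb K" for Y
    using internally_equivalent_refl[OF K that] that by (auto simp: \<Phi>_def)
  ultimately show ?thesis
    unfolding equivalent_two_cats_def two_equivalence_def by (metis locally_full_sub_simps(1))
qed

section \<open>The codomain fibration\<close>

lemma cartesian_lift:
  assumes "cartesian T C p f" "g \<in> Ar T" "Cod T g = Cod T f"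
    and "w \<in> homset C (fob p (Dom T g)) (fob p (Dom T f))" "Cmp C (far p f) w = far p g"
  shows "\<exists>!h. h \<in> homset T (Dom T g) (Dom T f) \<and> far p h = w \<and> Cmp T f h = g"
  using assms unfolding cartesian_def by blast

text \<open>Cartesian arrows are stable under isomorphism of arrows. Needed because a pseudo map
  preserves cartesian arrows only through \<open>mtotal\<close>, whose values are isomorphic, but
  not equal, to the squares induced by the base.\<close>

lemma (in is_functor) cartesian_iso:
  assumes f: "cartesian C D F f" and i: "iso_arr C i" and j: "iso_arr C j" and q: "q \<in> Ar C"
    and dom: "Dom C i = Dom C q" "Cod C i = Dom C f" and cod: "Dom C j = Cod C q" "Cod C j = Cod C f"
    and comm: "Cmp C j q = Cmp C f i"
  shows "cartesian C D F q"
proof -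
  have fA: "f \<in> Ar C" using f by (simp add: cartesian_def)
  obtain i' where i': "i \<in> Ar C" "i' \<in> Ar C" "Dom C i' = Cod C i" "Cod C i' = Dom C i"
    "Cmp C i' i = Idn C (Dom C i)" "Cmp C i i' = Idn C (Cod C i)"
    "\<And>h. h \<in> Ar C \<Longrightarrow> Cod C h = Dom C i \<Longrightarrow> Cmp C i' (Cmp C i h) = h"
    "\<And>h. h \<in> Ar C \<Longrightarrow> Cod C h = Cod C i \<Longrightarrow> Cmp C i (Cmp C i' h) = h"
    using C.iso_arrE[OF i] by blast
  obtain j' where j': "j \<in> Ar C" "j' \<in> Ar C" "Dom C j' = Cod C j" "Cod C j' = Dom C j"
    "Cmp C j' j = Idn C (Dom C j)" "Cmp C j j' = Idn C (Cod C j)"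
    "\<And>h. h \<in> Ar C \<Longrightarrow> Cod C h = Dom C j \<Longrightarrow> Cmp C j' (Cmp C j h) = h"
    "\<And>h. h \<in> Ar C \<Longrightarrow> Cod C h = Cod C j \<Longrightarrow> Cmp C j (Cmp C j' h) = h"
    using C.iso_arrE[OF j] by blast
  have comm': "Cmp C f (Cmp C i h) = Cmp C j (Cmp C q h)" if "h \<in> Ar C" "Cod C h = Dom C q" for h
  proof -
    have "Cmp C f (Cmp C i h) = Cmp C (Cmp C f i) h" using that fA i' dom by simp
    also have "\<dots> = Cmp C j (Cmp C q h)" unfolding comm[symmetric] using that q j' cod by simp
    finally show ?thesis .
  qed
  \<comment> \<open>A lifting problem \<open>g\<close>, \<open>w\<close> for \<open>q\<close>
    becomes the problem \<open>Cmp C j g\<close>, \<open>Cmp D (far F i) w\<close> for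
    \<open>f\<close>. Its solution \<open>h\<close> is carried back as
    \<open>Cmp C i' h\<close>.\<close>
  have "\<exists>!h. h \<in> homset C (Dom C g) (Dom C q) \<and> far F h = w \<and> Cmp C q h = g"
    if g: "g \<in> Ar C" "Cod C g = Cod C q"
      and w: "w \<in> homset D (fob F (Dom C g)) (fob F (Dom C q))" "Cmp D (far F q) w = far F g" for g w
  proof -
    have "Cmp D (far F f) (Cmp D (far F i) w) = Cmp D (Cmp D (far F f) (far F i)) w"
      using w fA i' dom by simp
    also have "\<dots> = Cmp D (far F (Cmp C j q)) w"
      unfolding comm using fA i' dom by simp
    also have "\<dots> = far F (Cmp C j g)"
      using w q j' cod g by simp
    finally have comp: "Cmp D (far F f) (Cmp D (far F i) w) = far F (Cmp C j g)" .
    have jg: "Cmp C j g \<in> Ar C" "Dom C (Cmp C j g) = Dom C g" "Cod C (Cmp C j g) = Cod C f"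
      using g j'(1) cod by simp_all
    have "Cmp D (far F i) w \<in> homset D (fob F (Dom C g)) (fob F (Dom C f))"
      using w i'(1) dom by simp
    then have ex: "\<exists>!h. h \<in> homset C (Dom C g) (Dom C f) \<and> far F h = Cmp D (far F i) w \<and>
        Cmp C f h = Cmp C j g"
      using cartesian_lift[OF f jg(1,3) _ comp] unfolding jg(2) by blast
    then obtain h where h: "h \<in> homset C (Dom C g) (Dom C f)" "far F h = Cmp D (far F i) w" "Cmp C f h = Cmp C j g"
      by blast
    have uniq: "k = h" if "k \<in> homset C (Dom C g) (Dom C f)" "far F k = Cmp D (far F i) w"
        "Cmp C f k = Cmp C j g" for k
      using ex h that by blast
    show ?thesis
    proof (rule ex1I[of _ "Cmp C i' h"])
      have "far F (Cmp C i' h) = Cmp D (Cmp D (far F i') (far F i)) w"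
        using h i' w dom by simp
      also have "Cmp D (far F i') (far F i) = Idn D (fob F (Dom C i))"
        using far_Cmp'[of i' i] i' by simp
      also have "Cmp D (Idn D (fob F (Dom C i))) w = w"
        using w dom by simp
      finally have 1: "far F (Cmp C i' h) = w" .
      have "Cmp C j (Cmp C q (Cmp C i' h)) = Cmp C j g"
        using comm'[of "Cmp C i' h"] h i' dom by simp
      then have "Cmp C j' (Cmp C j (Cmp C q (Cmp C i' h))) = Cmp C j' (Cmp C j g)" by simp
      then have "Cmp C q (Cmp C i' h) = g"
        using j'(7) h i' dom cod g q by simp
      with 1 show "Cmp C i' h \<in> homset C (Dom C g) (Dom C q) \<and> far F (Cmp C i' h) = w \<and> Cmp C q (Cmp C i' h) = g"
        using h i' dom by simp
    next
      fix k assume k: "k \<in> homset C (Dom C g) (Dom C q) \<and> far F k = w \<and> Cmp C q k = g"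
      then have "Cmp C i k = h"
        using i' dom comm'[of k] by (intro uniq) auto
      then show "k = Cmp C i' h" using i'(7)[of k] k dom by auto
    qed
  qed
  then show ?thesis unfolding cartesian_def using q by blast
qed

text \<open>Used with \<open>S\<close> the map that completes a top edge \<open>k\<close> to a
  square with three fixed edges: a unique such square amounts to a unique \<open>k\<close>.\<close>

lemma ex1_image_iff:
  assumes "\<And>k k'. S k = S k' \<Longrightarrow> k = k'"
  shows "(\<exists>!h. \<exists>k. h = S k \<and> P k) \<longleftrightarrow> (\<exists>!k. P k)"
proof
  assume "\<exists>!h. \<exists>k. h = S k \<and> P k"
  then obtain k where k: "P k" "\<And>k'. P k' \<Longrightarrow> S k' = S k" by blast
  then show "\<exists>!k. P k" using assms by blast
next
  assume "\<exists>!k. P k"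
  then show "\<exists>!h. \<exists>k. h = S k \<and> P k" by blast
qed

text \<open>The two universal properties test different data: a lifting problem has a variable
  bottom edge \<open>w\<close>, a cone over the cospan has none. One direction specializes
  \<open>w\<close> to an identity; the other absorbs \<open>w\<close> into the second leg of the
  cone.\<close>

lemma cartesian_cod_iff:
  assumes "category C"
  shows "cartesian (arrow_cat C) C (cod_functor C) s \<longleftrightarrow> pullback_square C s"
proof (cases s)
  case [simp]: (Square f u v g)
  interpret category C by fact
  show ?thesis
  proof
    assume cart: "cartesian (arrow_cat C) C (cod_functor C) s"
    then have s: "s \<in> Ar (arrow_cat C)" by (simp add: cartesian_def)
    then have p: "f \<in> Ar C" "g \<in> Ar C" "u \<in> Ar C" "v \<in> Ar C" "Dom C u = Dom C f" "Cod C u = Dom C g"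
      "Dom C v = Cod C f" "Cod C v = Cod C g" "Cmp C g u = Cmp C v f"
      by (auto simp: arrow_cat_Ar)
    show "pullback_square C s"
      unfolding Square
    proof (rule pullback_squareI)
      show "Square f u v g \<in> Ar (arrow_cat C)" using s by simp
      fix x a b assume ab: "a \<in> homset C x (Dom C g)" "b \<in> homset C x (Cod C f)" "Cmp C g a = Cmp C v b"
      \<comment> \<open>The cone \<open>a\<close>, \<open>b\<close> read as a square out of the
        arrow \<open>b\<close>. Lifting it over the identity of \<open>Cod C f\<close> gives the
        mediating arrow as a top edge.\<close>
      then have t: "Square b a v g \<in> Ar (arrow_cat C)" using p by (auto simp: arrow_cat_Ar)
      have ex: "\<exists>!h. h \<in> homset (arrow_cat C) (Dom (arrow_cat C) (Square b a v g)) (Dom (arrow_cat C) s) \<and>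
          far (cod_functor C) h = Idn C (Cod C f) \<and> Cmp (arrow_cat C) s h = Square b a v g"
        using s t p ab by (intro cartesian_lift[OF cart]) auto
      have iff: "h \<in> homset (arrow_cat C) b f \<and> far (cod_functor C) h = Idn C (Cod C f) \<and>
          Cmp (arrow_cat C) s h = Square b a v g \<longleftrightarrow>
          (\<exists>k. h = Square b k (Idn C (Cod C f)) f \<and> k \<in> homset C x (Dom C f) \<and> Cmp C u k = a \<and> Cmp C f k = b)" for h
      proof (cases h)
        case [simp]: (Square b' k i f')
        have "h \<in> homset (arrow_cat C) b f \<longleftrightarrow> h \<in> Ar (arrow_cat C) \<and> b' = b \<and> f' = f" by auto
        moreover have "Square b k (Idn C (Cod C f)) f \<in> Ar (arrow_cat C) \<longleftrightarrow>
            k \<in> homset C x (Dom C f) \<and> Cmp C f k = b"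
          using p ab by (auto simp: arrow_cat_Ar)
        moreover have "Cmp (arrow_cat C) s h = Square b (Cmp C u k) v g"
          if "Square b k (Idn C (Cod C f)) f \<in> Ar (arrow_cat C)" "h = Square b k (Idn C (Cod C f)) f"
          using that s p by simp
        moreover have "far (cod_functor C) h = i" if "h \<in> Ar (arrow_cat C)"
          using that by simp
        ultimately show ?thesis by auto
      qed
      have "\<exists>!h. (\<exists>k. h = Square b k (Idn C (Cod C f)) f \<and> k \<in> homset C x (Dom C f) \<and> Cmp C u k = a \<and> Cmp C f k = b)"
        using ex s t unfolding iff[symmetric] by simp
      then show "\<exists>!h. h \<in> homset C x (Dom C f) \<and> Cmp C u h = a \<and> Cmp C f h = b"
        by (subst (asm) ex1_image_iff) simp_all
    qed
  next
    assume pb: "pullback_square C s"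
    note pb = pb[unfolded Square]
    note p = pullback_square_ArD[OF pb]
    have "\<exists>!h. h \<in> homset (arrow_cat C) (Dom (arrow_cat C) t) (Dom (arrow_cat C) s) \<and>
        far (cod_functor C) h = w \<and> Cmp (arrow_cat C) s h = t"
      if t: "t \<in> Ar (arrow_cat C)" "Cod (arrow_cat C) t = Cod (arrow_cat C) s"
        and w: "w \<in> homset C (fob (cod_functor C) (Dom (arrow_cat C) t)) (fob (cod_functor C) (Dom (arrow_cat C) s))"
          "Cmp C (far (cod_functor C) s) w = far (cod_functor C) t" for t w
    proof (cases t)
      case [simp]: (Square b a v' g')
      have eq: "g' = g" using t p(1) by simp
      have q: "b \<in> Ar C" "a \<in> homset C (Dom C b) (Dom C g)" "v' \<in> homset C (Cod C b) (Cod C g)"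
        "Cmp C g a = Cmp C v' b"
        using t by (auto simp: arrow_cat_Ar eq)
      have w': "w \<in> homset C (Cod C b) (Cod C f)" "Cmp C v w = v'"
        using w t p q(1) by auto
      have vw: "Cmp C v (Cmp C w b) = Cmp C v' b"
        using Cmp_assoc'[of v w b] w' p q by simp
      \<comment> \<open>The pullback property for the cone with legs \<open>a\<close> and
        \<open>Cmp C w b\<close>.\<close>
      have ex: "\<exists>!k. k \<in> homset C (Dom C b) (Dom C f) \<and> Cmp C u k = a \<and> Cmp C f k = Cmp C w b"
        by (rule pullback_square_ex1[OF pb]) (use q w' vw in auto)
      have iff: "h \<in> homset (arrow_cat C) (Dom (arrow_cat C) t) (Dom (arrow_cat C) s) \<and>
        far (cod_functor C) h = w \<and> Cmp (arrow_cat C) s h = t \<longleftrightarrow>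
        (\<exists>k. h = Square b k w f \<and> k \<in> homset C (Dom C b) (Dom C f) \<and> Cmp C u k = a \<and> Cmp C f k = Cmp C w b)" for h
      proof (cases h)
        case [simp]: (Square b' k w'' f')
        have "h \<in> homset (arrow_cat C) (Dom (arrow_cat C) t) (Dom (arrow_cat C) s) \<longleftrightarrow>
            h \<in> Ar (arrow_cat C) \<and> b' = b \<and> f' = f"
          using t p by auto
        moreover have "Square b k w f \<in> Ar (arrow_cat C) \<longleftrightarrow>
            k \<in> homset C (Dom C b) (Dom C f) \<and> Cmp C f k = Cmp C w b"
          using p q w' by (auto simp: arrow_cat_Ar)
        moreover have "Cmp (arrow_cat C) s h = Square b (Cmp C u k) v' g"
          if "Square b k w f \<in> Ar (arrow_cat C)" "h = Square b k w f"
          using that p w' by simp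
        moreover have "far (cod_functor C) h = w''" if "h \<in> Ar (arrow_cat C)"
          using that by simp
        ultimately show ?thesis using eq by auto
      qed
      show ?thesis unfolding iff by (subst ex1_image_iff) (use ex in simp_all)
    qed
    moreover have "s \<in> Ar (arrow_cat C)" using p(1) by simp
    ultimately show "cartesian (arrow_cat C) C (cod_functor C) s"
      unfolding cartesian_def by blast
  qed
qed

lemma fibration_cod_iff:
  assumes "category C"
  shows "fibration (arrow_cat C) C (cod_functor C) \<longleftrightarrow> has_pullbacks C"
proof -
  interpret category C by fact
  have "(\<exists>s. pullback_square C s \<and> Cod (arrow_cat C) s = g \<and> far (cod_functor C) s = v) \<longleftrightarrow>
      (\<exists>f u. pullback_square C (Square f u v g))" for v g
  proof
    assume "\<exists>s. pullback_square C s \<and> Cod (arrow_cat C) s = g \<and> far (cod_functor C) s = v"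
    then obtain s where s: "pullback_square C s" "Cod (arrow_cat C) s = g" "far (cod_functor C) s = v" by blast
    from s(1) have "s \<in> Ar (arrow_cat C)" by (simp add: pullback_square_def)
    with s have "s = Square (sq_dom s) (sq_top s) v g" by (intro square_eqI) auto
    with s(1) show "\<exists>f u. pullback_square C (Square f u v g)" by metis
  next
    assume "\<exists>f u. pullback_square C (Square f u v g)"
    then obtain f u where s: "pullback_square C (Square f u v g)" by blast
    with pullback_square_ArD(1)[OF s]
    show "\<exists>s. pullback_square C s \<and> Cod (arrow_cat C) s = g \<and> far (cod_functor C) s = v"
      by (intro exI[of _ "Square f u v g"]) simp
  qed
  then show ?thesis
    unfolding fibration_def has_pullbacks_def cartesian_cod_iff[OF assms]
    using is_functor_cod_functor[OF assms] by auto
qed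

section \<open>Trivial rooted comprehension categories\<close>

definition triv_cc :: "('o, 'a) cat \<Rightarrow> 'o \<Rightarrow> ('o, 'a, 'a, 'a square) rooted_compcat" where
  "triv_cc C t = \<lparr>Base = C, Tot = arrow_cat C, Proj = cod_functor C, Chi = id_functor (arrow_cat C), Root = t\<rparr>"

lemma triv_cc_sel [simp]:
  "Base (triv_cc C t) = C" "Tot (triv_cc C t) = arrow_cat C" "Proj (triv_cc C t) = cod_functor C"
  "Chi (triv_cc C t) = id_functor (arrow_cat C)" "Root (triv_cc C t) = t"
  by (simp_all add: triv_cc_def)

lemma rooted_comp_cat_triv_cc:
  assumes C: "category C" and pb: "has_pullbacks C" and t: "terminal C t"
  shows "rooted_comp_cat (triv_cc C t)" "trivial (triv_cc C t)"
proof -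
  interpret category C by fact
  show "trivial (triv_cc C t)" by (simp add: trivial_def)
  show "rooted_comp_cat (triv_cc C t)"
  proof (intro rooted_comp_cat.intro comp_cat.intro rooted_comp_cat_axioms.intro, unfold triv_cc_sel)
    show "fibration (arrow_cat C) C (cod_functor C)"
      using pb by (simp add: fibration_cod_iff C)
    show "is_functor (arrow_cat C) (arrow_cat C) (id_functor (arrow_cat C))"
      by (rule is_functor_id_functor[OF category_arrow_cat[OF C]])
    show "comp_functor (arrow_cat C) (cod_functor C) (id_functor (arrow_cat C)) = cod_functor C"
      by (rule comp_functor_id_right[OF is_functor_cod_functor[OF C]])
    show "pullback_square C (far (id_functor (arrow_cat C)) s)"
      if "cartesian (arrow_cat C) C (cod_functor C) s" for s
    proof -
      from that have s: "s \<in> Ar (arrow_cat C)" by (simp add: cartesian_def)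
      with that show ?thesis by (simp add: cartesian_cod_iff[OF C])
    qed
    show "terminal C t" by fact
    fix x assume x: "x \<in> Ob C"
    then obtain f where f: "f \<in> homset C x t" using t by (metis terminal_def)
    have "ctx_ext (triv_cc C t) f \<in> iterated_ext (triv_cc C t)"
      using f iterated_ext.root[of "triv_cc C t"] by (intro iterated_ext.extend) auto
    moreover have "isomorphic C x x"
      unfolding isomorphic_def using x by (intro bexI[of _ "Idn C x"]) auto
    ultimately show "\<exists>\<Gamma> \<in> iterated_ext (triv_cc C t). isomorphic C x \<Gamma>"
      using f by (auto simp: ctx_ext_def)
  qed
qed

text \<open>\<open>Proj\<close> is recovered from \<open>cod_Chi\<close>, so base and root determine
  the whole record. This is injectivity of forgetting on 0-cells.\<close>

lemma trivial_rooted_comp_cat: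
  assumes "rooted_comp_cat X" "trivial X"
  shows "category (Base X)" "has_pullbacks (Base X)" "terminal (Base X) (Root X)"
    and "X = triv_cc (Base X) (Root X)"
proof -
  interpret rooted_comp_cat X by fact
  show C: "category (Base X)" by (rule P.D.category_axioms)
  have "Proj X = cod_functor (Base X)"
    using cod_Chi assms(2) comp_functor_id_right[OF is_functor_cod_functor[OF C]]
    by (simp add: trivial_def)
  then show "X = triv_cc (Base X) (Root X)" "has_pullbacks (Base X)"
    using assms(2) fibration_cod_iff[OF C] Proj_fibration by (auto simp: triv_cc_def trivial_def)
  show "terminal (Base X) (Root X)" by (rule Root_terminal)
qed

subsection \<open>Strict maps\<close>

text \<open>A pointwise form suited to composition. Once the two functors agree, domain, codomain
  and bottom edge of each comparison square are those of an identity, so only the top edges remain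
  to be compared.\<close>

lemma strict_iff:
  assumes "pseudo_map' X Y M"
  shows "strict X Y M \<longleftrightarrow>
    (\<forall>A \<in> Ob (Tot X). fob (Chi Y) (fob (mtotal M) A) = far (mbase M) (fob (Chi X) A)) \<and>
    (\<forall>f \<in> Ar (Tot X). far (Chi Y) (far (mtotal M) f) = map_square (far (mbase M)) (far (Chi X) f)) \<and>
    (\<forall>A \<in> Ob (Tot X). sq_top (mcomp M A) = Idn (Base Y) (ctx_ext Y (fob (mtotal M) A)))"
    (is "_ \<longleftrightarrow> ?O \<and> ?A \<and> ?T")
proof -
  interpret pseudo_map' X Y M by fact
  have 1: "comp_functor (Tot X) (Chi Y) (mtotal M) =
      comp_functor (Tot X) (arrow_functor (Base X) (mbase M)) (Chi X) \<longleftrightarrow> ?O \<and> ?A" (is "?L = ?R \<longleftrightarrow> _")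
  proof
    assume "?L = ?R" from comp_functor_eqD[OF this] show "?O \<and> ?A" by simp
  next
    assume "?O \<and> ?A" then show "?L = ?R"
      unfolding comp_functor_def by (intro mk_functor_eqI) auto
  qed
  have 2: "mcomp M = nt_id (Tot X) (arrow_cat (Base Y)) ?L \<longleftrightarrow> ?T" if O: ?O
  proof
    assume "mcomp M = nt_id (Tot X) (arrow_cat (Base Y)) ?L"
    then have "mcomp M A = nt_id (Tot X) (arrow_cat (Base Y)) ?L A" for A by simp
    then show ?T by simp
  next
    have "fob (mbase M) (ctx_ext X A) = ctx_ext Y (fob (mtotal M) A)" if A: "A \<in> Ob (Tot X)" for A
    proof -
      have "Dom (Base Y) (fob (Chi Y) (fob (mtotal M) A)) = Dom (Base Y) (far (mbase M) (fob (Chi X) A))"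
        using O A by simp
      then show ?thesis using A by simp
    qed
    moreover assume ?T
    ultimately show "mcomp M = nt_id (Tot X) (arrow_cat (Base Y)) ?L"
      using O phi.comp_ext by (intro nt_eqI[where C = "Tot X"]) (auto intro!: square_eqI)
  qed
  show ?thesis unfolding strict_def 1 using 2 by blast
qed

lemma strict_id_map:
  assumes "rooted_comp_cat X" shows "strict X X (id_map X)"
proof -
  interpret rooted_comp_cat X by fact
  show ?thesis
    using Chi.is_functor_axioms
    by (simp add: strict_def arrow_functor_id[OF P.D.category_axioms] comp_functor_id_right[OF Chi.is_functor_axioms]
        comp_functor_id_left[OF Chi.is_functor_axioms])
qed

lemma strict_map_comp:
  assumes X: "rooted_comp_cat X" and Y: "rooted_comp_cat Y" and Z: "rooted_comp_cat Z"
    and M: "rooted_pseudo_map X Y M" "strict X Y M" and N: "rooted_pseudo_map Y Z N" "strict Y Z N"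
  shows "strict X Z (map_comp X Y Z N M)"
proof -
  interpret M: pseudo_map' X Y M by (rule rooted_pseudo_map'[OF X Y M(1)])
  interpret N: pseudo_map' Y Z N by (rule rooted_pseudo_map'[OF Y Z N(1)])
  interpret NM: pseudo_map' X Z "map_comp X Y Z N M"
    by (rule rooted_pseudo_map'[OF X Z rooted_pseudo_map_map_comp[OF X Y Z M(1) N(1)]])
  note sM = M(2)[unfolded strict_iff[OF M.pseudo_map'_axioms]]
    and sN = N(2)[unfolded strict_iff[OF N.pseudo_map'_axioms]]
  \<comment> \<open>Strictness preserves context extensions on the nose, so the two identities
    composed in the top edge sit on the same object.\<close>
  have ext: "fob (mbase N) (ctx_ext Y B) = ctx_ext Z (fob (mtotal N) B)" if B: "B \<in> Ob (Tot Y)" for B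
  proof -
    have "Dom (Base Z) (fob (Chi Z) (fob (mtotal N) B)) = Dom (Base Z) (far (mbase N) (fob (Chi Y) B))"
      using sN B by simp
    then show ?thesis using B by simp
  qed
  have "sq_top (mcomp (map_comp X Y Z N M) A) =
      Idn (Base Z) (ctx_ext Z (fob (mtotal (map_comp X Y Z N M)) A))" if A: "A \<in> Ob (Tot X)" for A
    using A sM sN by (simp add: mcomp_map_comp[OF M.pseudo_map'_axioms N.pseudo_map'_axioms A] ext
        del: map_comp_sel(3))
  moreover have "map_square (far (mbase (map_comp X Y Z N M))) (far (Chi X) f) =
      map_square (far (mbase N)) (map_square (far (mbase M)) (far (Chi X) f))" if "f \<in> Ar (Tot X)" for f
    using that arrow_cat_ArD[OF M.X.Chi.far_simps(1)[OF that]] by (intro square_eqI) simp_all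
  ultimately show ?thesis
    unfolding strict_iff[OF NM.pseudo_map'_axioms] using sM sN by simp
qed

definition strict_map :: "('o, 'a) cat \<Rightarrow> ('o, 'a) cat \<Rightarrow> ('o, 'a, 'o, 'a) functr \<Rightarrow> 'a \<Rightarrow>
    ('o, 'a, 'a, 'a square) rooted_compmap" where
  "strict_map C D F r = \<lparr>mbase = F, mtotal = arrow_functor C F,
     mcomp = nt_id (arrow_cat C) (arrow_cat D) (arrow_functor C F), mroot = r\<rparr>"

lemma strict_map_sel [simp]:
  "mbase (strict_map C D F r) = F" "mtotal (strict_map C D F r) = arrow_functor C F"
  "mcomp (strict_map C D F r) = nt_id (arrow_cat C) (arrow_cat D) (arrow_functor C F)"
  "mroot (strict_map C D F r) = r"
  by (simp_all add: strict_map_def)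

text \<open>Here \<open>Chi\<close> is an identity functor on both sides, so the strictness equation
  directly reads \<open>mtotal M = arrow_functor C (mbase M)\<close>.\<close>

lemma strict_triv_cc_iff:
  assumes "rooted_pseudo_map (triv_cc C t) (triv_cc D u) M"
  shows "strict (triv_cc C t) (triv_cc D u) M \<longleftrightarrow> M = strict_map C D (mbase M) (mroot M)"
proof -
  interpret rooted_pseudo_map "triv_cc C t" "triv_cc D u" M by fact
  have F: "is_functor C D (mbase M)" "is_functor (arrow_cat C) (arrow_cat D) (mtotal M)"
    using mbase_functor mtotal_functor by simp_all
  have "strict (triv_cc C t) (triv_cc D u) M \<longleftrightarrow> mtotal M = arrow_functor C (mbase M) \<and>
      mcomp M = nt_id (arrow_cat C) (arrow_cat D) (arrow_functor C (mbase M))"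
    by (auto simp: strict_def comp_functor_id_left[OF F(2)]
        comp_functor_id_right[OF is_functor_arrow_functor[OF F(1)]])
  then show ?thesis
    by (metis strict_map_sel rooted_compmap_eqI)
qed

text \<open>Preservation of cartesian arrows is preservation of pullbacks by
  \<open>cartesian_cod_iff\<close>, and the comparison is an identity.\<close>

lemma rooted_pseudo_map_strict_map:
  assumes F: "is_functor C D F" and pb: "preserves_pullbacks C D F"
    and r: "r \<in> homset D u (fob F t)" "iso_arr D r"
  shows "rooted_pseudo_map (triv_cc C t) (triv_cc D u) (strict_map C D F r)"
proof -
  interpret is_functor C D F by fact
  note AF = is_functor_arrow_functor[OF F]
  interpret AD: category "arrow_cat D" by (rule category_arrow_cat[OF D.category_axioms])
  show ?thesis
  proof (intro rooted_pseudo_map.intro pseudo_map.intro rooted_pseudo_map_axioms.intro,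
      unfold triv_cc_sel strict_map_sel)
    show "comp_functor (arrow_cat C) (cod_functor D) (arrow_functor C F) =
        comp_functor (arrow_cat C) F (cod_functor C)"
      unfolding comp_functor_def by (rule mk_functor_eqI) (auto simp: arrow_cat_ArD)
    show "cartesian (arrow_cat D) D (cod_functor D) (far (arrow_functor C F) f)"
      if "cartesian (arrow_cat C) C (cod_functor C) f" for f
    proof -
      from that have "f \<in> Ar (arrow_cat C)" by (simp add: cartesian_def)
      with that pb show ?thesis
        by (simp add: cartesian_cod_iff C.category_axioms D.category_axioms preserves_pullbacks_def)
    qed
    \<comment> \<open>An identity of the arrow category, in the form to which
      \<open>arrow_cat_simps\<close> rewrites it.\<close>
    have "iso_arr (arrow_cat D) (Square (far F f) (Idn D (fob F (Dom C f))) (Idn D (fob F (Cod C f))) (far F f))"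
      if "f \<in> Ar C" for f
      using AD.iso_arr_Idn[of "far F f"] that by simp
    then show "nat_iso (arrow_cat C) (arrow_cat D)
        (comp_functor (arrow_cat C) (id_functor (arrow_cat D)) (arrow_functor C F))
        (comp_functor (arrow_cat C) (arrow_functor C F) (id_functor (arrow_cat C)))
        (nt_id (arrow_cat C) (arrow_cat D) (arrow_functor C F))"
      by (simp add: comp_functor_id_left[OF AF] comp_functor_id_right[OF AF] nat_iso_def
          nat_trans_nt_id[OF AF])
  qed (use F AF r in simp_all)
qed

section \<open>Limits preserved by the base of a pseudo map\<close>

lemma terminal_iso:
  assumes "category C" and t: "terminal C t" and e: "iso_arr C e" "Dom C e = t"
  shows "terminal C (Cod C e)"
proof -
  interpret category C by fact
  obtain e' where e': "e \<in> Ar C" "e' \<in> Ar C" "Dom C e' = Cod C e" "Cod C e' = Dom C e"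
    "Cmp C e' e = Idn C (Dom C e)" "Cmp C e e' = Idn C (Cod C e)"
    "\<And>h. h \<in> Ar C \<Longrightarrow> Cod C h = Dom C e \<Longrightarrow> Cmp C e' (Cmp C e h) = h"
    "\<And>h. h \<in> Ar C \<Longrightarrow> Cod C h = Cod C e \<Longrightarrow> Cmp C e (Cmp C e' h) = h"
    using iso_arrE[OF e(1)] by blast
  have "\<exists>!f. f \<in> homset C x (Cod C e)" if x: "x \<in> Ob C" for x
  proof -
    obtain f where f: "f \<in> homset C x t" "\<And>g. g \<in> homset C x t \<Longrightarrow> g = f"
      using t x unfolding terminal_def by blast
    show ?thesis
    proof (rule ex1I[of _ "Cmp C e f"])
      show "Cmp C e f \<in> homset C x (Cod C e)" using f(1) e' e by simp
      fix g assume g: "g \<in> homset C x (Cod C e)"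
      then have "Cmp C e' g = f" using e' e by (intro f(2)) simp
      then show "g = Cmp C e f" using e'(8)[of g] g by simp
    qed
  qed
  then show ?thesis using e' by (simp add: terminal_def)
qed

lemma terminal_arrow_iso:
  assumes "category C" "terminal C s" "terminal C t" "f \<in> homset C s t"
  shows "iso_arr C f"
proof -
  interpret category C by fact
  have st: "s \<in> Ob C" "t \<in> Ob C" using assms(2,3) by (simp_all add: terminal_def)
  obtain g where g: "g \<in> homset C t s" using assms(2) st unfolding terminal_def by blast
  have "Cmp C g f = Idn C s"
    by (rule terminal_arrow_unique[OF assms(2), where x = s]) (use assms g st in simp_all)
  moreover have "Cmp C f g = Idn C t"
    by (rule terminal_arrow_unique[OF assms(3), where x = t]) (use assms g st in simp_all)
  ultimately show ?thesis using assms g by (intro iso_arrI[where g = g]) simp_all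
qed

text \<open>One terminal object suffices, because every other is isomorphic to it and functors
  preserve isomorphisms.\<close>

lemma preserves_terminalsI:
  assumes "is_functor C D F" and t: "terminal C t" and Ft: "terminal D (fob F t)"
  shows "preserves_terminals C D F"
  unfolding preserves_terminals_def
proof (intro allI impI)
  interpret is_functor C D F by fact
  fix t' assume t': "terminal C t'"
  have "t \<in> Ob C" using t by (simp add: terminal_def)
  then obtain f where f: "f \<in> homset C t t'" using t' unfolding terminal_def by blast
  have "iso_arr D (far F f)"
    by (rule far_iso[OF terminal_arrow_iso[OF C.category_axioms t t' f]])
  then have "terminal D (Cod D (far F f))"
    using f by (intro terminal_iso[OF D.category_axioms Ft]) simp_all
  then show "terminal D (fob F t')" using f by simp
qed

text \<open>For terminal objects, \<open>mroot M\<close> is an isomorphism from the terminal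
  \<open>u\<close> to \<open>fob (mbase M) t\<close>. For a pullback square \<open>s\<close>,
  \<open>far (mtotal M) s\<close> is cartesian and naturality of \<open>mcomp M\<close> relates it
  to \<open>map_square (far (mbase M)) s\<close>, so \<open>cartesian_iso\<close> transfers the
  property.\<close>

lemma rooted_pseudo_map_triv_ccD:
  assumes M: "rooted_pseudo_map (triv_cc C t) (triv_cc D u) M"
    and t: "terminal C t" and u: "terminal D u"
  shows "is_functor C D (mbase M)" "preserves_pullbacks C D (mbase M)" "preserves_terminals C D (mbase M)"
    "terminal D (fob (mbase M) t)"
proof -
  interpret rooted_pseudo_map "triv_cc C t" "triv_cc D u" M by fact
  show F: "is_functor C D (mbase M)" using mbase_functor by simp
  interpret F: is_functor C D "mbase M" by (rule F)
  have "terminal D (Cod D (mroot M))"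
    using mroot_hom mroot_iso by (intro terminal_iso[OF F.D.category_axioms u]) simp_all
  then show Ft: "terminal D (fob (mbase M) t)" using mroot_hom by simp
  show "preserves_terminals C D (mbase M)" by (rule preserves_terminalsI[OF F t Ft])
  have Ft: "is_functor (arrow_cat C) (arrow_cat D) (mtotal M)" using mtotal_functor by simp
  interpret Ft: is_functor "arrow_cat C" "arrow_cat D" "mtotal M" by (rule Ft)
  note AF = is_functor_arrow_functor[OF F]
  have iso: "nat_iso (arrow_cat C) (arrow_cat D) (mtotal M) (arrow_functor C (mbase M)) (mcomp M)"
    using mcomp_iso by (simp add: comp_functor_id_left[OF Ft] comp_functor_id_right[OF AF])
  then interpret phi: nat_trans "arrow_cat C" "arrow_cat D" "mtotal M" "arrow_functor C (mbase M)" "mcomp M"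
    by (simp add: nat_iso_def)
  interpret cod: is_functor "arrow_cat D" D "cod_functor D" by (rule is_functor_cod_functor[OF F.D.category_axioms])
  note AD = category_arrow_cat[OF F.D.category_axioms]
  \<comment> \<open>The inverse components are extracted as isomorphisms in their own right:
    \<open>cartesian_iso\<close> wants arrows from the image square to the cartesian one, against
    the direction of \<open>mcomp M\<close>.\<close>
  have inv: "\<exists>i. iso_arr (arrow_cat D) i \<and> Dom (arrow_cat D) i = far (mbase M) A \<and>
      Cod (arrow_cat D) i = fob (mtotal M) A \<and> Cmp (arrow_cat D) i (mcomp M A) = Idn (arrow_cat D) (fob (mtotal M) A) \<and>
      Cmp (arrow_cat D) (mcomp M A) i = Idn (arrow_cat D) (far (mbase M) A)" if A: "A \<in> Ar C" for A
  proof -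
    have "iso_arr (arrow_cat D) (mcomp M A)" using iso A by (simp add: nat_iso_def)
    then obtain i where i: "i \<in> homset (arrow_cat D) (Cod (arrow_cat D) (mcomp M A)) (Dom (arrow_cat D) (mcomp M A))"
      "Cmp (arrow_cat D) i (mcomp M A) = Idn (arrow_cat D) (Dom (arrow_cat D) (mcomp M A))"
      "Cmp (arrow_cat D) (mcomp M A) i = Idn (arrow_cat D) (Cod (arrow_cat D) (mcomp M A))"
      unfolding iso_arr_def by blast
    have d: "Dom (arrow_cat D) (mcomp M A) = fob (mtotal M) A" "Cod (arrow_cat D) (mcomp M A) = far (mbase M) A"
      "mcomp M A \<in> Ar (arrow_cat D)"
      using phi.comp_simps[of A] A by simp_all
    have "iso_arr (arrow_cat D) i"
      unfolding iso_arr_def using i d by auto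
    with i show ?thesis unfolding d by auto
  qed
  show "preserves_pullbacks C D (mbase M)"
    unfolding preserves_pullbacks_def
  proof (intro allI impI)
    fix s assume pb: "pullback_square C s"
    then have s: "s \<in> Ar (arrow_cat C)" by (simp add: pullback_square_def)
    note sD = arrow_cat_ArD[OF s]
    have cart: "cartesian (arrow_cat D) D (cod_functor D) (far (mtotal M) s)"
      using mtotal_cartesian[of s] pb by (simp add: cartesian_cod_iff F.C.category_axioms)
    obtain i where i: "iso_arr (arrow_cat D) i" "Dom (arrow_cat D) i = far (mbase M) (sq_dom s)"
      "Cod (arrow_cat D) i = fob (mtotal M) (sq_dom s)"
      "Cmp (arrow_cat D) (mcomp M (sq_dom s)) i = Idn (arrow_cat D) (far (mbase M) (sq_dom s))"
      using inv[OF sD(1)] by blast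
    obtain j where j: "iso_arr (arrow_cat D) j" "Dom (arrow_cat D) j = far (mbase M) (sq_cod s)"
      "Cod (arrow_cat D) j = fob (mtotal M) (sq_cod s)"
      "Cmp (arrow_cat D) j (mcomp M (sq_cod s)) = Idn (arrow_cat D) (fob (mtotal M) (sq_cod s))"
      using inv[OF sD(2)] by blast
    have ij: "i \<in> Ar (arrow_cat D)" "j \<in> Ar (arrow_cat D)"
      using i(1) j(1) by (simp_all add: iso_arr_def)
    let ?q = "far (arrow_functor C (mbase M)) s" and ?p = "far (mtotal M) s"
      and ?d = "mcomp M (sq_dom s)" and ?c = "mcomp M (sq_cod s)"
    have arr: "?q \<in> Ar (arrow_cat D)" "?p \<in> Ar (arrow_cat D)" "?d \<in> Ar (arrow_cat D)" "?c \<in> Ar (arrow_cat D)"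
      "Dom (arrow_cat D) ?q = far (mbase M) (sq_dom s)" "Cod (arrow_cat D) ?q = far (mbase M) (sq_cod s)"
      "Dom (arrow_cat D) ?p = fob (mtotal M) (sq_dom s)" "Cod (arrow_cat D) ?p = fob (mtotal M) (sq_cod s)"
      "Dom (arrow_cat D) ?d = fob (mtotal M) (sq_dom s)" "Cod (arrow_cat D) ?d = far (mbase M) (sq_dom s)"
      "Dom (arrow_cat D) ?c = fob (mtotal M) (sq_cod s)" "Cod (arrow_cat D) ?c = far (mbase M) (sq_cod s)"
      using phi.comp_simps[of "sq_dom s"] phi.comp_simps[of "sq_cod s"] Ft.far_simps[OF s] is_functor.far_simps[OF AF s] s sD
      by (simp_all del: arrow_cat_simps(1,2) add: arrow_cat_simps(1,2)[of s C])
    note assoc = category.Cmp_assoc'[OF AD]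
    let ?C = "Cmp (arrow_cat D)"
    \<comment> \<open>The calculation takes place in \<open>arrow_cat D\<close> as an abstract
      category; unfolding composites into their edges would destroy the terms to which associativity
      and \<open>nat\<close> apply.\<close>
    note del = arrow_cat_simps
    have nat: "?C ?c ?p = ?C ?q ?d"
      using phi.natural'[OF s] s by simp
    \<comment> \<open>As \<open>i\<close> and \<open>j\<close> are inverse to \<open>?d\<close> and
      \<open>?c\<close>: insert \<open>?C ?d i\<close>, exchange by naturality, and cancel
      \<open>?C j ?c\<close>.\<close>
    have "?C j ?q = ?C j (?C ?q (?C ?d i))"
      unfolding i(4) arr(5)[symmetric] by (subst category.Cmp_Idn(1)[OF AD arr(1) refl]) (rule refl)
    also have "\<dots> = ?C j (?C (?C ?q ?d) i)"
      by (subst assoc) (use arr ij i j in \<open>simp_all del: del\<close>)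
    also have "\<dots> = ?C (?C j ?c) (?C ?p i)"
      unfolding nat[symmetric] using arr ij i(1-3) j(1-3) by (simp del: del)
    also have "\<dots> = ?C ?p i"
      unfolding j(4) using arr ij i(1-3) by (simp del: del)
    finally have "cartesian (arrow_cat D) D (cod_functor D) ?q"
      using arr i j by (intro cod.cartesian_iso[OF cart i(1) j(1)]) (simp_all del: del)
    then show "pullback_square D (map_square (far (mbase M)) s)"
      using s by (simp add: cartesian_cod_iff F.D.category_axioms)
  qed
qed

subsection \<open>Transformations of strict maps\<close>

text \<open>The component at \<open>A\<close> is the naturality square of \<alpha> at
  \<open>A\<close>, read as an arrow of the arrow category.\<close>

definition arrow_trans :: "('o, 'a) cat \<Rightarrow> ('o, 'a, 'p, 'b) functr \<Rightarrow> ('o, 'a, 'p, 'b) functr \<Rightarrow> ('o \<Rightarrow> 'b) \<Rightarrow>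
    'a \<Rightarrow> 'b square" where
  "arrow_trans C F G \<alpha> = (\<lambda>A \<in> Ar C. Square (far F A) (\<alpha> (Dom C A)) (\<alpha> (Cod C A)) (far G A))"

lemma nat_trans_arrow_trans:
  assumes "nat_trans C D F G \<alpha>"
  shows "nat_trans (arrow_cat C) (arrow_cat D) (arrow_functor C F) (arrow_functor C G) (arrow_trans C F G \<alpha>)"
proof -
  interpret \<alpha>: nat_trans C D F G \<alpha> by fact
  note AF = is_functor_arrow_functor[OF \<alpha>.F.is_functor_axioms]
    and AG = is_functor_arrow_functor[OF \<alpha>.G.is_functor_axioms]
  have Ar: "arrow_trans C F G \<alpha> A \<in> Ar (arrow_cat D)" "sq_dom (arrow_trans C F G \<alpha> A) = far F A"
    "sq_cod (arrow_trans C F G \<alpha> A) = far G A"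
    "sq_top (arrow_trans C F G \<alpha> A) = \<alpha> (Dom C A)" "sq_bot (arrow_trans C F G \<alpha> A) = \<alpha> (Cod C A)"
    if "A \<in> Ar C" for A
    using that by (auto simp: arrow_trans_def arrow_cat_Ar \<alpha>.natural')
  show ?thesis
  proof (rule nat_transI[OF AF AG])
    show "arrow_trans C F G \<alpha> \<in> extensional (Ob (arrow_cat C))" by (simp add: arrow_trans_def)
    fix s assume s: "s \<in> Ar (arrow_cat C)"
    note sD = arrow_cat_ArD[OF s]
    have "Cmp D (\<alpha> (Dom C (sq_cod s))) (far F (sq_top s)) = Cmp D (far G (sq_top s)) (\<alpha> (Dom C (sq_dom s)))"
      "Cmp D (\<alpha> (Cod C (sq_cod s))) (far F (sq_bot s)) = Cmp D (far G (sq_bot s)) (\<alpha> (Cod C (sq_dom s)))"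
      using sD by (simp_all add: \<alpha>.natural')
    then show "Cmp (arrow_cat D) (arrow_trans C F G \<alpha> (Cod (arrow_cat C) s)) (far (arrow_functor C F) s) =
        Cmp (arrow_cat D) (far (arrow_functor C G) s) (arrow_trans C F G \<alpha> (Dom (arrow_cat C) s))"
      using s sD Ar by simp
  qed (simp_all add: Ar)
qed

text \<open>\<open>total_over\<close> fixes the bottom edge of each component of
  \<open>\<alpha>'\<close>, and \<open>comp_compat\<close>, in which both comparisons are
  identities, fixes the top edge. The total part of a 2-cell is therefore no extra data.\<close>

lemma comp_cell_strict_map_iff:
  assumes t: "terminal C t" and u: "terminal D u"
    and M: "rooted_pseudo_map (triv_cc C t) (triv_cc D u) (strict_map C D F r)"
    and N: "rooted_pseudo_map (triv_cc C t) (triv_cc D u) (strict_map C D G s)"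
  shows "comp_cell_between (triv_cc C t) (triv_cc D u) (strict_map C D F r) (strict_map C D G s) \<alpha> \<alpha>' \<longleftrightarrow>
    nat_trans C D F G \<alpha> \<and> \<alpha>' = arrow_trans C F G \<alpha>"
proof -
  note F = rooted_pseudo_map_triv_ccD[OF M t u, simplified] and G = rooted_pseudo_map_triv_ccD[OF N t u, simplified]
  interpret F: is_functor C D F by (rule F)
  interpret G: is_functor C D G by (rule G)
  have root: "t \<in> Ob C" "u \<in> Ob D" using t u by (simp_all add: terminal_def)
  have rs: "r \<in> homset D u (fob F t)" "s \<in> homset D u (fob G t)"
    using mroot_simps[OF M] mroot_simps[OF N] by simp_all
  show ?thesis
  proof
    assume "comp_cell_between (triv_cc C t) (triv_cc D u) (strict_map C D F r) (strict_map C D G s) \<alpha> \<alpha>'"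
    note c = comp_cell_betweenD[OF this, simplified]
    interpret c: rooted_comp_trans "triv_cc C t" "triv_cc D u" "strict_map C D F r" "strict_map C D G s" \<alpha> \<alpha>'
      by (rule c(3))
    interpret \<alpha>: nat_trans C D F G \<alpha> by (rule c(4))
    interpret \<alpha>': nat_trans "arrow_cat C" "arrow_cat D" "arrow_functor C F" "arrow_functor C G" \<alpha>' by (rule c(5))
    have "\<alpha>' = arrow_trans C F G \<alpha>"
    proof (rule nt_eqI[where C = "arrow_cat C"])
      fix A assume "A \<in> Ob (arrow_cat C)"
      then have A: "A \<in> Ar C" by simp
      have sq: "\<alpha>' A \<in> Ar (arrow_cat D)" using \<alpha>'.comp_simps(1)[of A] A by simp
      have d: "sq_dom (\<alpha>' A) = far F A" "sq_cod (\<alpha>' A) = far G A"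
        using \<alpha>'.comp_simps(2,3)[of A] A sq by simp_all
      have "sq_bot (\<alpha>' A) = \<alpha> (Cod C A)" using c.total_over[of A] A sq by simp
      moreover have "sq_top (\<alpha>' A) = \<alpha> (Dom C A)"
        using c.comp_compat[of A] A sq arrow_cat_ArD[OF sq] d by (simp add: ctx_ext_def)
      ultimately show "\<alpha>' A = arrow_trans C F G \<alpha> A"
        using A d by (intro square_eqI) (simp_all add: arrow_trans_def)
    qed (use \<alpha>'.comp_ext in \<open>simp_all add: arrow_trans_def\<close>)
    with c(4) show "nat_trans C D F G \<alpha> \<and> \<alpha>' = arrow_trans C F G \<alpha>" by blast
  next
    assume *: "nat_trans C D F G \<alpha> \<and> \<alpha>' = arrow_trans C F G \<alpha>"
    then interpret \<alpha>: nat_trans C D F G \<alpha> by blast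
    note AT = nat_trans_arrow_trans[OF \<alpha>.nat_trans_axioms]
    interpret AT: nat_trans "arrow_cat C" "arrow_cat D" "arrow_functor C F" "arrow_functor C G" "arrow_trans C F G \<alpha>"
      by (rule AT)
    have AA: "arrow_trans C F G \<alpha> A \<in> Ar (arrow_cat D)" if "A \<in> Ar C" for A
      using AT.comp_simps(1)[of A] that by simp
    have AS: "sq_top (arrow_trans C F G \<alpha> A) = \<alpha> (Dom C A)" "sq_bot (arrow_trans C F G \<alpha> A) = \<alpha> (Cod C A)"
      if "A \<in> Ar C" for A using that by (simp_all add: arrow_trans_def)
    \<comment> \<open>The root condition holds automatically, as both sides are arrows into the
      terminal object \<open>fob G t\<close>.\<close>
    have "Cmp D (\<alpha> t) r = s"
      by (rule terminal_arrow_unique[OF G(4)]) (use rs root in simp_all)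
    with * show "comp_cell_between (triv_cc C t) (triv_cc D u) (strict_map C D F r) (strict_map C D G s) \<alpha> \<alpha>'"
      unfolding comp_cell_between_def using M N AT
      by (intro conjI rooted_comp_transI) (simp_all add: AA AS ctx_ext_def)
  qed
qed

section \<open>The 2-categories in question\<close>

lemma full_sub_simps [simp]:
  "TOb (full_sub_two_cat K P) = TOb K \<inter> P" "THom (full_sub_two_cat K P) = THom K"
  "TId (full_sub_two_cat K P) = TId K" "TComp (full_sub_two_cat K P) = TComp K"
  by (simp_all add: full_sub_two_cat_def)

lemma Lex_simps [simp]:
  "X \<in> TOb Lex \<longleftrightarrow> category (fst X) \<and> has_finite_limits (fst X) \<and> terminal (fst X) (snd X)"
  "THom Lex X Y = full_subcat (functor_cat (fst X) (fst Y)) {F. preserves_finite_limits (fst X) (fst Y) F}"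
  "TId Lex X = id_functor (fst X)"
  by (auto simp: Lex_def terminal_def split: prod.splits)

lemma Lex_TComp [simp]:
  "is_functor (fst X) (fst Y) F \<Longrightarrow> preserves_finite_limits (fst X) (fst Y) F \<Longrightarrow>
    is_functor (fst Y) (fst Z) G \<Longrightarrow> preserves_finite_limits (fst Y) (fst Z) G \<Longrightarrow>
    TComp1 Lex X Y Z G F = comp_functor (fst X) G F"
  "nat_trans (fst X) (fst Y) F F' \<alpha> \<Longrightarrow> preserves_finite_limits (fst X) (fst Y) F \<Longrightarrow>
    preserves_finite_limits (fst X) (fst Y) F' \<Longrightarrow> nat_trans (fst Y) (fst Z) G G' \<beta> \<Longrightarrow>
    preserves_finite_limits (fst Y) (fst Z) G \<Longrightarrow> preserves_finite_limits (fst Y) (fst Z) G' \<Longrightarrow>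
    TComp2 Lex X Y Z (Cell G G' \<beta>) (Cell F F' \<alpha>) =
      Cell (comp_functor (fst X) G F) (comp_functor (fst X) G' F')
        (nt_hcomp (fst X) (fst Z) G F' \<beta> \<alpha>)"
  unfolding Lex_def by (subst locally_full_sub_TComp; auto split: prod.splits)+

lemma preserves_finite_limits_id:
  assumes "category C" "has_finite_limits C" shows "preserves_finite_limits C C (id_functor C)"
  using preserves_finite_limits_iff[OF is_functor_id_functor[OF assms(1)] assms(2)]
  by (simp add: preserves_pullbacks_id preserves_terminals_def terminal_def)

lemma preserves_finite_limits_comp:
  assumes F: "is_functor C D F" and G: "is_functor D E G"
    and C: "has_finite_limits C" and D: "has_finite_limits D"
    and pF: "preserves_finite_limits C D F" and pG: "preserves_finite_limits D E G"
  shows "preserves_finite_limits C E (comp_functor C G F)"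
proof -
  note pF = pF[unfolded preserves_finite_limits_iff[OF F C]]
    and pG = pG[unfolded preserves_finite_limits_iff[OF G D]]
  have "preserves_pullbacks C E (comp_functor C G F)"
    unfolding preserves_pullbacks_def
  proof (intro allI impI)
    fix s assume s: "pullback_square C s"
    then have "s \<in> Ar (arrow_cat C)" by (simp add: pullback_square_def)
    then have "map_square (far (comp_functor C G F)) s = map_square (far G) (map_square (far F) s)"
      by (intro square_eqI) (auto simp: arrow_cat_ArD)
    with s pF pG show "pullback_square E (map_square (far (comp_functor C G F)) s)"
      by (simp add: preserves_pullbacks_def)
  qed
  moreover have "preserves_terminals C E (comp_functor C G F)"
    unfolding preserves_terminals_def
  proof (intro allI impI)
    fix t assume t: "terminal C t"
    then have "t \<in> Ob C" by (simp add: terminal_def)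
    with t pF pG show "terminal E (fob (comp_functor C G F) t)"
      by (simp add: preserves_terminals_def)
  qed
  ultimately show ?thesis
    by (simp add: preserves_finite_limits_iff[OF is_functor_comp_functor[OF F G] C])
qed

lemma two_category_Lex: "two_category Lex"
  unfolding Lex_def
  by (rule two_category_locally_full_sub[OF two_category_full_sub[OF two_category_Cat_pt]])
    (auto simp: preserves_finite_limits_id preserves_finite_limits_comp)

lemma CompCat_rtd_triv_simps [simp]:
  "X \<in> TOb CompCat_rtd_triv \<longleftrightarrow> rooted_comp_cat X \<and> trivial X"
  "THom CompCat_rtd_triv X Y = comp_hom X Y"
  "TId CompCat_rtd_triv X = id_map X"
  "TComp CompCat_rtd_triv = TComp CompCat_rtd"
  by (auto simp: CompCat_rtd_triv_def)

lemma CompCat_str2_simps [simp]: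
  "X \<in> TOb CompCat_str2_rtd_triv \<longleftrightarrow> rooted_comp_cat X \<and> trivial X"
  "THom CompCat_str2_rtd_triv X Y = full_subcat (comp_hom X Y) {M. strict X Y M}"
  "TId CompCat_str2_rtd_triv X = id_map X"
  by (auto simp: CompCat_str2_rtd_triv_def)

lemma CompCat_str2_TComp [simp]:
  "rooted_pseudo_map X Y M \<Longrightarrow> strict X Y M \<Longrightarrow> rooted_pseudo_map Y Z N \<Longrightarrow> strict Y Z N \<Longrightarrow>
    TComp1 CompCat_str2_rtd_triv X Y Z N M = map_comp X Y Z N M"
  "comp_cell_between X Y M M' \<alpha> \<alpha>' \<Longrightarrow> strict X Y M \<Longrightarrow> strict X Y M' \<Longrightarrow>
    comp_cell_between Y Z N N' \<beta> \<beta>' \<Longrightarrow> strict Y Z N \<Longrightarrow> strict Y Z N' \<Longrightarrow>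
    TComp2 CompCat_str2_rtd_triv X Y Z (Cell N N' (\<beta>, \<beta>')) (Cell M M' (\<alpha>, \<alpha>')) =
      Cell (map_comp X Y Z N M) (map_comp X Y Z N' M')
        (nt_hcomp (Base X) (Base Z) (mbase N) (mbase M') \<beta> \<alpha>,
         nt_hcomp (Tot X) (Tot Z) (mtotal N) (mtotal M') \<beta>' \<alpha>')"
  unfolding CompCat_str2_rtd_triv_def by (subst locally_full_sub_TComp; auto)+

lemma two_category_CompCat_rtd_triv: "two_category CompCat_rtd_triv"
  unfolding CompCat_rtd_triv_def by (rule two_category_full_sub[OF two_category_CompCat_rtd])

lemma two_category_CompCat_str2_rtd_triv: "two_category CompCat_str2_rtd_triv"
  unfolding CompCat_str2_rtd_triv_def
  by (rule two_category_locally_full_sub[OF two_category_CompCat_rtd_triv])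
    (auto simp: strict_id_map strict_map_comp)

subsection \<open>The isomorphism\<close>

text \<open>Directed towards \<open>Lex\<close>, because the other direction would have to choose a
  root isomorphism for every 1-cell.\<close>

definition forget :: "(('o, 'a, 'a, 'a square) rooted_compcat, ('o, 'a, 'a, 'a square) rooted_compmap,
    ('o, 'a, 'a, 'a square) comp_cell, ('o, 'a) cat \<times> 'o, ('o, 'a, 'o, 'a) functr,
    (('o, 'a, 'o, 'a) functr, 'o \<Rightarrow> 'a) cell) two_functr" where
  "forget = \<lparr>Fob = (\<lambda>X. (Base X, Root X)),
     Fhom = (\<lambda>X Y. mk_functor (THom CompCat_str2_rtd_triv X Y) mbase
       (\<lambda>s. Cell (mbase (src s)) (mbase (tgt s)) (fst (comps s))))\<rparr>"

lemma forget_Fob [simp]: "Fob forget X = (Base X, Root X)"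
  by (simp add: forget_def)

lemma forget_Fhom [simp]:
  "rooted_pseudo_map X Y M \<Longrightarrow> strict X Y M \<Longrightarrow> fob (Fhom forget X Y) M = mbase M"
  "comp_cell_between X Y M N \<alpha> \<alpha>' \<Longrightarrow> strict X Y M \<Longrightarrow> strict X Y N \<Longrightarrow>
    far (Fhom forget X Y) (Cell M N (\<alpha>, \<alpha>')) = Cell (mbase M) (mbase N) \<alpha>"
  by (simp_all add: forget_def)

lemma trivial_cases:
  assumes "rooted_comp_cat X" "trivial X"
  obtains C t where "X = triv_cc C t" "category C" "has_finite_limits C" "has_pullbacks C" "terminal C t"
  using trivial_rooted_comp_cat[OF assms] has_finite_limits_iff that by metis

lemma mbase_lex:
  assumes "rooted_comp_cat X" "trivial X" "rooted_comp_cat Y" "trivial Y" "rooted_pseudo_map X Y M"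
  shows "is_functor (Base X) (Base Y) (mbase M)" "preserves_finite_limits (Base X) (Base Y) (mbase M)"
proof -
  obtain C t where X: "X = triv_cc C t" "has_finite_limits C" "terminal C t"
    using trivial_cases[OF assms(1,2)] by metis
  obtain D u where Y: "Y = triv_cc D u" "terminal D u"
    using trivial_cases[OF assms(3,4)] by metis
  note M = rooted_pseudo_map_triv_ccD[OF assms(5)[unfolded X(1) Y(1)] X(3) Y(2)]
  show "is_functor (Base X) (Base Y) (mbase M)" "preserves_finite_limits (Base X) (Base Y) (mbase M)"
    using M preserves_finite_limits_iff[OF M(1) X(2)] by (simp_all add: X(1) Y(1))
qed

lemma two_functor_forget: "two_functor CompCat_str2_rtd_triv Lex forget"
proof (intro two_functor.intro two_functor_axioms.intro two_category_CompCat_str2_rtd_triv two_category_Lex)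
  fix X :: "('a, 'b, 'b, 'b square) rooted_compcat"
  assume X: "X \<in> TOb CompCat_str2_rtd_triv"
  then have X': "rooted_comp_cat X" "trivial X" by simp_all
  obtain C t where "X = triv_cc C t" "category C" "has_finite_limits C" "terminal C t"
    using trivial_cases[OF X'] by metis
  then show "Fob forget X \<in> TOb Lex" by simp
  show "fob (Fhom forget X X) (TId CompCat_str2_rtd_triv X) = TId Lex (Fob forget X)"
    using X by (simp add: rooted_pseudo_map_id_map strict_id_map)
next
  fix X Y :: "('a, 'b, 'b, 'b square) rooted_compcat"
  assume XY: "X \<in> TOb CompCat_str2_rtd_triv" "Y \<in> TOb CompCat_str2_rtd_triv"
  then have XY': "rooted_comp_cat X" "trivial X" "rooted_comp_cat Y" "trivial Y" by simp_all
  note D = comp_cell_betweenD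
  show "is_functor (THom CompCat_str2_rtd_triv X Y) (THom Lex (Fob forget X) (Fob forget Y)) (Fhom forget X Y)"
    unfolding forget_def two_functr.simps
    by (rule is_functor_mk_functor)
      (auto simp: category_full_subcat category_comp_hom category_functor_cat XY' mbase_lex[OF XY']
        comp_cell_between_id comp_cell_between_vcomp nat_trans_nt_id nat_trans_nt_vcomp[OF D(4) D(4)]
        D(4) mbase_lex(2)[OF XY' D(1)] mbase_lex(2)[OF XY' D(2)])
next
  fix X Y Z :: "('a, 'b, 'b, 'b square) rooted_compcat" and f g
  assume XYZ: "X \<in> TOb CompCat_str2_rtd_triv" "Y \<in> TOb CompCat_str2_rtd_triv" "Z \<in> TOb CompCat_str2_rtd_triv"
    and fg: "f \<in> Ob (THom CompCat_str2_rtd_triv X Y)" "g \<in> Ob (THom CompCat_str2_rtd_triv Y Z)"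
  then show "fob (Fhom forget X Z) (TComp1 CompCat_str2_rtd_triv X Y Z g f) =
     TComp1 Lex (Fob forget X) (Fob forget Y) (Fob forget Z) (fob (Fhom forget Y Z) g) (fob (Fhom forget X Y) f)"
    by (simp add: rooted_pseudo_map_map_comp strict_map_comp mbase_lex)
next
  fix X Y Z :: "('a, 'b, 'b, 'b square) rooted_compcat" and s t
  assume XYZ: "X \<in> TOb CompCat_str2_rtd_triv" "Y \<in> TOb CompCat_str2_rtd_triv" "Z \<in> TOb CompCat_str2_rtd_triv"
    and st: "s \<in> Ar (THom CompCat_str2_rtd_triv X Y)" "t \<in> Ar (THom CompCat_str2_rtd_triv Y Z)"
  obtain M M' \<alpha> \<alpha>' where s: "s = Cell M M' (\<alpha>, \<alpha>')" "comp_cell_between X Y M M' \<alpha> \<alpha>'" "strict X Y M" "strict X Y M'"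
    using st(1) by auto
  obtain N N' \<beta> \<beta>' where t: "t = Cell N N' (\<beta>, \<beta>')" "comp_cell_between Y Z N N' \<beta> \<beta>'" "strict Y Z N" "strict Y Z N'"
    using st(2) by auto
  show "far (Fhom forget X Z) (TComp2 CompCat_str2_rtd_triv X Y Z t s) =
     TComp2 Lex (Fob forget X) (Fob forget Y) (Fob forget Z) (far (Fhom forget Y Z) t) (far (Fhom forget X Y) s)"
    using XYZ s(2-) t(2-) comp_cell_betweenD[OF s(2)] comp_cell_betweenD[OF t(2)] unfolding s(1) t(1)
    by (simp add: comp_cell_between_hcomp strict_map_comp mbase_lex)
qed

text \<open>Surjectivity of \<open>forget\<close> on 1-cells: the missing root isomorphism is the
  arrow between the terminal objects \<open>u\<close> and \<open>fob F t\<close>.\<close>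

lemma strict_map_ex:
  assumes C: "has_finite_limits C" and t: "terminal C t" and u: "terminal D u"
    and F: "is_functor C D F" "preserves_finite_limits C D F"
  shows "\<exists>r. rooted_pseudo_map (triv_cc C t) (triv_cc D u) (strict_map C D F r)"
proof -
  interpret is_functor C D F by fact
  note p = F(2)[unfolded preserves_finite_limits_iff[OF F(1) C]]
  have Ft: "terminal D (fob F t)" using p t by (simp add: preserves_terminals_def)
  have "u \<in> Ob D" using u by (simp add: terminal_def)
  then obtain r where r: "r \<in> homset D u (fob F t)" using Ft unfolding terminal_def by blast
  with rooted_pseudo_map_strict_map[OF F(1) conjunct1[OF p] r] terminal_arrow_iso[OF D.category_axioms u Ft r]
  show ?thesis by blast
qed

text \<open>Injectivity of \<open>forget\<close> on 1-cells: both root isomorphisms are arrows into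
  the terminal object \<open>fob F t\<close>.\<close>

lemma strict_map_unique:
  assumes t: "terminal C t" and u: "terminal D u"
    and r: "rooted_pseudo_map (triv_cc C t) (triv_cc D u) (strict_map C D F r)"
    and s: "rooted_pseudo_map (triv_cc C t) (triv_cc D u) (strict_map C D F s)"
  shows "r = s"
proof -
  have "u \<in> Ob D" using u by (simp add: terminal_def)
  then show ?thesis
    using rooted_pseudo_map_triv_ccD(4)[OF r t u] mroot_simps[OF r] mroot_simps[OF s]
    by (intro terminal_arrow_unique[where C = D and t = "fob F t" and x = u]) simp_all
qed

lemma isomorphic_Lex_CompCat_str2:
  "isomorphic_two_cats (Lex :: ('o, 'a) lex_two_cat) (CompCat_str2_rtd_triv :: ('o, 'a) triv_two_cat)"
proof (rule isomorphic_two_cats_of_bij[OF two_functor_forget])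
  show "bij_betw (Fob forget) (TOb (CompCat_str2_rtd_triv :: ('o, 'a) triv_two_cat)) (TOb (Lex :: ('o, 'a) lex_two_cat))"
  proof (rule bij_betw_byWitness[where f' = "\<lambda>(C, t). triv_cc C t"])
    show "\<forall>X \<in> TOb CompCat_str2_rtd_triv. (case Fob forget X of (C, t) \<Rightarrow> triv_cc C t) = X"
      by (auto elim!: trivial_cases)
    show "Fob forget ` TOb CompCat_str2_rtd_triv \<subseteq> TOb Lex"
      using two_functor.Fob_ob[OF two_functor_forget] by blast
    show "(\<lambda>(C, t). triv_cc C t) ` TOb Lex \<subseteq> TOb CompCat_str2_rtd_triv"
      by (auto simp: has_finite_limits_iff rooted_comp_cat_triv_cc)
  qed auto
  fix X Y :: "('o, 'a, 'a, 'a square) rooted_compcat"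
  assume "X \<in> TOb CompCat_str2_rtd_triv" "Y \<in> TOb CompCat_str2_rtd_triv"
  then obtain C t D u where X: "X = triv_cc C t" "has_finite_limits C" "terminal C t"
    and Y: "Y = triv_cc D u" "has_finite_limits D" "terminal D u"
    using trivial_cases[of X] trivial_cases[of Y] by (metis CompCat_str2_simps(1))
  have XY: "X \<in> TOb CompCat_str2_rtd_triv" "Y \<in> TOb CompCat_str2_rtd_triv" by fact+
  interpret F: is_functor "THom CompCat_str2_rtd_triv X Y" "THom Lex (Fob forget X) (Fob forget Y)" "Fhom forget X Y"
    by (rule two_functor.Fhom_functor[OF two_functor_forget XY])
  let ?P = "rooted_pseudo_map (triv_cc C t) (triv_cc D u)"
  have strict: "M = strict_map C D (mbase M) (mroot M)" if "?P M" "strict (triv_cc C t) (triv_cc D u) M" for M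
    using that strict_triv_cc_iff[OF that(1)] by blast
  have strict': "strict (triv_cc C t) (triv_cc D u) (strict_map C D G r)" if "?P (strict_map C D G r)" for G r
    using strict_triv_cc_iff[OF that] by simp
  \<comment> \<open>A strict map is rebuilt from its base and its root isomorphism, and the latter
    is determined by the base.\<close>
  have inj: "M = N" if M: "?P M" "strict (triv_cc C t) (triv_cc D u) M"
    and N: "?P N" "strict (triv_cc C t) (triv_cc D u) N" and eq: "mbase M = mbase N" for M N
  proof -
    note M' = strict[OF M] and N' = strict[OF N]
    have "mroot M = mroot N"
      using M(1) N(1) M' N' eq by (intro strict_map_unique[OF X(3) Y(3), where F = "mbase M"]) metis+
    then show ?thesis using M' N' eq by metis
  qed
  show "bij_betw (fob (Fhom forget X Y)) (Ob (THom CompCat_str2_rtd_triv X Y))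
      (Ob (THom Lex (Fob forget X) (Fob forget Y)))"
  proof (rule bij_betw_imageI)
    show "inj_on (fob (Fhom forget X Y)) (Ob (THom CompCat_str2_rtd_triv X Y))"
      using inj by (auto intro!: inj_onI simp: X(1) Y(1))
    show "fob (Fhom forget X Y) ` Ob (THom CompCat_str2_rtd_triv X Y) = Ob (THom Lex (Fob forget X) (Fob forget Y))"
    proof (intro equalityI subsetI)
      fix G assume G: "G \<in> Ob (THom Lex (Fob forget X) (Fob forget Y))"
      then obtain r where r: "?P (strict_map C D G r)"
        using strict_map_ex[OF X(2,3) Y(3)] by (auto simp: X(1) Y(1))
      then show "G \<in> fob (Fhom forget X Y) ` Ob (THom CompCat_str2_rtd_triv X Y)"
        using strict'[OF r] by (intro image_eqI[of _ _ "strict_map C D G r"]) (simp_all add: X(1) Y(1))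
    qed (use F.fob_Ob in blast)
  qed
  show "bij_betw (far (Fhom forget X Y)) (Ar (THom CompCat_str2_rtd_triv X Y))
      (Ar (THom Lex (Fob forget X) (Fob forget Y)))"
  proof (rule bij_betw_imageI)
    show "inj_on (far (Fhom forget X Y)) (Ar (THom CompCat_str2_rtd_triv X Y))"
    proof (rule inj_onI)
      fix s s' assume s: "s \<in> Ar (THom CompCat_str2_rtd_triv X Y)" and s': "s' \<in> Ar (THom CompCat_str2_rtd_triv X Y)"
        and eq: "far (Fhom forget X Y) s = far (Fhom forget X Y) s'"
      obtain M N \<alpha> \<alpha>' where s: "s = Cell M N (\<alpha>, \<alpha>')" "comp_cell_between X Y M N \<alpha> \<alpha>'"
          "strict X Y M" "strict X Y N"
        using s by auto
      obtain M' N' \<beta> \<beta>' where s': "s' = Cell M' N' (\<beta>, \<beta>')" "comp_cell_between X Y M' N' \<beta> \<beta>'"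
          "strict X Y M'" "strict X Y N'"
        using s' by auto
      have eq': "mbase M = mbase M'" "mbase N = mbase N'" "\<alpha> = \<beta>"
        using eq s s' by simp_all
      have P: "?P M" "?P N" "?P M'" "?P N'"
        using comp_cell_betweenD(1,2)[OF s(2)] comp_cell_betweenD(1,2)[OF s'(2)] by (simp_all add: X(1) Y(1))
      have MN: "M = M'" "N = N'"
        using inj P s(3,4) s'(3,4) eq'(1,2) by (simp_all add: X(1) Y(1))
      have "M = strict_map C D (mbase M) (mroot M)" "N = strict_map C D (mbase N) (mroot N)"
        using strict P s(3,4) by (simp_all add: X(1) Y(1))
      then obtain G r H q where GH: "M = strict_map C D G r" "N = strict_map C D H q" by blast
      \<comment> \<open>Rewrites the two 2-cells between the same strict maps so that both total
        parts become \<open>arrow_trans\<close> of the common base part.\<close>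
      note iff = comp_cell_strict_map_iff[OF X(3) Y(3) P(1,2)[unfolded GH], folded GH, folded X(1) Y(1)]
      have "\<alpha>' = \<beta>'"
        using s(2) s'(2) eq'(3) unfolding MN[symmetric] iff by simp
      then show "s = s'" using s(1) s'(1) MN eq'(3) by simp
    qed
    show "far (Fhom forget X Y) ` Ar (THom CompCat_str2_rtd_triv X Y) = Ar (THom Lex (Fob forget X) (Fob forget Y))"
    proof (intro equalityI subsetI)
      fix c assume "c \<in> Ar (THom Lex (Fob forget X) (Fob forget Y))"
      then obtain G H \<alpha> where c: "c = Cell G H \<alpha>" "nat_trans C D G H \<alpha>"
        "preserves_finite_limits C D G" "preserves_finite_limits C D H"
        by (auto simp: X(1) Y(1))
      note GH = nat_trans_functors[OF c(2)]
      obtain r where r: "?P (strict_map C D G r)" using strict_map_ex[OF X(2,3) Y(3)] c GH by blast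
      obtain q where q: "?P (strict_map C D H q)" using strict_map_ex[OF X(2,3) Y(3)] c GH by blast
      \<comment> \<open>The preimage of a natural transformation: the same base part, with the only
        possible total part.\<close>
      have "comp_cell_between X Y (strict_map C D G r) (strict_map C D H q) \<alpha> (arrow_trans C G H \<alpha>)"
        using comp_cell_strict_map_iff[OF X(3) Y(3) r q] c(2) by (simp add: X(1) Y(1))
      then show "c \<in> far (Fhom forget X Y) ` Ar (THom CompCat_str2_rtd_triv X Y)"
        using strict'[OF r] strict'[OF q]
        by (intro image_eqI[of _ _ "Cell (strict_map C D G r) (strict_map C D H q) (\<alpha>, arrow_trans C G H \<alpha>)"])
          (simp_all add: X(1) Y(1) c(1))
    qed (use F.far_simps(1) in blast)
  qed
qed

subsection \<open>The equivalence\<close>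

text \<open>Pointwise inverses of a natural isomorphism are automatically natural; this form
  provides them as one transformation on the whole of \<open>C\<close>.\<close>

lemma nat_iso_inverse:
  assumes "nat_iso C D F G \<alpha>"
  obtains \<beta> where "nat_trans C D G F \<beta>" "nt_vcomp C D \<beta> \<alpha> = nt_id C D F" "nt_vcomp C D \<alpha> \<beta> = nt_id C D G"
proof -
  interpret \<alpha>: nat_trans C D F G \<alpha> using assms by (simp add: nat_iso_def)
  have "\<exists>b. b \<in> Ar D \<and> Dom D b = fob G x \<and> Cod D b = fob F x \<and>
      Cmp D b (\<alpha> x) = Idn D (fob F x) \<and> Cmp D (\<alpha> x) b = Idn D (fob G x)" if "x \<in> Ob C" for x
  proof -
    have "iso_arr D (\<alpha> x)" using assms that by (simp add: nat_iso_def)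
    then obtain b where "b \<in> homset D (Cod D (\<alpha> x)) (Dom D (\<alpha> x))"
      "Cmp D b (\<alpha> x) = Idn D (Dom D (\<alpha> x))" "Cmp D (\<alpha> x) b = Idn D (Cod D (\<alpha> x))"
      unfolding iso_arr_def by blast
    then show ?thesis using that by (intro exI[of _ b]) simp
  qed
  then have "\<forall>x. \<exists>b. x \<in> Ob C \<longrightarrow> b \<in> Ar D \<and> Dom D b = fob G x \<and> Cod D b = fob F x \<and>
      Cmp D b (\<alpha> x) = Idn D (fob F x) \<and> Cmp D (\<alpha> x) b = Idn D (fob G x)" by blast
  then obtain b where "\<And>x. x \<in> Ob C \<Longrightarrow> b x \<in> Ar D \<and> Dom D (b x) = fob G x \<and> Cod D (b x) = fob F x \<and>
      Cmp D (b x) (\<alpha> x) = Idn D (fob F x) \<and> Cmp D (\<alpha> x) (b x) = Idn D (fob G x)"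
    unfolding choice_iff by blast
  then have b: "b x \<in> Ar D" "Dom D (b x) = fob G x" "Cod D (b x) = fob F x"
    "Cmp D (b x) (\<alpha> x) = Idn D (fob F x)" "Cmp D (\<alpha> x) (b x) = Idn D (fob G x)" if "x \<in> Ob C" for x
    using that by blast+
  have "Cmp D (b (Cod C f)) (far G f) = Cmp D (far F f) (b (Dom C f))" if f: "f \<in> Ar C" for f
  proof -
    \<comment> \<open>Naturality of the inverse: insert the identity
      \<open>Cmp D (\<alpha> (Dom C f)) (b (Dom C f))\<close>, move \<alpha> across by its own
      naturality, and cancel.\<close>
    have "Cmp D (b (Cod C f)) (far G f) =
        Cmp D (b (Cod C f)) (Cmp D (far G f) (Cmp D (\<alpha> (Dom C f)) (b (Dom C f))))"
      using f by (simp add: b)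
    also have "\<dots> = Cmp D (b (Cod C f)) (Cmp D (\<alpha> (Cod C f)) (Cmp D (far F f) (b (Dom C f))))"
      using f by (subst \<alpha>.natural_Cmp[OF f refl refl]) (simp_all add: b)
    also have "\<dots> = Cmp D (Cmp D (b (Cod C f)) (\<alpha> (Cod C f))) (Cmp D (far F f) (b (Dom C f)))"
      using f by (subst \<alpha>.F.D.Cmp_assoc') (simp_all add: b(1-3))
    also have "\<dots> = Cmp D (far F f) (b (Dom C f))"
      using f by (simp add: b)
    finally show ?thesis .
  qed
  then have "nat_trans C D G F (restrict b (Ob C))"
    by (intro nat_transI[OF \<alpha>.G.is_functor_axioms \<alpha>.F.is_functor_axioms]) (simp_all add: b)
  then show thesis
    by (intro that[of "restrict b (Ob C)"] nt_eqI[where C = C]) (simp_all add: b)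
qed

text \<open>\<open>S\<close> keeps base and root isomorphism of \<open>M\<close>, so the identity on
  the base satisfies the root condition in both directions. As the comparison of \<open>S\<close> is
  an identity, \<open>comp_compat\<close> is trivial for \<open>mcomp M\<close>, and for the inverse
  \<psi> it says that \<psi> is a right inverse of \<open>mcomp M\<close> on top edges.\<close>

lemma isomorphic_strict_map:
  assumes C: "has_finite_limits C" and t: "terminal C t" and u: "terminal D u"
    and X: "rooted_comp_cat (triv_cc C t)" and Y: "rooted_comp_cat (triv_cc D u)"
    and M: "rooted_pseudo_map (triv_cc C t) (triv_cc D u) M"
  defines "S \<equiv> strict_map C D (mbase M) (mroot M)"
  shows "rooted_pseudo_map (triv_cc C t) (triv_cc D u) S"
    and "isomorphic (comp_hom (triv_cc C t) (triv_cc D u)) M S"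
proof -
  interpret M: pseudo_map' "triv_cc C t" "triv_cc D u" M by (rule rooted_pseudo_map'[OF X Y M])
  interpret rooted_pseudo_map "triv_cc C t" "triv_cc D u" M by fact
  note F = rooted_pseudo_map_triv_ccD[OF M t u]
  show S: "rooted_pseudo_map (triv_cc C t) (triv_cc D u) S"
    unfolding S_def using mroot_hom mroot_iso by (intro rooted_pseudo_map_strict_map F) simp_all
  interpret F: is_functor C D "mbase M" by (rule F)
  have Ft: "is_functor (arrow_cat C) (arrow_cat D) (mtotal M)" using M.mtotal_functor by simp
  interpret Ft: is_functor "arrow_cat C" "arrow_cat D" "mtotal M" by (rule Ft)
  note AF = is_functor_arrow_functor[OF F(1)]
  have iso: "nat_iso (arrow_cat C) (arrow_cat D) (mtotal M) (arrow_functor C (mbase M)) (mcomp M)"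
    using M.mcomp_iso by (simp add: comp_functor_id_left[OF Ft] comp_functor_id_right[OF AF])
  then have phi: "nat_trans (arrow_cat C) (arrow_cat D) (mtotal M) (arrow_functor C (mbase M)) (mcomp M)"
    by (simp add: nat_iso_def)
  obtain \<psi> where psi: "nat_trans (arrow_cat C) (arrow_cat D) (arrow_functor C (mbase M)) (mtotal M) \<psi>"
    and inv: "nt_vcomp (arrow_cat C) (arrow_cat D) \<psi> (mcomp M) = nt_id (arrow_cat C) (arrow_cat D) (mtotal M)"
      "nt_vcomp (arrow_cat C) (arrow_cat D) (mcomp M) \<psi> =
        nt_id (arrow_cat C) (arrow_cat D) (arrow_functor C (mbase M))"
    by (rule nat_iso_inverse[OF iso])
  interpret psi: nat_trans "arrow_cat C" "arrow_cat D" "arrow_functor C (mbase M)" "mtotal M" \<psi> by (rule psi)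
  let ?id = "nt_id C D (mbase M)"
  have root: "t \<in> Ob C" using t by (simp add: terminal_def)
  have mA: "mcomp M A \<in> Ar (arrow_cat D)" "sq_bot (mcomp M A) = Idn D (fob (mbase M) (Cod C A))"
    "sq_dom (mcomp M A) = fob (mtotal M) A" "sq_cod (mcomp M A) = far (mbase M) A" if "A \<in> Ar C" for A
    using M.mcomp_simps[of A] Ft.fob_Ob[of A] that by simp_all
  \<comment> \<open>The bottom edge of \<psi> is inverse to an identity, hence an identity. This is
    what puts \<psi> over the identity of the base.\<close>
  have pA: "\<psi> A \<in> Ar (arrow_cat D)" "sq_bot (\<psi> A) = Idn D (fob (mbase M) (Cod C A))"
    "Cmp D (sq_top (mcomp M A)) (sq_top (\<psi> A)) = Idn D (fob (mbase M) (Dom C A))" if A: "A \<in> Ar C" for A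
  proof -
    show 1: "\<psi> A \<in> Ar (arrow_cat D)" using psi.comp_simps(1)[of A] A by simp
    then have d: "sq_cod (\<psi> A) = fob (mtotal M) A" "sq_dom (\<psi> A) = far (mbase M) A"
      using psi.comp_simps(2,3)[of A] A by simp_all
    have "Cmp (arrow_cat D) (mcomp M A) (\<psi> A) = Idn (arrow_cat D) (far (mbase M) A)"
      using fun_cong[OF inv(2), of A] A by simp
    then have "Cmp D (sq_top (mcomp M A)) (sq_top (\<psi> A)) = Idn D (fob (mbase M) (Dom C A)) \<and>
        Cmp D (sq_bot (mcomp M A)) (sq_bot (\<psi> A)) = Idn D (fob (mbase M) (Cod C A))"
      using A 1 mA[OF A] d by simp
    moreover have "Cmp D (sq_bot (mcomp M A)) (sq_bot (\<psi> A)) = sq_bot (\<psi> A)"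
      using arrow_cat_ArD[OF 1] arrow_cat_ArD[OF mA(1)[OF A]] mA[OF A] d A
      by simp
    ultimately show "sq_bot (\<psi> A) = Idn D (fob (mbase M) (Cod C A))"
      "Cmp D (sq_top (mcomp M A)) (sq_top (\<psi> A)) = Idn D (fob (mbase M) (Dom C A))" by simp_all
  qed
  have idn: "nat_trans C D (mbase M) (mbase M) ?id" by (rule nat_trans_nt_id[OF F(1)])
  have fwd: "comp_cell_between (triv_cc C t) (triv_cc D u) M S ?id (mcomp M)"
    unfolding comp_cell_between_def
  proof (intro conjI M S rooted_comp_transI)
    fix A assume "A \<in> Ob (Tot (triv_cc C t))"
    then have A: "A \<in> Ar C" by simp
    show "far (Proj (triv_cc D u)) (mcomp M A) = ?id (fob (Proj (triv_cc C t)) A)"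
      using A mA[OF A] by simp
    show "Cmp (Base (triv_cc D u)) (sq_top (mcomp S A)) (sq_top (far (Chi (triv_cc D u)) (mcomp M A))) =
         Cmp (Base (triv_cc D u)) (?id (ctx_ext (triv_cc C t) A)) (sq_top (mcomp M A))"
      using A mA[OF A] by (simp add: S_def ctx_ext_def)
  next
    show "Cmp (Base (triv_cc D u)) (?id (Root (triv_cc C t))) (mroot M) = mroot S"
      using root mroot_simps[OF M] by (simp add: S_def)
  qed (use idn phi in \<open>simp_all add: S_def\<close>)
  have bwd: "comp_cell_between (triv_cc C t) (triv_cc D u) S M ?id \<psi>"
    unfolding comp_cell_between_def
  proof (intro conjI M S rooted_comp_transI)
    fix A assume "A \<in> Ob (Tot (triv_cc C t))"
    then have A: "A \<in> Ar C" by simp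
    show "far (Proj (triv_cc D u)) (\<psi> A) = ?id (fob (Proj (triv_cc C t)) A)"
      using A pA[OF A] by simp
    show "Cmp (Base (triv_cc D u)) (sq_top (mcomp M A)) (sq_top (far (Chi (triv_cc D u)) (\<psi> A))) =
         Cmp (Base (triv_cc D u)) (?id (ctx_ext (triv_cc C t) A)) (sq_top (mcomp S A))"
      using A pA[OF A] by (simp add: S_def ctx_ext_def)
  next
    show "Cmp (Base (triv_cc D u)) (?id (Root (triv_cc C t))) (mroot S) = mroot M"
      using root mroot_simps[OF M] by (simp add: S_def)
  qed (use idn psi in \<open>simp_all add: S_def\<close>)
  have "iso_arr (comp_hom (triv_cc C t) (triv_cc D u)) (Cell M S (?id, mcomp M))"
    by (rule category.iso_arrI[OF category_comp_hom[OF X Y], where g = "Cell S M (?id, \<psi>)"])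
      (use M S fwd bwd in \<open>simp_all add: inv S_def nt_vcomp_id[OF idn]\<close>)
  then show "isomorphic (comp_hom (triv_cc C t) (triv_cc D u)) M S"
    unfolding isomorphic_def using fwd by (intro bexI[of _ "Cell M S (?id, mcomp M)"]) simp_all
qed

lemma equivalent_CompCat_str2:
  "equivalent_two_cats (CompCat_str2_rtd_triv :: ('o, 'a) triv_two_cat) (CompCat_rtd_triv :: ('o, 'a) triv_two_cat)"
  unfolding CompCat_str2_rtd_triv_def
proof (rule equivalent_two_cats_locally_full_sub[OF two_category_CompCat_rtd_triv
      two_category_CompCat_str2_rtd_triv[unfolded CompCat_str2_rtd_triv_def]])
  fix X Y :: "('o, 'a, 'a, 'a square) rooted_compcat" and M
  assume "X \<in> TOb CompCat_rtd_triv" "Y \<in> TOb CompCat_rtd_triv" and M: "M \<in> Ob (THom CompCat_rtd_triv X Y)"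
  then have XY: "rooted_comp_cat X" "trivial X" "rooted_comp_cat Y" "trivial Y" by simp_all
  obtain C t where X: "X = triv_cc C t" "has_finite_limits C" "terminal C t"
    using trivial_cases[OF XY(1,2)] by metis
  obtain D u where Y: "Y = triv_cc D u" "terminal D u"
    using trivial_cases[OF XY(3,4)] by metis
  have M': "rooted_pseudo_map (triv_cc C t) (triv_cc D u) M" using M by (simp add: X(1) Y(1))
  note S = isomorphic_strict_map[OF X(2,3) Y(2) XY(1)[unfolded X(1)] XY(3)[unfolded Y(1)] M']
  show "\<exists>S \<in> Ob (THom CompCat_rtd_triv X Y) \<inter> {M. strict X Y M}. isomorphic (THom CompCat_rtd_triv X Y) M S"
    using S strict_triv_cc_iff[OF S(1)]
    by (intro bexI[of _ "strict_map C D (mbase M) (mroot M)"]) (simp_all add: X(1) Y(1))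
qed

theorem lemma35:
  shows "isomorphic_two_cats (Lex :: ('o, 'a) lex_two_cat)
           (CompCat_str2_rtd_triv :: ('o, 'a) triv_two_cat) \<and>
         equivalent_two_cats (CompCat_str2_rtd_triv :: ('o, 'a) triv_two_cat)
           (CompCat_rtd_triv :: ('o, 'a) triv_two_cat)"
  using isomorphic_Lex_CompCat_str2 equivalent_CompCat_str2 by blast

end
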